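(* Consider the class of equations $$f(x)u_{tt}=(g(x)H(u)u_x)_x+h(x)K(u)u_x$$ for $u=u(t,x)$, with arbitrary elements $f,g,h,H,K$ (smooth real-valued functions of the indicated variables, $f(x)g(x)H(u)\neq0$, $(H_u,K_u)\neq(0,0)$). The extended equivalence transformation group $\hat G^{\sim}$ of this class is formed by the transformations $$\tilde t=\delta_1t+\delta_2,\quad \tilde x=X(x),\quad \tilde u=\delta_3u+\delta_4,$$ $$\tilde f=\frac{\epsilon_1\delta_1^2}{X_x}\,f\,e^{-\epsilon_4\int\frac{h}{g}},\quad \tilde g=\epsilon_1\epsilon_2^{-1}X_x\,g\,e^{-\epsilon_4\int\frac{h}{g}},\quad \tilde h=\epsilon_1\epsilon_3^{-1}\,h\,e^{-\epsilon_4\int\frac{h}{g}},$$ $$\tilde H=\epsilon_2H,\quad \tilde K=\epsilon_3(K+\epsilon_4H),$$ where $\delta_j$ $(j=1,\ldots,4)$ and $\epsilon_i$ $(i=1,\ldots,4)$ are arbitrary constants with $\delta_1\delta_3\epsilon_1\epsilon_2\epsilon_3\neq0$, $X$ is an arbitrary smooth function of $x$ with $X_x\neq0$, and $\int\frac hg=\int\frac{h(x)}{g(x)}\,dx$.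
   Context: The extended equivalence group $\hat G^{\sim}$ of the class consists of the transformations that map every equation of the class for $u=u(t,x)$ with arbitrary elements $(f,g,h,H,K)$ to an equation of the same class for $\tilde u=\tilde u(\tilde t,\tilde x)$ with arbitrary elements $(\tilde f,\tilde g,\tilde h,\tilde H,\tilde K)$ ($\tilde f,\tilde g,\tilde h$ functions of $\tilde x$; $\tilde H,\tilde K$ functions of $\tilde u$), that are (nondegenerate) point transformations with respect to $(t,x,u)$, and in which the new arbitrary elements are determined via $(t,x,u,f,g,h,H,K)$ in some not prescribed, possibly nonlocal (e.g. involving antiderivatives of arbitrary elements), way. An antiderivative $\int h/g$ is fixed up to an additive constant, which can be absorbed into $\epsilon_1$.
   Formalization: New arbitrary elements must depend smoothly on the old (else K could change freely when h=0), and in the "only these" direction the ε_i may vary with the tuple (f,g,h,H,K), as scaling f,g,h by 1+f(x0)² shows; all listed maps with fixed ε_i are proved to belong. *)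

theory Defs
  imports "HOL-Analysis.Analysis"
begin

text \<open>Only meaningful for open \<open>S\<close>: the Frechet derivatives are unrestricted ones, and
  \<open>C_k_on\<close> quantifies over all directional derivatives.\<close>

primrec C_k_on :: "nat \<Rightarrow> 'a::real_normed_vector set \<Rightarrow> ('a \<Rightarrow> 'b::real_normed_vector) \<Rightarrow> bool" where
  "C_k_on 0 S F \<longleftrightarrow> continuous_on S F"
| "C_k_on (Suc k) S F \<longleftrightarrow>
     F differentiable_on S \<and> (\<forall>v. C_k_on k S (\<lambda>p. frechet_derivative F (at p) v))"

definition smooth_on :: "'a::real_normed_vector set \<Rightarrow> ('a \<Rightarrow> 'b::real_normed_vector) \<Rightarrow> bool" where
  "smooth_on S F \<longleftrightarrow> (\<forall>k. C_k_on k S F)"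

definition open_interval :: "real set \<Rightarrow> bool" where
  "open_interval I \<longleftrightarrow> open I \<and> is_interval I \<and> I \<noteq> {}"

definition antiderivative :: "real \<Rightarrow> (real \<Rightarrow> real) \<Rightarrow> real \<Rightarrow> real" where
  "antiderivative x0 k x = (if x0 \<le> x then integral {x0..x} k else - integral {x..x0} k)"

record arb_elements =
  el_f :: "real \<Rightarrow> real"
  el_g :: "real \<Rightarrow> real"
  el_h :: "real \<Rightarrow> real"
  el_H :: "real \<Rightarrow> real"
  el_K :: "real \<Rightarrow> real"

text \<open>Tuples of arbitrary elements over a set \<open>I\<close> of values of \<open>x\<close> and a set \<open>J\<close> of values
  of \<open>u\<close>.  The components are total functions, but only their values on \<open>I\<close> and \<open>J\<close> matter.
  The last conjunct excludes the linear equations, in which both \<open>H\<close> and \<open>K\<close> are constant.\<close>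

definition arb_class :: "real set \<Rightarrow> real set \<Rightarrow> arb_elements set" where
  "arb_class I J = {\<theta>.
     smooth_on I (el_f \<theta>) \<and> smooth_on I (el_g \<theta>) \<and> smooth_on I (el_h \<theta>) \<and>
     smooth_on J (el_H \<theta>) \<and> smooth_on J (el_K \<theta>) \<and>
     (\<forall>x\<in>I. el_f \<theta> x \<noteq> 0 \<and> el_g \<theta> x \<noteq> 0) \<and> (\<forall>u\<in>J. el_H \<theta> u \<noteq> 0) \<and>
     (\<exists>u\<in>J. deriv (el_H \<theta>) u \<noteq> 0 \<or> deriv (el_K \<theta>) u \<noteq> 0)}"

definition D_t :: "(real \<times> real \<Rightarrow> real) \<Rightarrow> real \<times> real \<Rightarrow> real" where
  "D_t w = (\<lambda>(t, x). deriv (\<lambda>s. w (s, x)) t)"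

definition D_x :: "(real \<times> real \<Rightarrow> real) \<Rightarrow> real \<times> real \<Rightarrow> real" where
  "D_x w = (\<lambda>(t, x). deriv (\<lambda>y. w (t, y)) x)"

definition satisfies_at :: "arb_elements \<Rightarrow> (real \<times> real \<Rightarrow> real) \<Rightarrow> real \<times> real \<Rightarrow> bool" where
  "satisfies_at \<theta> u p \<longleftrightarrow>
     el_f \<theta> (snd p) * D_t (D_t u) p =
       D_x (\<lambda>q. el_g \<theta> (snd q) * el_H \<theta> (u q) * D_x u q) p
       + el_h \<theta> (snd p) * el_K \<theta> (u p) * D_x u p"

text \<open>A \<open>point\<close> is a triple \<open>(t, x, u)\<close>.\<close>

type_synonym point = "real \<times> real \<times> real"

definition point_transformation :: "point set \<Rightarrow> (point \<Rightarrow> point) \<Rightarrow> bool" where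
  "point_transformation B \<phi> \<longleftrightarrow>
     smooth_on B \<phi> \<and> (\<forall>p\<in>B. bij (frechet_derivative \<phi> (at p)))"

definition x_range :: "point set \<Rightarrow> (point \<Rightarrow> point) \<Rightarrow> real set" where
  "x_range B \<phi> = (\<lambda>p. fst (snd (\<phi> p))) ` B"

definition u_range :: "point set \<Rightarrow> (point \<Rightarrow> point) \<Rightarrow> real set" where
  "u_range B \<phi> = (\<lambda>p. snd (snd (\<phi> p))) ` B"

definition graph_over :: "(real \<times> real) set \<Rightarrow> (real \<times> real \<Rightarrow> real) \<Rightarrow> point set" where
  "graph_over V u = {(t, x, u (t, x)) | t x. (t, x) \<in> V}"

text \<open>\<open>\<phi>\<close> maps the equation given by \<open>\<theta>\<close> to the equation given by \<open>\<theta>'\<close>.  As usual for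
  differential equations regarded as submanifolds of the jet space, this is required jet by jet:
  \<open>u\<close> ranges over all functions (not only solutions) whose graph lies in \<open>B\<close>, \<open>v\<close> is the
  function whose graph is the \<open>\<phi>\<close>-image of the graph of \<open>u\<close>, and the 2-jet of \<open>u\<close> at a point
  lies on the first equation iff the 2-jet of \<open>v\<close> at the image point lies on the second one.
  In particular, \<open>u\<close> is a solution iff \<open>v\<close> is.\<close>

definition maps_equation ::
    "point set \<Rightarrow> (point \<Rightarrow> point) \<Rightarrow> arb_elements \<Rightarrow> arb_elements \<Rightarrow> bool" where
  "maps_equation B \<phi> \<theta> \<theta>' \<longleftrightarrow>
     (\<forall>V W u v. open V \<and> open W \<and> C_k_on 2 V u \<and> C_k_on 2 W v \<and>
        graph_over V u \<subseteq> B \<and> \<phi> ` graph_over V u = graph_over W v \<longrightarrow>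
        (\<forall>p\<in>V. \<forall>q\<in>W. \<phi> (fst p, snd p, u p) = (fst q, snd q, v q) \<longrightarrow>
           (satisfies_at \<theta> u p \<longleftrightarrow> satisfies_at \<theta>' v q)))"

definition smooth_family :: "real set \<Rightarrow> real set \<Rightarrow> (real \<Rightarrow> arb_elements) \<Rightarrow> bool" where
  "smooth_family I J \<Theta> \<longleftrightarrow> (\<forall>s. \<Theta> s \<in> arb_class I J) \<and>
     smooth_on (UNIV \<times> I) (\<lambda>(s, x). el_f (\<Theta> s) x) \<and>
     smooth_on (UNIV \<times> I) (\<lambda>(s, x). el_g (\<Theta> s) x) \<and>
     smooth_on (UNIV \<times> I) (\<lambda>(s, x). el_h (\<Theta> s) x) \<and>
     smooth_on (UNIV \<times> J) (\<lambda>(s, u). el_H (\<Theta> s) u) \<and>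
     smooth_on (UNIV \<times> J) (\<lambda>(s, u). el_K (\<Theta> s) u)"

text \<open>The new arbitrary elements may depend on the old ones in any way, local or not, that is
  smooth in the sense of mapping smooth one-parameter families to smooth one-parameter families.
  Without any regularity, \<open>\<Psi>\<close> could be redefined at will at the tuples that are not determined
  by their equation: if \<open>h = 0\<close>, for example, then \<open>K\<close> can be replaced by any other function.\<close>

definition smooth_operator ::
    "real set \<Rightarrow> real set \<Rightarrow> real set \<Rightarrow> real set \<Rightarrow> (arb_elements \<Rightarrow> arb_elements) \<Rightarrow> bool" where
  "smooth_operator I J I' J' \<Psi> \<longleftrightarrow>
     (\<forall>\<Theta>. smooth_family I J \<Theta> \<longrightarrow> smooth_family I' J' (\<lambda>s. \<Psi> (\<Theta> s)))"

text \<open>\<open>\<phi>\<close> acts on \<open>(t, x, u)\<close> and does not depend on the arbitrary elements; \<open>\<Psi>\<close> acts on the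
  arbitrary elements.  The new arbitrary elements are considered on the sets of values
  that the new \<open>x\<close> and the new \<open>u\<close> assume.\<close>

definition ext_equiv_group ::
    "real set \<Rightarrow> real set \<Rightarrow> real set \<Rightarrow> ((point \<Rightarrow> point) \<times> (arb_elements \<Rightarrow> arb_elements)) set" where
  "ext_equiv_group It Ix Iu = {(\<phi>, \<Psi>). let B = It \<times> Ix \<times> Iu in
     point_transformation B \<phi> \<and>
     smooth_operator Ix Iu (x_range B \<phi>) (u_range B \<phi>) \<Psi> \<and>
     (\<forall>\<theta>\<in>arb_class Ix Iu. \<Psi> \<theta> \<in> arb_class (x_range B \<phi>) (u_range B \<phi>) \<and>
        maps_equation B \<phi> \<theta> (\<Psi> \<theta>))}"

definition listed_point_map ::
    "real set \<Rightarrow> real set \<Rightarrow> real set \<Rightarrow> real \<Rightarrow> real \<Rightarrow> real \<Rightarrow> real \<Rightarrow> (real \<Rightarrow> real) \<Rightarrow>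
     (point \<Rightarrow> point) \<Rightarrow> bool" where
  "listed_point_map It Ix Iu \<delta>1 \<delta>2 \<delta>3 \<delta>4 X \<phi> \<longleftrightarrow>
     \<delta>1 * \<delta>3 \<noteq> 0 \<and> smooth_on Ix X \<and> (\<forall>x\<in>Ix. deriv X x \<noteq> 0) \<and>
     (\<forall>t\<in>It. \<forall>x\<in>Ix. \<forall>u\<in>Iu. \<phi> (t, x, u) = (\<delta>1 * t + \<delta>2, X x, \<delta>3 * u + \<delta>4))"

definition listed_elements ::
    "real set \<Rightarrow> real set \<Rightarrow> real \<Rightarrow> real \<Rightarrow> real \<Rightarrow> real \<Rightarrow> (real \<Rightarrow> real) \<Rightarrow>
     real \<Rightarrow> real \<Rightarrow> real \<Rightarrow> real \<Rightarrow> arb_elements \<Rightarrow> arb_elements \<Rightarrow> bool" where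
  "listed_elements Ix Iu x0 \<delta>1 \<delta>3 \<delta>4 X \<epsilon>1 \<epsilon>2 \<epsilon>3 \<epsilon>4 \<theta> \<theta>' \<longleftrightarrow>
     (let E = (\<lambda>x. exp (- \<epsilon>4 * antiderivative x0 (\<lambda>y. el_h \<theta> y / el_g \<theta> y) x)) in
      (\<forall>x\<in>Ix. el_f \<theta>' (X x) = \<epsilon>1 * \<delta>1\<^sup>2 / deriv X x * el_f \<theta> x * E x \<and>
              el_g \<theta>' (X x) = \<epsilon>1 * inverse \<epsilon>2 * deriv X x * el_g \<theta> x * E x \<and>
              el_h \<theta>' (X x) = \<epsilon>1 * inverse \<epsilon>3 * el_h \<theta> x * E x) \<and>
      (\<forall>u\<in>Iu. el_H \<theta>' (\<delta>3 * u + \<delta>4) = \<epsilon>2 * el_H \<theta> u \<and>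
              el_K \<theta>' (\<delta>3 * u + \<delta>4) = \<epsilon>3 * (el_K \<theta> u + \<epsilon>4 * el_H \<theta> u)))"

end

theory Submission
  imports Defs
begin

text \<open>
  The image of the graph of \<open>u\<close> has a second jet that depends affinely on the second jet of \<open>u\<close>,
  so an equation goes to an equation only if the principal symbols \<open>diag (f, - g H)\<close>
  and \<open>diag (f~, - g~ H~)\<close> correspond up to a factor.  As \<open>f\<close> and \<open>g H\<close> are independent, this leaves
  \<open>T = T(t), X = X(x)\<close> or \<open>T = T(x), X = X(t)\<close>; the variation of \<open>f\<close> and \<open>H\<close> excludes the second case and
  gives \<open>T\<^sub>t\<^sub>t = U\<^sub>t = U\<^sub>x = 0\<close>, and \<open>U\<^sub>u\<^sub>u = 0\<close> as there is no term with \<open>u\<^sub>t\<^sup>2\<close>.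

  Then the new elements, pulled back to the old variables, satisfy \<open>f\<^sub>1 = l f\<close>, \<open>H\<^sub>1 = \<epsilon>2 H\<close>,
  \<open>g\<^sub>1 = l g / \<epsilon>2\<close> and \<open>h\<^sub>1(x) K\<^sub>1(u) = l h(x) K(u) - l\<^sub>x g(x) H(u)\<close> with some \<open>l = l(x)\<close>.  If \<open>h \<noteq> 0\<close> and
  \<open>K\<close> is not a multiple of \<open>H\<close>, a separation of variables yields the listed formulas.
  The remaining tuples are not determined by their equation; they are limits of determined
  ones along smooth families in several directions, and only the listed formulas are compatible with all of them.
\<close>

subsection \<open>Continuously differentiable functions\<close>

text \<open>The obstacle is non-uniqueness. For \<open>h = 0\<close> the equation says nothing about
  \<open>K\<close>, and for \<open>K = c H\<close> the function \<open>l\<close> may be any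
  nonvanishing function, since \<open>l\<^sub>x g H\<close> can be absorbed into the new
  \<open>h K\<close>. For such tuples the formulas must come from the smoothness of \<Psi> along
  families. But a limit of listed formulas need not be listed: \<open>1 / \<epsilon>3\<close> may
  tend to 0, and if \<open>h = s m g\<close>, the product \<open>s \<epsilon>4\<close> may keep a
  nonzero limit. One family does not exclude this; it only forces the limit into a shape dictated by
  the direction of deformation. Two directions, \<open>u\<close> and \<open>u^2\<close> for
  \<open>K\<close>, or \<open>1\<close> and \<open>2 (x - x0)\<close> for \<open>h\<close>, impose
  shapes that agree only in the listed form. For the point part a few test tuples suffice, with
  \<open>f\<close> among \<open>1\<close>, \<open>exp x\<close> and \<open>H\<close> among
  constants, \<open>exp u\<close>, \<open>exp (u^2)\<close>. All of them share the same \<phi>, so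
  relations for two tuples can be compared to eliminate its unknown derivatives.\<close>

lemma C_k_on_subset: "C_k_on k S F \<Longrightarrow> T \<subseteq> S \<Longrightarrow> C_k_on k T F"
  by (induction k arbitrary: F) (auto intro: continuous_on_subset differentiable_on_subset)

lemma C_k_on_SucD: "C_k_on (Suc k) S F \<Longrightarrow> C_k_on k S F"
proof (induction k arbitrary: F)
  case 0
  then show ?case by (auto intro: differentiable_imp_continuous_on)
next
  case (Suc k)
  then show ?case by (metis C_k_on.simps(2))
qed

lemma C_k_on_mono: "C_k_on n S F \<Longrightarrow> k \<le> n \<Longrightarrow> C_k_on k S F"
proof (induction n)
  case 0
  then show ?case by simp
next
  case (Suc n)
  show ?case
  proof (cases "k = Suc n")
    case True
    then show ?thesis using Suc.prems(1) by (simp only:)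
  next
    case False
    then have "k \<le> n" using Suc.prems(2) by simp
    then show ?thesis using Suc.IH C_k_on_SucD[OF Suc.prems(1)] by blast
  qed
qed

lemma C_k_on_continuous: "C_k_on k S F \<Longrightarrow> continuous_on S F"
  using C_k_on_mono[of k S F 0] by simp

text \<open>On an open set, equal functions have equal Frechet derivatives, so the equality is
  passed on to all orders.\<close>

lemma C_k_on_cong:
  assumes "open S" "\<And>p. p \<in> S \<Longrightarrow> F p = G p" "C_k_on k S F"
  shows "C_k_on k S G"
  using assms(2,3)
proof (induction k arbitrary: F G)
  case 0
  then show ?case using continuous_on_cong by force
next
  case (Suc k)
  have d: "F differentiable (at p)" if "p \<in> S" for p
    using Suc.prems that assms(1) by (auto simp: differentiable_on_eq_differentiable_at)
  have e: "frechet_derivative F (at p) = frechet_derivative G (at p)" if "p \<in> S" for p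
    using frechet_derivative_transform_within_open[of F p S G] d[OF that] assms(1) that Suc.prems(1)
    by blast
  have "G differentiable (at p)" if "p \<in> S" for p
  proof (rule differentiableI)
    show "(G has_derivative frechet_derivative F (at p)) (at p)"
      using d[OF that] Suc.prems(1)
      using has_derivative_transform_within_open[of F "frechet_derivative F (at p)" p UNIV S G]
        assms(1) that
      by (simp add: frechet_derivative_works)
  qed
  then have "G differentiable_on S"
    by (simp add: differentiable_at_imp_differentiable_on)
  moreover have "C_k_on k S (\<lambda>p. frechet_derivative G (at p) v)" for v
    by (rule Suc.IH[of "\<lambda>p. frechet_derivative F (at p) v"]) (use e Suc.prems in auto)
  ultimately show ?case by simp
qed

text \<open>The closure properties below are proved through this rule: the derivative may be given
  by an explicit formula instead of \<open>frechet_derivative\<close>, and on the open set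
  \<open>S\<close> both agree.\<close>

lemma C_k_on_SucI:
  assumes S: "open S" and d: "\<And>p. p \<in> S \<Longrightarrow> (F has_derivative F' p) (at p)"
    and c: "\<And>v. C_k_on k S (\<lambda>p. F' p v)"
  shows "C_k_on (Suc k) S F"
proof -
  have "F differentiable_on S"
    by (rule differentiable_at_imp_differentiable_on) (rule differentiableI[OF d])
  moreover have "C_k_on k S (\<lambda>p. frechet_derivative F (at p) v)" for v
    using C_k_on_cong[OF S _ c[of v], of "\<lambda>p. frechet_derivative F (at p) v"]
      frechet_derivative_at[OF d] by simp
  ultimately show ?thesis by simp
qed

lemma C_k_on_Suc_has_derivative:
  assumes "C_k_on (Suc k) S F" "open S" "p \<in> S"
  shows "(F has_derivative frechet_derivative F (at p)) (at p)"
  using assms by (auto simp: differentiable_on_eq_differentiable_at frechet_derivative_works[symmetric])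

lemma C_k_on_Suc_derivative: "C_k_on (Suc k) S F \<Longrightarrow> C_k_on k S (\<lambda>p. frechet_derivative F (at p) v)"
  by simp

lemma C_k_on_const: "open S \<Longrightarrow> C_k_on k S (\<lambda>p. c)"
proof (induction k arbitrary: c)
  case (Suc k)
  show ?case
    by (rule C_k_on_SucI[where F' = "\<lambda>p v. 0"])
      (use Suc in \<open>simp_all del: C_k_on.simps\<close>)
qed simp

lemma C_k_on_bounded_linear_compose:
  assumes S: "open S" and L: "bounded_linear L" and F: "C_k_on k S F"
  shows "C_k_on k S (\<lambda>p. L (F p))"
  using F
proof (induction k arbitrary: F)
  case 0
  then show ?case using bounded_linear.continuous_on[OF L] by auto
next
  case (Suc k)
  show ?case
    by (rule C_k_on_SucI[OF S bounded_linear.has_derivative[OF L C_k_on_Suc_has_derivative[OF Suc.prems S]]])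
      (simp_all add: Suc.IH C_k_on_Suc_derivative[OF Suc.prems] del: C_k_on.simps)
qed

lemma C_k_on_ident: "open S \<Longrightarrow> C_k_on k S (\<lambda>p. p)"
proof (induction k)
  case (Suc k)
  show ?case
    by (rule C_k_on_SucI[where F' = "\<lambda>p v. v"])
      (use Suc in \<open>simp_all add: C_k_on_const del: C_k_on.simps\<close>)
qed simp

lemma C_k_on_linear: "open S \<Longrightarrow> bounded_linear L \<Longrightarrow> C_k_on k S L"
  using C_k_on_bounded_linear_compose[OF _ _ C_k_on_ident] .

lemma C_k_on_add:
  assumes S: "open S" and "C_k_on k S F" "C_k_on k S G"
  shows "C_k_on k S (\<lambda>p. F p + G p)"
  using assms(2,3)
proof (induction k arbitrary: F G)
  case 0
  then show ?case by (auto intro: continuous_on_add)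
next
  case (Suc k)
  show ?case
    by (rule C_k_on_SucI[OF S has_derivative_add[OF C_k_on_Suc_has_derivative[OF Suc.prems(1) S]
            C_k_on_Suc_has_derivative[OF Suc.prems(2) S]]])
      (simp_all add: Suc.IH C_k_on_Suc_derivative[OF Suc.prems(1)]
        C_k_on_Suc_derivative[OF Suc.prems(2)] del: C_k_on.simps)
qed

lemma C_k_on_scaleR:
  assumes S: "open S" and "C_k_on k S F" "C_k_on k S G"
  shows "C_k_on k S (\<lambda>p. (F p :: real) *\<^sub>R G p)"
  using assms(2,3)
proof (induction k arbitrary: F G)
  case 0
  then show ?case by (auto intro: continuous_on_scaleR)
next
  case (Suc k)
  show ?case
    by (rule C_k_on_SucI[OF S has_derivative_scaleR[OF C_k_on_Suc_has_derivative[OF Suc.prems(1) S]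
            C_k_on_Suc_has_derivative[OF Suc.prems(2) S]]])
      (intro S C_k_on_add[OF S] Suc.IH C_k_on_Suc_derivative[OF Suc.prems(1)]
        C_k_on_Suc_derivative[OF Suc.prems(2)] C_k_on_SucD[OF Suc.prems(1)]
        C_k_on_SucD[OF Suc.prems(2)] | assumption)+
qed

lemma C_k_on_mult:
  "open S \<Longrightarrow> C_k_on k S F \<Longrightarrow> C_k_on k S G \<Longrightarrow> C_k_on k S (\<lambda>p. (F p :: real) * G p)"
  using C_k_on_scaleR[of S k F G] by simp

lemma C_k_on_sum:
  assumes "open S" "\<And>i. i \<in> A \<Longrightarrow> C_k_on k S (F i)"
  shows "C_k_on k S (\<lambda>p. \<Sum>i\<in>A. F i p)"
  using assms(2)
  by (induction A rule: infinite_finite_induct)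
    (auto intro: C_k_on_const[OF assms(1)] C_k_on_add[OF assms(1)])

lemma C_k_on_Pair:
  assumes "open S" "C_k_on k S F" "C_k_on k S G"
  shows "C_k_on k S (\<lambda>p. (F p, G p))"
proof -
  have "C_k_on k S (\<lambda>p. (F p, 0) + (0, G p))"
    using assms
    by (intro C_k_on_add C_k_on_bounded_linear_compose[of _ "\<lambda>a. (a, 0)"]
        C_k_on_bounded_linear_compose[of _ "\<lambda>a. (0, a)"])
      (auto intro: bounded_linear_Pair bounded_linear_zero bounded_linear_ident)
  then show ?thesis by simp
qed

lemma linear_euclidean_expansion:
  fixes L :: "'a::euclidean_space \<Rightarrow> 'b::real_normed_vector"
  assumes "bounded_linear L"
  shows "L y = (\<Sum>i\<in>Basis. (y \<bullet> i) *\<^sub>R L i)"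
proof -
  interpret bounded_linear L by fact
  have "L y = L (\<Sum>i\<in>Basis. (y \<bullet> i) *\<^sub>R i)" by (simp add: euclidean_representation)
  then show ?thesis by (simp add: sum scale)
qed

text \<open>The chain rule applies the derivative of \<open>G\<close> to a direction that moves with
  \<open>p\<close>, whereas \<open>C_k_on\<close> speaks of fixed directions. The moving direction
  is therefore expanded in the basis of the Euclidean space in the middle.\<close>

lemma C_k_on_compose:
  fixes F :: "'a::real_normed_vector \<Rightarrow> 'b::euclidean_space" and G :: "'b \<Rightarrow> 'c::real_normed_vector"
  assumes S: "open S" and T: "open T" and "C_k_on k S F" "C_k_on k T G" "F ` S \<subseteq> T"
  shows "C_k_on k S (\<lambda>p. G (F p))"
  using assms(3,4)
proof (induction k arbitrary: G)
  case 0
  then show ?case using assms(5) continuous_on_compose2 by auto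
next
  case (Suc k)
  have FT: "F p \<in> T" if "p \<in> S" for p using assms(5) that by auto
  note dG = C_k_on_Suc_has_derivative[OF Suc.prems(2) T FT]
  note dF = C_k_on_Suc_has_derivative[OF Suc.prems(1) S]
  show ?case
  proof (rule C_k_on_SucI[OF S])
    fix p assume p: "p \<in> S"
    let ?DG = "frechet_derivative G (at (F p))" and ?DF = "frechet_derivative F (at p)"
    have "((\<lambda>p. G (F p)) has_derivative (\<lambda>v. ?DG (?DF v))) (at p)"
      using diff_chain_at[OF dF[OF p] dG[OF p]] by (simp add: o_def)
    moreover have "?DG (?DF v) = (\<Sum>i\<in>Basis. (?DF v \<bullet> i) *\<^sub>R ?DG i)" for v
      by (rule linear_euclidean_expansion[OF has_derivative_bounded_linear[OF dG[OF p]]])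
    ultimately show "((\<lambda>p. G (F p)) has_derivative
        (\<lambda>v. (\<Sum>i\<in>Basis. (?DF v \<bullet> i) *\<^sub>R ?DG i))) (at p)"
      by simp
  next
    fix v
    have "C_k_on k S (\<lambda>p. frechet_derivative F (at p) v \<bullet> i)" for i
      by (rule C_k_on_bounded_linear_compose[OF S bounded_linear_inner_left
            C_k_on_Suc_derivative[OF Suc.prems(1)]])
    moreover have "C_k_on k S (\<lambda>p. frechet_derivative G (at (F p)) i)" for i
      by (rule Suc.IH[OF C_k_on_SucD[OF Suc.prems(1)] C_k_on_Suc_derivative[OF Suc.prems(2)]])
    ultimately show "C_k_on k S (\<lambda>p. \<Sum>i\<in>Basis. (frechet_derivative F (at p) v \<bullet> i) *\<^sub>R
        frechet_derivative G (at (F p)) i)"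
      by (intro C_k_on_sum[OF S] C_k_on_scaleR[OF S])
  qed
qed

lemma C_k_on_inverse:
  fixes F :: "'a::real_normed_vector \<Rightarrow> real"
  assumes S: "open S" and "C_k_on k S F" and nz: "\<And>p. p \<in> S \<Longrightarrow> F p \<noteq> 0"
  shows "C_k_on k S (\<lambda>p. inverse (F p))"
  using assms(2)
proof (induction k)
  case 0
  then show ?case using nz by (auto intro: continuous_on_inverse)
next
  case (Suc k)
  have "C_k_on k S (\<lambda>p. -1 * (inverse (F p) * frechet_derivative F (at p) v * inverse (F p)))" for v
    by (intro C_k_on_mult C_k_on_const C_k_on_Suc_derivative[OF Suc.prems] S Suc.IH C_k_on_SucD[OF Suc.prems])
  then show ?case
    by (intro C_k_on_SucI[OF S Deriv.has_derivative_inverse[OF nz C_k_on_Suc_has_derivative[OF Suc.prems S]]])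
      simp_all
qed

lemma C_k_on_divide:
  fixes F :: "'a::real_normed_vector \<Rightarrow> real"
  assumes "open S" "C_k_on k S F" "C_k_on k S G" "\<And>p. p \<in> S \<Longrightarrow> G p \<noteq> 0"
  shows "C_k_on k S (\<lambda>p. F p / G p)"
  using C_k_on_mult[OF assms(1,2) C_k_on_inverse[OF assms(1,3,4)]] by (simp add: divide_inverse)

lemma C_k_on_exp:
  fixes F :: "'a::real_normed_vector \<Rightarrow> real"
  assumes S: "open S" and "C_k_on k S F"
  shows "C_k_on k S (\<lambda>p. exp (F p))"
  using assms(2)
proof (induction k)
  case 0
  then show ?case by (auto intro: continuous_on_exp)
next
  case (Suc k)
  have "((\<lambda>p. exp (F p)) has_derivative (\<lambda>v. exp (F p) * frechet_derivative F (at p) v)) (at p)"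
    if "p \<in> S" for p
    using has_derivative_exp[OF C_k_on_Suc_has_derivative[OF Suc.prems S that]]
    by (simp add: mult.commute)
  moreover have "C_k_on k S (\<lambda>p. exp (F p) * frechet_derivative F (at p) v)" for v
    by (intro C_k_on_mult C_k_on_Suc_derivative[OF Suc.prems] S Suc.IH C_k_on_SucD[OF Suc.prems])
  ultimately show ?case by (rule C_k_on_SucI[OF S])
qed

lemmas C_k_on_intros = C_k_on_const C_k_on_ident C_k_on_add C_k_on_mult C_k_on_Pair C_k_on_exp
  C_k_on_divide C_k_on_inverse

section \<open>Derivatives in one variable and regularity of inverse maps\<close>

lemma frechet_derivative_eq_deriv:
  fixes f :: "real \<Rightarrow> real"
  assumes "f differentiable (at x)"
  shows "frechet_derivative f (at x) v = deriv f x * v"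
proof -
  obtain D where "DERIV f x :> D" using assms by (auto simp: real_differentiable_def)
  then show ?thesis
    using frechet_derivative_at[of f "(*) D" x] DERIV_imp_deriv[of f D x]
    by (auto simp: has_field_derivative_def fun_eq_iff)
qed

lemma C_k_on_Suc_DERIV:
  fixes f :: "real \<Rightarrow> real"
  assumes "C_k_on (Suc k) I f" "open I" "x \<in> I"
  shows "DERIV f x :> deriv f x"
proof -
  have "f differentiable (at x)"
    using assms by (auto simp: differentiable_on_eq_differentiable_at)
  then show ?thesis by (auto simp: real_differentiable_def dest: DERIV_imp_deriv)
qed

lemma C_k_on_Suc_deriv:
  fixes f :: "real \<Rightarrow> real"
  assumes "C_k_on (Suc k) I f" "open I"
  shows "C_k_on k I (deriv f)"
proof (rule C_k_on_cong[OF assms(2)])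
  show "C_k_on k I (\<lambda>x. frechet_derivative f (at x) 1)" using assms by simp
  show "frechet_derivative f (at x) 1 = deriv f x" if "x \<in> I" for x
    using assms that frechet_derivative_eq_deriv[of f x 1]
    by (auto simp: differentiable_on_eq_differentiable_at)
qed

lemma smooth_on_DERIV:
  fixes f :: "real \<Rightarrow> real"
  assumes "smooth_on I f" "open I" "x \<in> I"
  shows "DERIV f x :> deriv f x"
  using C_k_on_Suc_DERIV[of 0 I f x] assms unfolding smooth_on_def by blast

lemma smooth_on_deriv:
  fixes f :: "real \<Rightarrow> real"
  assumes "smooth_on I f" "open I"
  shows "smooth_on I (deriv f)"
  using C_k_on_Suc_deriv[OF _ assms(2)] assms(1) unfolding smooth_on_def by (simp del: C_k_on.simps)

text \<open>Bootstrapping: if \<open>g\<close> is of class C^k and \<open>f\<close> of class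
  C^(k+1), then g' = 1 / f'(g) is of class C^k, so each step of the induction gains one
  order.\<close>

lemma C_k_on_local_inverse_real:
  fixes f g :: "real \<Rightarrow> real"
  assumes I: "open I" and f: "C_k_on k I f" and J: "open J"
    and g: "\<And>y. y \<in> J \<Longrightarrow> g y \<in> I" "\<And>y. y \<in> J \<Longrightarrow> DERIV g y :> inverse (deriv f (g y))"
    and nz: "\<And>x. x \<in> I \<Longrightarrow> deriv f x \<noteq> 0"
  shows "C_k_on k J g"
  using f
proof (induction k)
  case 0
  have "continuous_on J g"
    by (rule continuous_at_imp_continuous_on) (use g(2) DERIV_isCont in blast)
  then show ?case by simp
next
  case (Suc k)
  have gk: "C_k_on k J g" by (rule Suc.IH[OF C_k_on_SucD[OF Suc.prems]])
  have "C_k_on k J (\<lambda>y. deriv f (g y))"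
    by (rule C_k_on_compose[OF J I gk C_k_on_Suc_deriv[OF Suc.prems I]]) (use g in auto)
  then have "C_k_on k J (\<lambda>y. inverse (deriv f (g y)))"
    by (rule C_k_on_inverse[OF J]) (use g nz in auto)
  then have c: "C_k_on k J (\<lambda>y. inverse (deriv f (g y)) * v)" for v
    by (intro C_k_on_mult J C_k_on_const)
  show ?case
    by (rule C_k_on_SucI[OF J g(2)[unfolded has_field_derivative_def] c])
qed

text \<open>The same bootstrapping in two dimensions. \<open>G'\<close> is given as a right inverse
  of the derivative of \<open>F\<close>; Cramer's rule turns it into a rational expression in the
  entries of that derivative at \<open>G y\<close>, which is as regular as \<open>G\<close>.\<close>

lemma C_k_on_local_inverse_plane:
  fixes F G :: "real \<times> real \<Rightarrow> real \<times> real"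
  assumes V: "open V" and F: "C_k_on k V F" and W: "open W"
    and G: "\<And>y. y \<in> W \<Longrightarrow> G y \<in> V"
      "\<And>y. y \<in> W \<Longrightarrow> (G has_derivative G' y) (at y)"
      "\<And>y v. y \<in> W \<Longrightarrow> frechet_derivative F (at (G y)) (G' y v) = v"
    and lin: "\<And>p. p \<in> V \<Longrightarrow> bounded_linear (frechet_derivative F (at p))"
  shows "C_k_on k W G"
  using F
proof (induction k)
  case 0
  have "continuous_on W G"
    by (rule continuous_at_imp_continuous_on) (use G(2) has_derivative_continuous in blast)
  then show ?case by simp
next
  case (Suc k)
  have gk: "C_k_on k W G" by (rule Suc.IH[OF C_k_on_SucD[OF Suc.prems]])
  define a where "a y = fst (frechet_derivative F (at (G y)) (1, 0))" for y
  define b where "b y = fst (frechet_derivative F (at (G y)) (0, 1))" for y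
  define c where "c y = snd (frechet_derivative F (at (G y)) (1, 0))" for y
  define d where "d y = snd (frechet_derivative F (at (G y)) (0, 1))" for y
  have ex: "frechet_derivative F (at (G y)) h = (fst h * a y + snd h * b y, fst h * c y + snd h * d y)"
    if "y \<in> W" for y h
  proof -
    interpret bounded_linear "frechet_derivative F (at (G y))" by (rule lin[OF G(1)[OF that]])
    have "frechet_derivative F (at (G y)) (fst h *\<^sub>R (1, 0) + snd h *\<^sub>R (0, 1)) =
        fst h *\<^sub>R frechet_derivative F (at (G y)) (1, 0) + snd h *\<^sub>R frechet_derivative F (at (G y)) (0, 1)"
      by (simp only: add scale)
    then show ?thesis by (simp add: prod_eq_iff a_def b_def c_def d_def)
  qed
  define e where "e y = a y * d y - b y * c y" for y
  have e0: "e y \<noteq> 0" if y: "y \<in> W" for y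
  proof
    assume "e y = 0"
    obtain h1 h2 where "(h1 * a y + h2 * b y, h1 * c y + h2 * d y) = (1, 0)"
      using G(3)[OF y, of "(1,0)"] ex[OF y] by metis
    moreover obtain k1 k2 where "(k1 * a y + k2 * b y, k1 * c y + k2 * d y) = (0, 1)"
      using G(3)[OF y, of "(0,1)"] ex[OF y] by metis
    \<comment> \<open>Multiplicativity of the determinant: \<open>h\<close> and \<open>k\<close> are
      the columns of a right inverse, so the product of the two determinants is 1 and
      \<open>e y\<close> cannot vanish.\<close>
    ultimately have "(h1 * a y + h2 * b y) * (k1 * c y + k2 * d y) - (h1 * c y + h2 * d y) * (k1 * a y + k2 * b y) = 1"
      by simp
    moreover have "(h1 * a y + h2 * b y) * (k1 * c y + k2 * d y) - (h1 * c y + h2 * d y) * (k1 * a y + k2 * b y)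
        = (h1 * k2 - h2 * k1) * e y"
      by (simp add: e_def algebra_simps)
    ultimately show False using \<open>e y = 0\<close> by simp
  qed
  have inv: "G' y v = ((fst v * d y - snd v * b y) / e y, (snd v * a y - fst v * c y) / e y)"
    if "y \<in> W" for y v
  proof -
    obtain h1 h2 where h: "G' y v = (h1, h2)" by fastforce
    have "(h1 * a y + h2 * b y, h1 * c y + h2 * d y) = v"
      using G(3)[OF that, of v] ex[OF that, of "(h1, h2)"] h by simp
    then have v: "fst v = h1 * a y + h2 * b y" "snd v = h1 * c y + h2 * d y" by auto
    have "fst v * d y - snd v * b y = h1 * e y" "snd v * a y - fst v * c y = h2 * e y"
      unfolding v e_def by (simp_all add: algebra_simps)
    then show ?thesis using h e0[OF that] by simp
  qed
  have C: "C_k_on k W (\<lambda>y. L (frechet_derivative F (at (G y)) v))"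
    if "bounded_linear L" for v and L :: "real \<times> real \<Rightarrow> real"
    by (rule C_k_on_bounded_linear_compose[OF W that C_k_on_compose[OF W V gk C_k_on_Suc_derivative[OF Suc.prems]]])
      (use G in auto)
  have abcd: "C_k_on k W a" "C_k_on k W b" "C_k_on k W c" "C_k_on k W d"
    unfolding a_def b_def c_def d_def by (auto intro!: C bounded_linear_fst bounded_linear_snd)
  have "C_k_on k W (\<lambda>y. a y * d y + (-1) * (b y * c y))"
    by (intro C_k_on_intros W abcd)
  then have "C_k_on k W e" by (simp add: e_def[abs_def])
  then have "C_k_on k W (\<lambda>y. ((fst v * d y + (- snd v) * b y) / e y, (snd v * a y + (- fst v) * c y) / e y))" for v
    by (intro C_k_on_intros W abcd e0)
  then have *: "C_k_on k W (\<lambda>y. ((fst v * d y - snd v * b y) / e y, (snd v * a y - fst v * c y) / e y))" for v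
    by simp
  have c: "C_k_on k W (\<lambda>y. G' y v)" for v
    by (rule C_k_on_cong[OF W _ *[of v]]) (simp add: inv)
  show ?case by (rule C_k_on_SucI[OF W G(2) c])
qed

subsection \<open>Smooth functions and antiderivatives\<close>

lemma open_intervalD:
  assumes "open_interval I"
  shows "open I" "convex I" "connected I" "I \<noteq> {}"
  using assms by (auto simp: open_interval_def is_interval_convex is_interval_connected)

lemma open_interval_Icc_subset:
  assumes "open_interval I" "a \<in> I" "b \<in> I"
  shows "{a..b} \<subseteq> I"
proof
  fix z assume "z \<in> {a..b}"
  then have "a \<le> z" "z \<le> b" by simp_all
  then show "z \<in> I" using assms unfolding open_interval_def is_interval_1 by blast
qed

lemma smooth_on_subset: "smooth_on S F \<Longrightarrow> T \<subseteq> S \<Longrightarrow> smooth_on T F"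
  unfolding smooth_on_def using C_k_on_subset[of _ S F T] by blast

lemma smooth_on_cong: "smooth_on S F \<Longrightarrow> open S \<Longrightarrow> (\<And>p. p \<in> S \<Longrightarrow> F p = G p) \<Longrightarrow> smooth_on S G"
  unfolding smooth_on_def using C_k_on_cong[of S F G] by blast

lemma smooth_on_continuous: "smooth_on S F \<Longrightarrow> continuous_on S F"
  unfolding smooth_on_def using C_k_on_continuous by blast

lemma smooth_on_const: "open S \<Longrightarrow> smooth_on S (\<lambda>p. c)"
  unfolding smooth_on_def by (simp add: C_k_on_const)

lemma smooth_on_ident: "open S \<Longrightarrow> smooth_on S (\<lambda>p. p)"
  unfolding smooth_on_def by (simp add: C_k_on_ident)

lemma smooth_on_linear: "open S \<Longrightarrow> bounded_linear L \<Longrightarrow> smooth_on S L"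
  unfolding smooth_on_def by (simp add: C_k_on_linear)

lemma smooth_on_add:
  "open S \<Longrightarrow> smooth_on S F \<Longrightarrow> smooth_on S G \<Longrightarrow> smooth_on S (\<lambda>p. F p + G p)"
  unfolding smooth_on_def by (simp add: C_k_on_add)

lemma smooth_on_mult:
  "open S \<Longrightarrow> smooth_on S F \<Longrightarrow> smooth_on S G \<Longrightarrow> smooth_on S (\<lambda>p. (F p :: real) * G p)"
  unfolding smooth_on_def by (simp add: C_k_on_mult)

lemma smooth_on_divide:
  "open S \<Longrightarrow> smooth_on S F \<Longrightarrow> smooth_on S G \<Longrightarrow> (\<And>p. p \<in> S \<Longrightarrow> G p \<noteq> 0) \<Longrightarrow>
    smooth_on S (\<lambda>p. (F p :: real) / G p)"
  unfolding smooth_on_def by (simp add: C_k_on_divide)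

lemma smooth_on_exp:
  "open S \<Longrightarrow> smooth_on S F \<Longrightarrow> smooth_on S (\<lambda>p. exp (F p :: real))"
  unfolding smooth_on_def by (simp add: C_k_on_exp)

lemma smooth_on_Pair:
  "open S \<Longrightarrow> smooth_on S F \<Longrightarrow> smooth_on S G \<Longrightarrow> smooth_on S (\<lambda>p. (F p, G p))"
  unfolding smooth_on_def by (simp add: C_k_on_Pair)

lemma smooth_on_compose:
  fixes F :: "'a::real_normed_vector \<Rightarrow> 'b::euclidean_space"
  shows "open S \<Longrightarrow> open T \<Longrightarrow> smooth_on T G \<Longrightarrow> smooth_on S F \<Longrightarrow> F ` S \<subseteq> T \<Longrightarrow>
    smooth_on S (\<lambda>p. G (F p))"
  unfolding smooth_on_def using C_k_on_compose[of S T _ F G] by blast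

lemma smooth_on_fst: "open S \<Longrightarrow> smooth_on S F \<Longrightarrow> smooth_on S (\<lambda>p. fst (F p))"
  unfolding smooth_on_def by (simp add: C_k_on_bounded_linear_compose[OF _ bounded_linear_fst])

lemma smooth_on_snd: "open S \<Longrightarrow> smooth_on S F \<Longrightarrow> smooth_on S (\<lambda>p. snd (F p))"
  unfolding smooth_on_def by (simp add: C_k_on_bounded_linear_compose[OF _ bounded_linear_snd])

lemmas smooth_on_intros = smooth_on_const smooth_on_ident smooth_on_add smooth_on_mult
  smooth_on_divide smooth_on_exp smooth_on_Pair smooth_on_fst smooth_on_snd

lemma smooth_on_has_derivative:
  "smooth_on S F \<Longrightarrow> open S \<Longrightarrow> p \<in> S \<Longrightarrow> (F has_derivative frechet_derivative F (at p)) (at p)"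
  unfolding smooth_on_def using C_k_on_Suc_has_derivative[of 0] by blast

lemma smooth_on_derivative:
  "smooth_on S F \<Longrightarrow> smooth_on S (\<lambda>p. frechet_derivative F (at p) v)"
  unfolding smooth_on_def by (metis C_k_on_Suc_derivative)

text \<open>A right inverse of the derivative is what Sussmann's open mapping theorem asks for.
  Hence the lemma serves both for monotone functions on intervals and for single coordinates of a
  map with invertible derivative.\<close>

lemma open_image_submersion:
  fixes f :: "'a::real_normed_vector \<Rightarrow> 'b::euclidean_space"
  assumes "open S" "\<And>x. x \<in> S \<Longrightarrow> (f has_derivative f' x) (at x)"
    and "\<And>x. x \<in> S \<Longrightarrow> \<exists>g'. bounded_linear g' \<and> f' x \<circ> g' = id"
  shows "open (f ` S)"
proof -
  have cont: "continuous_on S f"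
    by (rule continuous_at_imp_continuous_on) (use assms(2) has_derivative_continuous in blast)
  have "f x \<in> interior (f ` S)" if x: "x \<in> S" for x
  proof -
    obtain g' where g': "bounded_linear g'" "f' x \<circ> g' = id" using assms(3)[OF x] by blast
    show ?thesis
      by (rule sussmann_open_mapping[OF assms(1) cont x assms(2)[OF x] g'])
        (use assms(1) x in \<open>auto simp: interior_open\<close>)
  qed
  then have "f ` S \<subseteq> interior (f ` S)" by blast
  then have "interior (f ` S) = f ` S" using interior_subset by blast
  then show ?thesis using open_interior by metis
qed

lemma open_image_real:
  assumes "open I" "\<And>x. x \<in> I \<Longrightarrow> DERIV f x :> f' x" "\<And>x. x \<in> I \<Longrightarrow> f' x \<noteq> (0::real)"
  shows "open (f ` I)"
proof (rule open_image_submersion[OF assms(1)])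
  show "(f has_derivative (*) (f' x)) (at x)" if "x \<in> I" for x
    using assms(2)[OF that] by (simp add: has_field_derivative_def)
  show "\<exists>g'. bounded_linear g' \<and> (*) (f' x) \<circ> g' = id" if "x \<in> I" for x
    by (rule exI[of _ "(*) (1 / f' x)"]) (use assms(3)[OF that] in \<open>auto simp: bounded_linear_mult_right\<close>)
qed

lemma inj_on_nonzero_deriv:
  assumes I: "open_interval I" and d: "\<And>x. x \<in> I \<Longrightarrow> DERIV f x :> f' x"
    and nz: "\<And>x. x \<in> I \<Longrightarrow> f' x \<noteq> (0::real)"
  shows "inj_on f I"
proof -
  have "f a \<noteq> f b" if ab: "a \<in> I" "b \<in> I" "a < b" for a b
  proof
    assume e: "f a = f b"
    have sub: "z \<in> I" if "a \<le> z" "z \<le> b" for z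
      using open_interval_Icc_subset[OF I ab(1,2)] that by auto
    have "DERIV f z :> f' z" if "a \<le> z" "z \<le> b" for z
      by (rule d[OF sub[OF that]])
    from MVT2[OF ab(3) this] obtain z where z: "a < z" "z < b" "f b - f a = (b - a) * f' z"
      by blast
    have "f' z \<noteq> 0" by (rule nz[OF sub]) (use z in simp_all)
    then show False using z e by simp
  qed
  note ne = this
  show ?thesis
  proof (rule inj_onI, rule ccontr)
    fix a b assume "a \<in> I" "b \<in> I" "f a = f b" "a \<noteq> b"
    then show False using ne[of a b] ne[of b a] by (cases "a < b") simp_all
  qed
qed

lemma smooth_on_inv_into:
  assumes I: "open_interval I" and X: "smooth_on I X" and nz: "\<And>x. x \<in> I \<Longrightarrow> deriv X x \<noteq> (0::real)"
  shows "open (X ` I)" "inj_on X I" "smooth_on (X ` I) (inv_into I X)"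
proof -
  note oI = open_intervalD(1)[OF I]
  note d = smooth_on_DERIV[OF X oI]
  show o: "open (X ` I)" by (rule open_image_real[OF oI d nz])
  show inj: "inj_on X I" by (rule inj_on_nonzero_deriv[OF I d nz])
  have D: "DERIV (inv_into I X) y :> inverse (deriv X (inv_into I X y))" if y: "y \<in> X ` I" for y
  proof -
    let ?x = "inv_into I X y"
    have x: "?x \<in> I" "X ?x = y" using y by (auto simp: inv_into_into f_inv_into_f)
    have "(inv_into I X has_derivative (*) (inverse (deriv X ?x))) (at (X ?x))"
    proof (rule has_derivative_inverse_strong[OF oI x(1)])
      show "continuous_on I X" by (rule smooth_on_continuous[OF X])
      show "inv_into I X (X z) = z" if "z \<in> I" for z using inj that by simp
      show "(X has_derivative (*) (deriv X ?x)) (at ?x)"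
        using d[OF x(1)] by (simp add: has_field_derivative_def)
      show "(*) (deriv X ?x) \<circ> (*) (inverse (deriv X ?x)) = id"
        using nz[OF x(1)] by (auto simp: fun_eq_iff)
    qed
    then show ?thesis using x(2) by (simp add: has_field_derivative_def)
  qed
  show "smooth_on (X ` I) (inv_into I X)"
    unfolding smooth_on_def
  proof
    fix k
    show "C_k_on k (X ` I) (inv_into I X)"
      by (rule C_k_on_local_inverse_real[OF oI _ o _ D nz])
        (use X in \<open>auto simp: smooth_on_def inv_into_into\<close>)
  qed
qed

section \<open>Antiderivatives and their dependence on a parameter\<close>

lemma interval_between:
  assumes "open_interval I" "a \<in> I" "b \<in> I"
  obtains c d where "c < a" "c < b" "a < d" "b < d" "{c..d} \<subseteq> I"
proof -
  have "open I" "is_interval I" using assms by (auto simp: open_interval_def)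
  obtain e1 where e1: "e1 > 0" "cball (min a b) e1 \<subseteq> I"
    using \<open>open I\<close> assms open_contains_cball by (metis min_def)
  obtain e2 where e2: "e2 > 0" "cball (max a b) e2 \<subseteq> I"
    using \<open>open I\<close> assms open_contains_cball by (metis max_def)
  have 1: "min a b - e1 \<in> I" "max a b + e2 \<in> I"
    using e1 e2 by (auto simp: subset_iff dist_real_def)
  have "{min a b - e1..max a b + e2} \<subseteq> I"
    by (rule open_interval_Icc_subset[OF assms(1) 1])
  then show thesis using e1(1) e2(1) that[of "min a b - e1" "max a b + e2"] by linarith
qed

lemma antiderivative_self [simp]: "antiderivative x0 k x0 = 0"
  by (simp add: antiderivative_def)

text \<open>The two branches of the definition are merged by integrating from a point
  \<open>c\<close> to the left of both \<open>x0\<close> and \<open>x\<close>: up to a constant,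
  \<open>antiderivative\<close> is the integral from \<open>c\<close>.\<close>

lemma DERIV_antiderivative:
  assumes I: "open_interval I" and "x0 \<in> I" and k: "continuous_on I k" and "x \<in> I"
  shows "DERIV (antiderivative x0 k) x :> k x"
proof -
  obtain c d where cd: "c < x0" "c < x" "x0 < d" "x < d" "{c..d} \<subseteq> I"
    using interval_between[OF I assms(2,4)] by metis
  have kc: "continuous_on {c..d} k" using k cd continuous_on_subset by blast
  then have int: "k integrable_on {c..d}" by (rule integrable_continuous_real)
  have "((\<lambda>y. integral {c..y} k) has_real_derivative k x) (at x within {c..d})"
    by (rule integral_has_real_derivative[OF kc]) (use cd in auto)
  then have "((\<lambda>y. integral {c..y} k) has_real_derivative k x) (at x)"
    using at_within_Icc_at[of c x d] cd by simp
  then have D: "((\<lambda>y. integral {c..y} k - integral {c..x0} k) has_real_derivative k x) (at x)"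
    by (auto intro!: derivative_eq_intros)
  have eq: "integral {c..y} k - integral {c..x0} k = antiderivative x0 k y" if y: "y \<in> {c<..<d}" for y
  proof (cases "x0 \<le> y")
    case True
    have "integral {c..x0} k + integral {x0..y} k = integral {c..y} k"
      by (rule Henstock_Kurzweil_Integration.integral_combine)
        (use True cd y in \<open>auto intro!: integrable_on_subinterval[OF int]\<close>)
    then show ?thesis using True by (simp add: antiderivative_def)
  next
    case False
    have "integral {c..y} k + integral {y..x0} k = integral {c..x0} k"
      by (rule Henstock_Kurzweil_Integration.integral_combine)
        (use False cd y in \<open>auto intro!: integrable_on_subinterval[OF int]\<close>)
    then show ?thesis using False by (simp add: antiderivative_def)
  qed
  have "x \<in> {c<..<d}" using cd by simp
  from has_field_derivative_transform_within_open[OF D open_greaterThanLessThan this eq]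
  show ?thesis .
qed

text \<open>Differentiation under the integral sign over the compact interval between
  \<open>x0\<close> and \<open>x\<close>, where the s-derivative of \<open>K\<close> is jointly
  continuous.\<close>

lemma DERIV_antiderivative_parameter:
  fixes K :: "real \<times> real \<Rightarrow> real"
  assumes I: "open_interval I" and "x0 \<in> I" "x \<in> I" and K: "smooth_on (UNIV \<times> I) K"
  shows "DERIV (\<lambda>s. antiderivative x0 (\<lambda>y. K (s, y)) x) s :>
    antiderivative x0 (\<lambda>y. frechet_derivative K (at (s, y)) (1, 0)) x"
proof -
  have op: "open (UNIV \<times> I :: (real \<times> real) set)" using open_intervalD(1)[OF I] by (simp add: open_Times)
  let ?K' = "\<lambda>p. frechet_derivative K (at p) (1, 0)"
  have K': "continuous_on (UNIV \<times> I) ?K'"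
    by (rule smooth_on_continuous[OF smooth_on_derivative[OF K]])
  have sub: "{x0..x} \<subseteq> I" "{x..x0} \<subseteq> I"
    by (rule open_interval_Icc_subset[OF I assms(2,3)], rule open_interval_Icc_subset[OF I assms(3,2)])
  have *: "((\<lambda>s. integral {a..b} (\<lambda>y. K (s, y))) has_field_derivative integral {a..b} (\<lambda>y. ?K' (s, y))) (at s)"
    if ab: "{a..b} \<subseteq> I" for a b
  proof -
    have "((\<lambda>s. integral (cbox a b) (\<lambda>y. K (s, y))) has_field_derivative integral (cbox a b) (\<lambda>y. ?K' (s, y))) (at s within UNIV)"
    proof (rule leibniz_rule_field_derivative)
      fix r t :: real assume "t \<in> cbox a b"
      then have rt: "(r, t) \<in> UNIV \<times> I" using ab by auto
      have "((\<lambda>r. (r, t)) has_derivative (\<lambda>h. (h, 0))) (at r)"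
        by (auto intro!: derivative_eq_intros)
      from has_derivative_compose[OF this smooth_on_has_derivative[OF K op rt]]
      have d: "((\<lambda>r. K (r, t)) has_derivative (\<lambda>h. frechet_derivative K (at (r, t)) (h, 0))) (at r)" .
      have "(\<lambda>h. frechet_derivative K (at (r, t)) (h, 0)) = (\<lambda>h. ?K' (r, t) * h)"
      proof
        fix h
        have "frechet_derivative K (at (r, t)) (h *\<^sub>R (1, 0)) = h *\<^sub>R ?K' (r, t)"
          by (rule linear_cmul[OF has_derivative_linear[OF smooth_on_has_derivative[OF K op rt]]])
        then show "frechet_derivative K (at (r, t)) (h, 0) = ?K' (r, t) * h"
          by (simp only: scaleR_Pair real_scaleR_def mult_1_right mult_zero_right mult.commute[of h])
      qed
      with d show "((\<lambda>r. K (r, t)) has_field_derivative ?K' (r, t)) (at r within UNIV)"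
        by (simp only: has_field_derivative_def)
    next
      fix r :: real
      show "(\<lambda>y. K (r, y)) integrable_on cbox a b"
        by (rule integrable_continuous)
          (auto intro!: continuous_on_compose2[OF smooth_on_continuous[OF K]] continuous_intros
            simp: subsetD[OF ab])
    next
      show "continuous_on (UNIV \<times> cbox a b) (\<lambda>(r, t). ?K' (r, t))"
        using ab by (auto intro: continuous_on_subset[OF K'] simp: case_prod_unfold)
    qed auto
    then show ?thesis by simp
  qed
  show ?thesis
    unfolding antiderivative_def
    by (cases "x0 \<le> x") (use *[OF sub(1)] DERIV_minus[OF *[OF sub(2)]] in auto)
qed

text \<open>The s-derivative of the antiderivative is the antiderivative of the s-derivative of
  \<open>K\<close>, and its x-derivative is \<open>K\<close> itself. The former has the same shape
  with another smooth integrand, so the induction runs over all \<open>K\<close> at once.\<close>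

lemma smooth_on_antiderivative:
  fixes K :: "real \<times> real \<Rightarrow> real"
  assumes I: "open_interval I" and x0: "x0 \<in> I" and K: "smooth_on (UNIV \<times> I) K"
  shows "smooth_on (UNIV \<times> I) (\<lambda>(s, x). antiderivative x0 (\<lambda>y. K (s, y)) x)"
proof -
  have op: "open (UNIV \<times> I :: (real \<times> real) set)" using open_intervalD(1)[OF I] by (simp add: open_Times)
  let ?A = "\<lambda>K (s, x). antiderivative x0 (\<lambda>y. K (s, y)) x"
  let ?K' = "\<lambda>K (p::real \<times> real). frechet_derivative K (at p) (1, 0) :: real"
  have D: "(?A K has_derivative (\<lambda>v. ?A (?K' K) p * fst v + K p * snd v)) (at p)"
    if K: "smooth_on (UNIV \<times> I) K" and p: "p \<in> UNIV \<times> I" for K :: "real \<times> real \<Rightarrow> real" and p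
  proof -
    obtain s x where p': "p = (s, x)" "x \<in> I" using p by auto
    have contK: "continuous_on (UNIV \<times> I) K" by (rule smooth_on_continuous[OF K])
    have "((\<lambda>(s, x). antiderivative x0 (\<lambda>y. K (s, y)) x) has_derivative
        (\<lambda>(tx, ty). antiderivative x0 (\<lambda>y. ?K' K (s, y)) x * tx + blinfun_mult_right (K (s, x)) ty))
        (at (s, x) within UNIV \<times> I)"
    proof (rule has_derivative_partialsI)
      show "((\<lambda>s. antiderivative x0 (\<lambda>y. K (s, y)) x) has_derivative
          (*) (antiderivative x0 (\<lambda>y. ?K' K (s, y)) x)) (at s within UNIV)"
        using DERIV_antiderivative_parameter[OF I x0 p'(2) K]
        by (simp add: has_field_derivative_def)
      show "(antiderivative x0 (\<lambda>y. K (r, y)) has_derivative blinfun_apply (blinfun_mult_right (K (r, t))))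
          (at t within I)" if "t \<in> I" for r t
      proof -
        have "continuous_on I (\<lambda>y. K (r, y))"
          by (auto intro!: continuous_on_compose2[OF contK] continuous_intros)
        from DERIV_antiderivative[OF I x0 this that] show ?thesis
          by (auto simp: has_field_derivative_eq_has_derivative_blinfun intro: has_derivative_at_withinI)
      qed
      have "continuous (at (s, x) within UNIV \<times> I) K"
        using contK p' by (auto simp: continuous_on_eq_continuous_within)
      then show "continuous (at (s, x) within UNIV \<times> I) (\<lambda>(r, t). blinfun_mult_right (K (r, t)))"
        using bounded_linear.continuous[OF bounded_linear_blinfun_mult_right]
        by (simp add: case_prod_unfold)
      show "x \<in> I" "convex I" using p' open_intervalD[OF I] by auto
    qed
    then show ?thesis
      using at_within_open[OF p op] p' by (simp add: case_prod_unfold)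
  qed
  have "C_k_on k (UNIV \<times> I) (?A K)" if "smooth_on (UNIV \<times> I) K" for k and K :: "real \<times> real \<Rightarrow> real"
    using that
  proof (induction k arbitrary: K)
    case (0 K)
    have "continuous_on (UNIV \<times> I) (?A K)"
      by (rule continuous_at_imp_continuous_on) (intro ballI has_derivative_continuous[OF D[OF 0]])
    then show ?case by simp
  next
    case (Suc k K)
    have c: "C_k_on k (UNIV \<times> I) (\<lambda>p. ?A (?K' K) p * fst v + K p * snd v)" for v
      using Suc.IH[OF smooth_on_derivative[OF Suc.prems]] Suc.prems
      by (intro C_k_on_add op C_k_on_mult C_k_on_const) (auto simp: smooth_on_def)
    show ?case by (rule C_k_on_SucI[OF op D[OF Suc.prems] c])
  qed
  then show ?thesis using K by (auto simp: smooth_on_def)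
qed

subsection \<open>The equation as a condition on jets\<close>

text \<open>The device by which identities valid on an open set are differentiated
  throughout.\<close>

lemma DERIV_unique_on:
  fixes f g :: "real \<Rightarrow> real"
  assumes "DERIV f x :> a" "DERIV g x :> b" "open N" "x \<in> N" "\<And>y. y \<in> N \<Longrightarrow> f y = g y"
  shows "a = b"
  using has_field_derivative_transform_within_open[OF assms(1,3,4,5)] assms(2) DERIV_unique by blast

lemma DERIV_slice:
  fixes w :: "real \<times> real \<Rightarrow> real"
  assumes w: "(w has_derivative w') (at (t, x))"
  shows "DERIV (\<lambda>s. w (s, x)) t :> w' (1, 0)" "DERIV (\<lambda>y. w (t, y)) x :> w' (0, 1)"
proof -
  note lin = has_derivative_linear[OF w]
  have 1: "((\<lambda>s. (s, x)) has_derivative (\<lambda>h. h *\<^sub>R (1, 0))) (at t)"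
    by (auto intro!: derivative_eq_intros)
  have "((\<lambda>s. w (s, x)) has_derivative (\<lambda>h. w' (h *\<^sub>R (1, 0)))) (at t)"
    by (rule has_derivative_compose[OF 1 w])
  moreover have "(\<lambda>h. w' (h *\<^sub>R (1, 0))) = (*) (w' (1, 0))"
    by (rule ext) (simp only: linear_cmul[OF lin] real_scaleR_def mult.commute)
  ultimately show "DERIV (\<lambda>s. w (s, x)) t :> w' (1, 0)" by (simp only: has_field_derivative_def)
  have 2: "((\<lambda>y. (t, y)) has_derivative (\<lambda>h. h *\<^sub>R (0, 1))) (at x)"
    by (auto intro!: derivative_eq_intros)
  have "((\<lambda>y. w (t, y)) has_derivative (\<lambda>h. w' (h *\<^sub>R (0, 1)))) (at x)"
    by (rule has_derivative_compose[OF 2 w])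
  moreover have "(\<lambda>h. w' (h *\<^sub>R (0, 1))) = (*) (w' (0, 1))"
    by (rule ext) (simp only: linear_cmul[OF lin] real_scaleR_def mult.commute)
  ultimately show "DERIV (\<lambda>y. w (t, y)) x :> w' (0, 1)" by (simp only: has_field_derivative_def)
qed

lemma D_t_eq:
  assumes "(w has_derivative w') (at p)"
  shows "D_t w p = w' (1, 0)"
  using DERIV_imp_deriv[OF DERIV_slice(1)[of w w' "fst p" "snd p"]] assms
  by (simp add: D_t_def case_prod_unfold)

lemma D_x_eq:
  assumes "(w has_derivative w') (at p)"
  shows "D_x w p = w' (0, 1)"
  using DERIV_imp_deriv[OF DERIV_slice(2)[of w w' "fst p" "snd p"]] assms
  by (simp add: D_x_def case_prod_unfold)

lemma C_k_on_D_t: "open V \<Longrightarrow> C_k_on (Suc k) V w \<Longrightarrow> C_k_on k V (D_t w)"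
  by (rule C_k_on_cong[OF _ _ C_k_on_Suc_derivative[of k V w "(1, 0)"]])
    (use D_t_eq[OF C_k_on_Suc_has_derivative[of k V w]] in simp_all)

lemma C_k_on_D_x: "open V \<Longrightarrow> C_k_on (Suc k) V w \<Longrightarrow> C_k_on k V (D_x w)"
  by (rule C_k_on_cong[OF _ _ C_k_on_Suc_derivative[of k V w "(0, 1)"]])
    (use D_x_eq[OF C_k_on_Suc_has_derivative[of k V w]] in simp_all)

lemma DERIV_D_t:
  assumes "open V" "C_k_on (Suc k) V w" "(t, x) \<in> V"
  shows "DERIV (\<lambda>s. w (s, x)) t :> D_t w (t, x)"
  using DERIV_slice(1)[OF C_k_on_Suc_has_derivative[OF assms(2,1,3)]]
    D_t_eq[OF C_k_on_Suc_has_derivative[OF assms(2,1,3)]] by simp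

lemma DERIV_D_x:
  assumes "open V" "C_k_on (Suc k) V w" "(t, x) \<in> V"
  shows "DERIV (\<lambda>y. w (t, y)) x :> D_x w (t, x)"
  using DERIV_slice(2)[OF C_k_on_Suc_has_derivative[OF assms(2,1,3)]]
    D_x_eq[OF C_k_on_Suc_has_derivative[OF assms(2,1,3)]] by simp

text \<open>The equation as a condition on the 2-jet of \<open>u\<close>: \<open>w\<close>, \<open>q\<close>, \<open>a\<close>, \<open>c\<close> stand for
  \<open>u\<close>, \<open>u\<^sub>x\<close>, \<open>u\<^sub>t\<^sub>t\<close>, \<open>u\<^sub>x\<^sub>x\<close>.\<close>

definition jet_eq :: "arb_elements \<Rightarrow> real \<Rightarrow> real \<Rightarrow> real \<Rightarrow> real \<Rightarrow> real \<Rightarrow> bool" where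
  "jet_eq \<theta> x w q a c \<longleftrightarrow>
     el_f \<theta> x * a = (deriv (el_g \<theta>) x * el_H \<theta> w + el_h \<theta> x * el_K \<theta> w) * q
       + el_g \<theta> x * deriv (el_H \<theta>) w * q\<^sup>2 + el_g \<theta> x * el_H \<theta> w * c"

lemma satisfies_at_iff_jet_eq:
  assumes V: "open V" and u: "C_k_on 2 V u" and p: "(t, x) \<in> V"
    and g: "DERIV (el_g \<theta>) x :> deriv (el_g \<theta>) x"
    and H: "DERIV (el_H \<theta>) (u (t, x)) :> deriv (el_H \<theta>) (u (t, x))"
  shows "satisfies_at \<theta> u (t, x) \<longleftrightarrow>
    jet_eq \<theta> x (u (t, x)) (D_x u (t, x)) (D_t (D_t u) (t, x)) (D_x (D_x u) (t, x))"
proof -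
  have u2: "C_k_on (Suc (Suc 0)) V u" using u by (simp only: numeral_2_eq_2)
  have ux: "DERIV (\<lambda>y. u (t, y)) x :> D_x u (t, x)" by (rule DERIV_D_x[OF V u2 p])
  have uxx: "DERIV (\<lambda>y. D_x u (t, y)) x :> D_x (D_x u) (t, x)"
    by (rule DERIV_D_x[OF V C_k_on_D_x[OF V u2] p])
  have "DERIV (\<lambda>y. el_g \<theta> y * el_H \<theta> (u (t, y)) * D_x u (t, y)) x :>
      (deriv (el_g \<theta>) x * el_H \<theta> (u (t, x)) + deriv (el_H \<theta>) (u (t, x)) * D_x u (t, x) * el_g \<theta> x)
        * D_x u (t, x) + D_x (D_x u) (t, x) * (el_g \<theta> x * el_H \<theta> (u (t, x)))"
    by (rule DERIV_mult[OF DERIV_mult[OF g DERIV_chain2[OF H ux]] uxx])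
  then have "D_x (\<lambda>q. el_g \<theta> (snd q) * el_H \<theta> (u q) * D_x u q) (t, x) =
      (deriv (el_g \<theta>) x * el_H \<theta> (u (t, x)) + deriv (el_H \<theta>) (u (t, x)) * D_x u (t, x) * el_g \<theta> x)
        * D_x u (t, x) + D_x (D_x u) (t, x) * (el_g \<theta> x * el_H \<theta> (u (t, x)))"
    unfolding D_x_def[of "\<lambda>q. el_g \<theta> (snd q) * el_H \<theta> (u q) * D_x u q"]
    using DERIV_imp_deriv by simp
  then show ?thesis
    unfolding satisfies_at_def jet_eq_def by (simp add: algebra_simps power2_eq_square)
qed

text \<open>Chain rule for v(\<delta>1 t + \<delta>2, X x) = U(u(t, x)). The first-order identities
  are proved on all of \<open>V\<close> so that they can be differentiated again. \<open>U\<close>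
  is general because the lemma is also applied when \<open>U\<close> is not yet known to be affine;
  the term with \<open>U2\<close> is what then forces it to be.\<close>

lemma separated_jets:
  assumes V: "open V" and W: "open W" and u: "C_k_on 2 V u" and v: "C_k_on 2 W v"
    and p: "(t, x) \<in> V"
    and vu: "\<And>s y. (s, y) \<in> V \<Longrightarrow> (\<delta>1 * s + \<delta>2, X y) \<in> W \<and> v (\<delta>1 * s + \<delta>2, X y) = U (u (s, y))"
    and X: "\<And>s y. (s, y) \<in> V \<Longrightarrow> DERIV X y :> X' y" "DERIV X' x :> X2"
    and U: "\<And>s y. (s, y) \<in> V \<Longrightarrow> DERIV U (u (s, y)) :> U' (u (s, y))" "DERIV U' (u (t, x)) :> U2"
  shows "\<delta>1 * D_t v (\<delta>1 * t + \<delta>2, X x) = U' (u (t, x)) * D_t u (t, x)"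
    "X' x * D_x v (\<delta>1 * t + \<delta>2, X x) = U' (u (t, x)) * D_x u (t, x)"
    "\<delta>1\<^sup>2 * D_t (D_t v) (\<delta>1 * t + \<delta>2, X x) =
      U2 * (D_t u (t, x))\<^sup>2 + U' (u (t, x)) * D_t (D_t u) (t, x)"
    "(X' x)\<^sup>2 * D_x (D_x v) (\<delta>1 * t + \<delta>2, X x) + X2 * D_x v (\<delta>1 * t + \<delta>2, X x) =
      U2 * (D_x u (t, x))\<^sup>2 + U' (u (t, x)) * D_x (D_x u) (t, x)"
proof -
  have u2: "C_k_on (Suc (Suc 0)) V u" and v2: "C_k_on (Suc (Suc 0)) W v"
    using u v by (simp_all only: numeral_2_eq_2)
  have ot: "open ((\<lambda>r. (r, y)) -` V)" and ox: "open ((\<lambda>r. (s, r)) -` V)" for s y :: real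
    by (auto intro!: open_vimage[OF V] continuous_intros)
  have lin: "DERIV (\<lambda>r. \<delta>1 * r + \<delta>2) s :> \<delta>1" for s
    by (auto intro!: derivative_eq_intros)
  have t1: "\<delta>1 * D_t v (\<delta>1 * s + \<delta>2, X y) = U' (u (s, y)) * D_t u (s, y)" if sy: "(s, y) \<in> V" for s y
  proof (rule DERIV_unique_on[OF _ _ ot[of y]])
    show "DERIV (\<lambda>r. v (\<delta>1 * r + \<delta>2, X y)) s :> \<delta>1 * D_t v (\<delta>1 * s + \<delta>2, X y)"
      unfolding mult.commute[of \<delta>1 "D_t v (\<delta>1 * s + \<delta>2, X y)"]
      by (rule DERIV_chain2[OF DERIV_D_t[OF W v2 conjunct1[OF vu[OF sy]]] lin])
    show "DERIV (\<lambda>r. U (u (r, y))) s :> U' (u (s, y)) * D_t u (s, y)"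
      by (rule DERIV_chain2[OF U(1)[OF sy] DERIV_D_t[OF V u2 sy]])
  qed (use vu sy in auto)
  have x1: "X' y * D_x v (\<delta>1 * s + \<delta>2, X y) = U' (u (s, y)) * D_x u (s, y)" if sy: "(s, y) \<in> V" for s y
  proof (rule DERIV_unique_on[OF _ _ ox[of s]])
    show "DERIV (\<lambda>r. v (\<delta>1 * s + \<delta>2, X r)) y :> X' y * D_x v (\<delta>1 * s + \<delta>2, X y)"
      unfolding mult.commute[of "X' y"]
      by (rule DERIV_chain2[OF DERIV_D_x[OF W v2 conjunct1[OF vu[OF sy]]] X(1)[OF sy]])
    show "DERIV (\<lambda>r. U (u (s, r))) y :> U' (u (s, y)) * D_x u (s, y)"
      by (rule DERIV_chain2[OF U(1)[OF sy] DERIV_D_x[OF V u2 sy]])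
  qed (use vu sy in auto)
  show "\<delta>1 * D_t v (\<delta>1 * t + \<delta>2, X x) = U' (u (t, x)) * D_t u (t, x)" by (rule t1[OF p])
  show "X' x * D_x v (\<delta>1 * t + \<delta>2, X x) = U' (u (t, x)) * D_x u (t, x)" by (rule x1[OF p])
  have "\<delta>1 * (D_t (D_t v) (\<delta>1 * t + \<delta>2, X x) * \<delta>1) =
      U2 * D_t u (t, x) * D_t u (t, x) + D_t (D_t u) (t, x) * U' (u (t, x))"
  proof (rule DERIV_unique_on[OF _ _ ot[of x]])
    show "DERIV (\<lambda>r. \<delta>1 * D_t v (\<delta>1 * r + \<delta>2, X x)) t :> \<delta>1 * (D_t (D_t v) (\<delta>1 * t + \<delta>2, X x) * \<delta>1)"
      using vu[OF p] by (intro DERIV_cmult DERIV_chain2[OF DERIV_D_t[OF W C_k_on_D_t[OF W v2]] lin]) simp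
    show "DERIV (\<lambda>r. U' (u (r, x)) * D_t u (r, x)) t :>
        U2 * D_t u (t, x) * D_t u (t, x) + D_t (D_t u) (t, x) * U' (u (t, x))"
      by (intro DERIV_mult DERIV_chain2[where f = U' and g = "\<lambda>r. u (r, x)", OF U(2)] DERIV_D_t[OF V u2 p] DERIV_D_t[OF V C_k_on_D_t[OF V u2] p])
  qed (use t1 p in auto)
  then show "\<delta>1\<^sup>2 * D_t (D_t v) (\<delta>1 * t + \<delta>2, X x) =
      U2 * (D_t u (t, x))\<^sup>2 + U' (u (t, x)) * D_t (D_t u) (t, x)"
    by (simp add: power2_eq_square mult.commute mult.left_commute)
  have "X2 * D_x v (\<delta>1 * t + \<delta>2, X x) + D_x (D_x v) (\<delta>1 * t + \<delta>2, X x) * X' x * X' x =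
      U2 * D_x u (t, x) * D_x u (t, x) + D_x (D_x u) (t, x) * U' (u (t, x))"
  proof (rule DERIV_unique_on[OF _ _ ox[of t]])
    show "DERIV (\<lambda>r. X' r * D_x v (\<delta>1 * t + \<delta>2, X r)) x :>
        X2 * D_x v (\<delta>1 * t + \<delta>2, X x) + D_x (D_x v) (\<delta>1 * t + \<delta>2, X x) * X' x * X' x"
      using vu[OF p] by (intro DERIV_mult X(2) DERIV_chain2[OF DERIV_D_x[OF W C_k_on_D_x[OF W v2]] X(1)[OF p]]) simp
    show "DERIV (\<lambda>r. U' (u (t, r)) * D_x u (t, r)) x :>
        U2 * D_x u (t, x) * D_x u (t, x) + D_x (D_x u) (t, x) * U' (u (t, x))"
      by (intro DERIV_mult DERIV_chain2[where f = U' and g = "\<lambda>r. u (t, r)", OF U(2)] DERIV_D_x[OF V u2 p] DERIV_D_x[OF V C_k_on_D_x[OF V u2] p])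
  qed (use x1 p in auto)
  then show "(X' x)\<^sup>2 * D_x (D_x v) (\<delta>1 * t + \<delta>2, X x) + X2 * D_x v (\<delta>1 * t + \<delta>2, X x) =
      U2 * (D_x u (t, x))\<^sup>2 + U' (u (t, x)) * D_x (D_x u) (t, x)"
    by (simp add: power2_eq_square mult.commute mult.left_commute add.commute)
qed

text \<open>The new equation written in the old variables and multiplied by X_x / \<delta>3. This
  multiplier brings it back to the class: it cancels the factor 1 / X_x of the outer x-derivative,
  and \<open>h\<close> stays unchanged because the new u_x is \<delta>3 u_x / X_x.\<close>

definition pullback :: "real \<Rightarrow> real \<Rightarrow> real \<Rightarrow> (real \<Rightarrow> real) \<Rightarrow> arb_elements \<Rightarrow> arb_elements" where
  "pullback \<delta>1 \<delta>3 \<delta>4 X \<theta> =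
     \<lparr>el_f = \<lambda>x. el_f \<theta> (X x) * deriv X x / \<delta>1\<^sup>2, el_g = \<lambda>x. el_g \<theta> (X x) / deriv X x,
      el_h = \<lambda>x. el_h \<theta> (X x), el_H = \<lambda>u. el_H \<theta> (\<delta>3 * u + \<delta>4), el_K = \<lambda>u. el_K \<theta> (\<delta>3 * u + \<delta>4)\<rparr>"

lemma jet_eq_pullback:
  assumes nz: "\<delta>1 \<noteq> 0" "\<delta>3 \<noteq> 0" "deriv X x \<noteq> 0"
    and X: "DERIV X x :> deriv X x" "DERIV (deriv X) x :> X2"
    and g: "DERIV (el_g \<theta>) (X x) :> deriv (el_g \<theta>) (X x)"
    and H: "DERIV (el_H \<theta>) (\<delta>3 * w + \<delta>4) :> deriv (el_H \<theta>) (\<delta>3 * w + \<delta>4)"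
    and q: "deriv X x * q' = \<delta>3 * q" and a: "\<delta>1\<^sup>2 * a' = \<delta>3 * a"
    and c: "(deriv X x)\<^sup>2 * c' + X2 * q' = \<delta>3 * c"
  shows "jet_eq \<theta> (X x) (\<delta>3 * w + \<delta>4) q' a' c' \<longleftrightarrow> jet_eq (pullback \<delta>1 \<delta>3 \<delta>4 X \<theta>) x w q a c"
proof -
  let ?P = "pullback \<delta>1 \<delta>3 \<delta>4 X \<theta>"
  have "DERIV (el_g ?P) x :>
      (deriv (el_g \<theta>) (X x) * deriv X x * deriv X x - el_g \<theta> (X x) * X2) / (deriv X x * deriv X x)"
    unfolding pullback_def by (simp, rule DERIV_divide[OF DERIV_chain2[OF g X(1)] X(2) nz(3)])
  then have dg: "deriv (el_g ?P) x =
      (deriv (el_g \<theta>) (X x) * deriv X x * deriv X x - el_g \<theta> (X x) * X2) / (deriv X x * deriv X x)"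
    by (rule DERIV_imp_deriv)
  have "DERIV (\<lambda>u. \<delta>3 * u + \<delta>4) w :> \<delta>3" by (auto intro!: derivative_eq_intros)
  from DERIV_chain2[OF H this] have "DERIV (el_H ?P) w :> deriv (el_H \<theta>) (\<delta>3 * w + \<delta>4) * \<delta>3"
    unfolding pullback_def by simp
  then have dH: "deriv (el_H ?P) w = deriv (el_H \<theta>) (\<delta>3 * w + \<delta>4) * \<delta>3" by (rule DERIV_imp_deriv)
  define D where "D = deriv X x"
  have q': "q' = \<delta>3 * q / D" and a': "a' = \<delta>3 * a / \<delta>1\<^sup>2"
    using q a nz by (auto simp: D_def field_simps)
  have c': "c' = (\<delta>3 * c - X2 * (\<delta>3 * q / D)) / D\<^sup>2"
  proof -
    have "c' = (\<delta>3 * c - X2 * q') / D\<^sup>2"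
      using c nz(3) by (simp add: eq_divide_eq D_def algebra_simps)
    then show ?thesis by (simp only: q')
  qed
  define f g1 h H1 K g2 H2 where "f = el_f \<theta> (X x)" "g1 = el_g \<theta> (X x)" "h = el_h \<theta> (X x)"
    "H1 = el_H \<theta> (\<delta>3 * w + \<delta>4)" "K = el_K \<theta> (\<delta>3 * w + \<delta>4)"
    "g2 = deriv (el_g \<theta>) (X x)" "H2 = deriv (el_H \<theta>) (\<delta>3 * w + \<delta>4)"
  note defs = this
  have D0: "D \<noteq> 0" using nz by (simp add: D_def)
  \<comment> \<open>\<delta>3 / D is the reciprocal of the multiplier in \<open>pullback\<close>.
    The second derivative \<open>X2\<close> is absorbed by the derivative of g / X_x.\<close>
  have lhs: "f * a' - ((g2 * H1 + h * K) * q' + g1 * H2 * q'\<^sup>2 + g1 * H1 * c') =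
    (\<delta>3 / D) * (f * D / \<delta>1\<^sup>2 * a -
     (((g2 * D * D - g1 * X2) / (D * D) * H1 + h * K) * q + g1 / D * (H2 * \<delta>3) * q\<^sup>2 + g1 / D * H1 * c))"
    unfolding q' a' c' using D0 nz(1) by (simp add: field_simps power2_eq_square)
  have "jet_eq \<theta> (X x) (\<delta>3 * w + \<delta>4) q' a' c' \<longleftrightarrow>
      f * a' - ((g2 * H1 + h * K) * q' + g1 * H2 * q'\<^sup>2 + g1 * H1 * c') = 0"
    unfolding jet_eq_def defs by simp
  also have "\<dots> \<longleftrightarrow> f * D / \<delta>1\<^sup>2 * a -
     (((g2 * D * D - g1 * X2) / (D * D) * H1 + h * K) * q + g1 / D * (H2 * \<delta>3) * q\<^sup>2 + g1 / D * H1 * c) = 0"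
    unfolding lhs using D0 nz by simp
  also have "\<dots> \<longleftrightarrow> jet_eq ?P x w q a c"
    unfolding jet_eq_def dg dH unfolding pullback_def defs D_def by simp
  finally show ?thesis .
qed

text \<open>In terms of the pulled back elements, \<delta>1, \<delta>3, \<delta>4 and
  \<open>X\<close> disappear from the formulas. What remains is the case of unchanged
  variables.\<close>

lemma listed_elements_iff_pullback:
  assumes "\<delta>1 \<noteq> 0" "\<And>x. x \<in> Ix \<Longrightarrow> deriv X x \<noteq> 0"
  shows "listed_elements Ix Iu x0 \<delta>1 \<delta>3 \<delta>4 X \<epsilon>1 \<epsilon>2 \<epsilon>3 \<epsilon>4 \<theta> \<theta>' \<longleftrightarrow>
    (let \<eta> = pullback \<delta>1 \<delta>3 \<delta>4 X \<theta>';
         E = (\<lambda>x. exp (- \<epsilon>4 * antiderivative x0 (\<lambda>y. el_h \<theta> y / el_g \<theta> y) x)) in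
      (\<forall>x\<in>Ix. el_f \<eta> x = \<epsilon>1 * el_f \<theta> x * E x \<and> el_g \<eta> x = \<epsilon>1 / \<epsilon>2 * el_g \<theta> x * E x \<and>
         el_h \<eta> x = \<epsilon>1 / \<epsilon>3 * el_h \<theta> x * E x) \<and>
      (\<forall>u\<in>Iu. el_H \<eta> u = \<epsilon>2 * el_H \<theta> u \<and> el_K \<eta> u = \<epsilon>3 * (el_K \<theta> u + \<epsilon>4 * el_H \<theta> u)))"
  unfolding listed_elements_def Let_def pullback_def
  using assms by (intro conj_cong ball_cong) (auto simp: field_simps)

lemma arb_classD:
  assumes "\<theta> \<in> arb_class I J"
  shows "smooth_on I (el_f \<theta>)" "smooth_on I (el_g \<theta>)" "smooth_on I (el_h \<theta>)"
    "smooth_on J (el_H \<theta>)" "smooth_on J (el_K \<theta>)"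
    "\<And>x. x \<in> I \<Longrightarrow> el_f \<theta> x \<noteq> 0" "\<And>x. x \<in> I \<Longrightarrow> el_g \<theta> x \<noteq> 0" "\<And>u. u \<in> J \<Longrightarrow> el_H \<theta> u \<noteq> 0"
    "\<exists>u\<in>J. deriv (el_H \<theta>) u \<noteq> 0 \<or> deriv (el_K \<theta>) u \<noteq> 0"
  using assms unfolding arb_class_def by auto

lemma deriv_cong_on:
  assumes "open N" "x \<in> N" "\<And>y. y \<in> N \<Longrightarrow> f y = g y"
  shows "deriv f x = deriv g x"
proof (rule deriv_cong_ev)
  show "\<forall>\<^sub>F y in nhds x. f y = g y" using assms eventually_nhds by blast
qed simp

text \<open>Up to the common factor \<epsilon>1 E x, the derivative of the exponential in the new
  \<open>g\<close> contributes - \<epsilon>4 h H to the coefficient of u_x, and the summand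
  \<epsilon>4 H of the new \<open>K\<close> contributes + \<epsilon>4 h H. They cancel, so the whole
  equation is just multiplied by \<epsilon>1 E x.\<close>

lemma jet_eq_listed:
  assumes Ix: "open_interval Ix" and Iu: "open Iu" and x0: "x0 \<in> Ix" and \<theta>: "\<theta> \<in> arb_class Ix Iu"
    and nz: "\<epsilon>1 * \<epsilon>2 * \<epsilon>3 \<noteq> 0" and E: "E = (\<lambda>x. exp (- \<epsilon>4 * antiderivative x0 (\<lambda>y. el_h \<theta> y / el_g \<theta> y) x))"
    and \<eta>x: "\<And>x. x \<in> Ix \<Longrightarrow> el_f \<eta> x = \<epsilon>1 * el_f \<theta> x * E x \<and> el_g \<eta> x = \<epsilon>1 / \<epsilon>2 * el_g \<theta> x * E x \<and>
      el_h \<eta> x = \<epsilon>1 / \<epsilon>3 * el_h \<theta> x * E x"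
    and \<eta>u: "\<And>u. u \<in> Iu \<Longrightarrow> el_H \<eta> u = \<epsilon>2 * el_H \<theta> u \<and> el_K \<eta> u = \<epsilon>3 * (el_K \<theta> u + \<epsilon>4 * el_H \<theta> u)"
    and x: "x \<in> Ix" and w: "w \<in> Iu"
  shows "jet_eq \<eta> x w q a c \<longleftrightarrow> jet_eq \<theta> x w q a c"
proof -
  note \<theta>s = arb_classD[OF \<theta>] and oI = open_intervalD(1)[OF Ix]
  define k where "k = (\<lambda>y. el_h \<theta> y / el_g \<theta> y)"
  have "continuous_on Ix k"
    unfolding k_def by (intro continuous_on_divide ballI smooth_on_continuous \<theta>s)
  then have A: "DERIV (antiderivative x0 k) x :> k x" by (rule DERIV_antiderivative[OF Ix x0 _ x])
  have dE: "DERIV E x :> - \<epsilon>4 * k x * E x"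
    unfolding E k_def[symmetric] by (rule derivative_eq_intros A refl)+ simp
  have g: "DERIV (el_g \<theta>) x :> deriv (el_g \<theta>) x" by (rule smooth_on_DERIV[OF \<theta>s(2) oI x])
  have H: "DERIV (el_H \<theta>) w :> deriv (el_H \<theta>) w" by (rule smooth_on_DERIV[OF \<theta>s(4) Iu w])
  have "deriv (el_g \<eta>) x = deriv (\<lambda>x. \<epsilon>1 / \<epsilon>2 * el_g \<theta> x * E x) x"
    by (rule deriv_cong_on[OF oI x]) (use \<eta>x in simp)
  also have "\<dots> = \<epsilon>1 / \<epsilon>2 * deriv (el_g \<theta>) x * E x + - \<epsilon>4 * k x * E x * (\<epsilon>1 / \<epsilon>2 * el_g \<theta> x)"
    by (rule DERIV_imp_deriv[OF DERIV_mult[OF DERIV_cmult[OF g] dE]])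
  also have "\<dots> = \<epsilon>1 * E x / \<epsilon>2 * (deriv (el_g \<theta>) x - \<epsilon>4 * el_h \<theta> x)"
    using \<theta>s(7)[OF x] by (simp add: k_def algebra_simps)
  finally have dg: "deriv (el_g \<eta>) x = \<epsilon>1 * E x / \<epsilon>2 * (deriv (el_g \<theta>) x - \<epsilon>4 * el_h \<theta> x)" .
  have "deriv (el_H \<eta>) w = deriv (\<lambda>u. \<epsilon>2 * el_H \<theta> u) w"
    by (rule deriv_cong_on[OF Iu w]) (use \<eta>u in simp)
  also have "\<dots> = \<epsilon>2 * deriv (el_H \<theta>) w" by (rule DERIV_imp_deriv[OF DERIV_cmult[OF H]])
  finally have dH: "deriv (el_H \<eta>) w = \<epsilon>2 * deriv (el_H \<theta>) w" .
  have e: "\<epsilon>1 \<noteq> 0" "\<epsilon>2 \<noteq> 0" "\<epsilon>3 \<noteq> 0" "E x \<noteq> 0" using nz by (auto simp: E)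
  let ?F = "\<lambda>\<theta>. el_f \<theta> x * a - ((deriv (el_g \<theta>) x * el_H \<theta> w + el_h \<theta> x * el_K \<theta> w) * q
       + el_g \<theta> x * deriv (el_H \<theta>) w * q\<^sup>2 + el_g \<theta> x * el_H \<theta> w * c)"
  have "?F \<eta> = \<epsilon>1 * E x * ?F \<theta>"
    unfolding dg dH conjunct1[OF \<eta>x[OF x]] conjunct1[OF conjunct2[OF \<eta>x[OF x]]]
      conjunct2[OF conjunct2[OF \<eta>x[OF x]]] conjunct1[OF \<eta>u[OF w]] conjunct2[OF \<eta>u[OF w]]
    using e by (simp add: field_simps)
  then have "?F \<eta> = 0 \<longleftrightarrow> ?F \<theta> = 0" using e by simp
  then show ?thesis unfolding jet_eq_def by simp
qed

subsection \<open>The listed transformations belong to the group\<close>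

lemma listed_ranges:
  assumes "listed_point_map It Ix Iu \<delta>1 \<delta>2 \<delta>3 \<delta>4 X \<phi>" "It \<noteq> {}" "Ix \<noteq> {}" "Iu \<noteq> {}"
  shows "x_range (It \<times> Ix \<times> Iu) \<phi> = X ` Ix" "u_range (It \<times> Ix \<times> Iu) \<phi> = (\<lambda>u. \<delta>3 * u + \<delta>4) ` Iu"
proof -
  have \<phi>: "\<phi> (t, x, u) = (\<delta>1 * t + \<delta>2, X x, \<delta>3 * u + \<delta>4)" if "t \<in> It" "x \<in> Ix" "u \<in> Iu" for t x u
    using assms(1) that by (simp add: listed_point_map_def)
  obtain t0 x0 u0 where 0: "t0 \<in> It" "x0 \<in> Ix" "u0 \<in> Iu" using assms by blast
  show "x_range (It \<times> Ix \<times> Iu) \<phi> = X ` Ix"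
  proof
    show "x_range (It \<times> Ix \<times> Iu) \<phi> \<subseteq> X ` Ix" by (auto simp: x_range_def \<phi>)
    show "X ` Ix \<subseteq> x_range (It \<times> Ix \<times> Iu) \<phi>"
    proof
      fix y assume "y \<in> X ` Ix"
      then obtain x where x: "x \<in> Ix" "y = X x" by blast
      then have "y = fst (snd (\<phi> (t0, x, u0)))" using 0 \<phi> by simp
      then show "y \<in> x_range (It \<times> Ix \<times> Iu) \<phi>" using 0 x unfolding x_range_def by blast
    qed
  qed
  show "u_range (It \<times> Ix \<times> Iu) \<phi> = (\<lambda>u. \<delta>3 * u + \<delta>4) ` Iu"
  proof
    show "u_range (It \<times> Ix \<times> Iu) \<phi> \<subseteq> (\<lambda>u. \<delta>3 * u + \<delta>4) ` Iu" by (auto simp: u_range_def \<phi>)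
    show "(\<lambda>u. \<delta>3 * u + \<delta>4) ` Iu \<subseteq> u_range (It \<times> Ix \<times> Iu) \<phi>"
    proof
      fix w assume "w \<in> (\<lambda>u. \<delta>3 * u + \<delta>4) ` Iu"
      then obtain u where u: "u \<in> Iu" "w = \<delta>3 * u + \<delta>4" by blast
      then have "w = snd (snd (\<phi> (t0, x0, u)))" using 0 \<phi> by simp
      then show "w \<in> u_range (It \<times> Ix \<times> Iu) \<phi>" using 0 u unfolding u_range_def by blast
    qed
  qed
qed

lemma open_affine_image: "open J \<Longrightarrow> a \<noteq> 0 \<Longrightarrow> open ((\<lambda>u. a * u + b :: real) ` J)"
  by (rule open_image_real[where f' = "\<lambda>_. a"]) (auto intro!: derivative_eq_intros)

lemma graph_image_eqD:
  assumes "\<phi> ` graph_over V u = graph_over W v" "(s, y) \<in> V"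
  obtains a b where "(a, b) \<in> W" "\<phi> (s, y, u (s, y)) = (a, b, v (a, b))"
proof -
  have "(s, y, u (s, y)) \<in> graph_over V u" using assms(2) by (auto simp: graph_over_def)
  then have "\<phi> (s, y, u (s, y)) \<in> graph_over W v" using assms(1) by blast
  then show thesis using that by (auto simp: graph_over_def)
qed

lemma graph_subset_boxD:
  "graph_over V u \<subseteq> It \<times> Ix \<times> Iu \<Longrightarrow> (s, y) \<in> V \<Longrightarrow> s \<in> It \<and> y \<in> Ix \<and> u (s, y) \<in> Iu"
  by (auto simp: graph_over_def)

text \<open>Only the class of \<theta>' and the form of \<phi> enter, so the equivalence serves both
  to verify the listed transformations and to extract conditions on the new elements of a given
  one.\<close>

lemma satisfies_at_listed_map:
  assumes Ix: "open_interval Ix" and Iu: "open_interval Iu"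
    and L: "listed_point_map It Ix Iu \<delta>1 \<delta>2 \<delta>3 \<delta>4 X \<phi>"
    and \<theta>': "\<theta>' \<in> arb_class (X ` Ix) ((\<lambda>u. \<delta>3 * u + \<delta>4) ` Iu)"
    and V: "open V" and W: "open W" and u: "C_k_on 2 V u" and v: "C_k_on 2 W v"
    and B: "graph_over V u \<subseteq> It \<times> Ix \<times> Iu" and im: "\<phi> ` graph_over V u = graph_over W v"
    and p: "(t, x) \<in> V"
  shows "satisfies_at \<theta>' v (\<delta>1 * t + \<delta>2, X x) \<longleftrightarrow>
    jet_eq (pullback \<delta>1 \<delta>3 \<delta>4 X \<theta>') x (u (t, x)) (D_x u (t, x)) (D_t (D_t u) (t, x)) (D_x (D_x u) (t, x))"
proof -
  note oI = open_intervalD(1)[OF Ix] and oJ = open_intervalD(1)[OF Iu]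
  have \<delta>: "\<delta>1 \<noteq> 0" "\<delta>3 \<noteq> 0" and X: "smooth_on Ix X" and X0: "\<And>y. y \<in> Ix \<Longrightarrow> deriv X y \<noteq> 0"
    and \<phi>: "\<And>s y w. s \<in> It \<Longrightarrow> y \<in> Ix \<Longrightarrow> w \<in> Iu \<Longrightarrow> \<phi> (s, y, w) = (\<delta>1 * s + \<delta>2, X y, \<delta>3 * w + \<delta>4)"
    using L by (auto simp: listed_point_map_def)
  note box = graph_subset_boxD[OF B]
  have vu: "(\<delta>1 * s + \<delta>2, X y) \<in> W \<and> v (\<delta>1 * s + \<delta>2, X y) = \<delta>3 * u (s, y) + \<delta>4" if "(s, y) \<in> V" for s y
    using graph_image_eqD[OF im that] \<phi> box[OF that] by (metis Pair_inject)
  have x: "x \<in> Ix" "u (t, x) \<in> Iu" using box[OF p] by auto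
  have dX: "DERIV X y :> deriv X y" if "(s, y) \<in> V" for s y
    using smooth_on_DERIV[OF X oI] box[OF that] by blast
  have dX2: "DERIV (deriv X) x :> deriv (deriv X) x"
    by (rule smooth_on_DERIV[OF smooth_on_deriv[OF X oI] oI x(1)])
  have dU: "DERIV (\<lambda>w. \<delta>3 * w + \<delta>4) w :> (\<lambda>_. \<delta>3) w" "DERIV (\<lambda>_. \<delta>3) w :> 0" for w :: real
    by (auto intro!: derivative_eq_intros)
  note jets = separated_jets[where U = "\<lambda>w. \<delta>3 * w + \<delta>4" and U' = "\<lambda>_. \<delta>3",
      OF V W u v p vu dX dX2 dU(1) dU(2)]
  have g: "DERIV (el_g \<theta>') (X x) :> deriv (el_g \<theta>') (X x)"
    by (rule smooth_on_DERIV[OF arb_classD(2)[OF \<theta>'] smooth_on_inv_into(1)[OF Ix X X0]]) (use x in auto)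
  have H: "DERIV (el_H \<theta>') (\<delta>3 * u (t, x) + \<delta>4) :> deriv (el_H \<theta>') (\<delta>3 * u (t, x) + \<delta>4)"
    by (rule smooth_on_DERIV[OF arb_classD(4)[OF \<theta>'] open_affine_image[OF oJ \<delta>(2)]]) (use x in auto)
  have vq: "v (\<delta>1 * t + \<delta>2, X x) = \<delta>3 * u (t, x) + \<delta>4" using vu[OF p] by simp
  have "satisfies_at \<theta>' v (\<delta>1 * t + \<delta>2, X x) \<longleftrightarrow>
      jet_eq \<theta>' (X x) (\<delta>3 * u (t, x) + \<delta>4) (D_x v (\<delta>1 * t + \<delta>2, X x))
        (D_t (D_t v) (\<delta>1 * t + \<delta>2, X x)) (D_x (D_x v) (\<delta>1 * t + \<delta>2, X x))"
    using satisfies_at_iff_jet_eq[OF W v conjunct1[OF vu[OF p]] g] H unfolding vq by blast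
  also have "\<dots> \<longleftrightarrow> jet_eq (pullback \<delta>1 \<delta>3 \<delta>4 X \<theta>') x (u (t, x)) (D_x u (t, x))
      (D_t (D_t u) (t, x)) (D_x (D_x u) (t, x))"
    by (rule jet_eq_pullback[OF \<delta> X0[OF x(1)] dX[OF p] dX2 g H]) (use jets in simp_all)
  finally show ?thesis .
qed

lemma listed_maps_equation:
  assumes Ix: "open_interval Ix" and Iu: "open_interval Iu" and x0: "x0 \<in> Ix"
    and L: "listed_point_map It Ix Iu \<delta>1 \<delta>2 \<delta>3 \<delta>4 X \<phi>"
    and \<theta>: "\<theta> \<in> arb_class Ix Iu" and \<theta>': "\<theta>' \<in> arb_class (X ` Ix) ((\<lambda>u. \<delta>3 * u + \<delta>4) ` Iu)"
    and nz: "\<epsilon>1 * \<epsilon>2 * \<epsilon>3 \<noteq> 0"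
    and E: "listed_elements Ix Iu x0 \<delta>1 \<delta>3 \<delta>4 X \<epsilon>1 \<epsilon>2 \<epsilon>3 \<epsilon>4 \<theta> \<theta>'"
  shows "maps_equation (It \<times> Ix \<times> Iu) \<phi> \<theta> \<theta>'"
  unfolding maps_equation_def
proof (intro allI impI ballI)
  fix V W u v p q
  assume A: "open V \<and> open W \<and> C_k_on 2 V u \<and> C_k_on 2 W v \<and>
        graph_over V u \<subseteq> It \<times> Ix \<times> Iu \<and> \<phi> ` graph_over V u = graph_over W v"
    and p: "p \<in> V" and q: "q \<in> W" and pq: "\<phi> (fst p, snd p, u p) = (fst q, snd q, v q)"
  obtain t x where tx: "p = (t, x)" by fastforce
  have box: "t \<in> It" "x \<in> Ix" "u (t, x) \<in> Iu"
    using graph_subset_boxD[of V u It Ix Iu t x] A p tx by auto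
  have \<phi>: "\<phi> (t, x, u (t, x)) = (\<delta>1 * t + \<delta>2, X x, \<delta>3 * u (t, x) + \<delta>4)"
    using L box by (simp add: listed_point_map_def)
  have \<delta>1: "\<delta>1 \<noteq> 0" and X0: "\<And>x. x \<in> Ix \<Longrightarrow> deriv X x \<noteq> 0"
    using L by (auto simp: listed_point_map_def)
  have qe: "q = (\<delta>1 * t + \<delta>2, X x)" using pq \<phi> tx by (cases q) simp
  note oI = open_intervalD(1)[OF Ix] and oJ = open_intervalD(1)[OF Iu]
  define \<eta> where "\<eta> = pullback \<delta>1 \<delta>3 \<delta>4 X \<theta>'"
  define F where "F = (\<lambda>x. exp (- \<epsilon>4 * antiderivative x0 (\<lambda>y. el_h \<theta> y / el_g \<theta> y) x))"
  have "listed_elements Ix Iu x0 \<delta>1 \<delta>3 \<delta>4 X \<epsilon>1 \<epsilon>2 \<epsilon>3 \<epsilon>4 \<theta> \<theta>' \<longleftrightarrow>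
      (\<forall>x\<in>Ix. el_f \<eta> x = \<epsilon>1 * el_f \<theta> x * F x \<and> el_g \<eta> x = \<epsilon>1 / \<epsilon>2 * el_g \<theta> x * F x \<and>
         el_h \<eta> x = \<epsilon>1 / \<epsilon>3 * el_h \<theta> x * F x) \<and>
      (\<forall>u\<in>Iu. el_H \<eta> u = \<epsilon>2 * el_H \<theta> u \<and> el_K \<eta> u = \<epsilon>3 * (el_K \<theta> u + \<epsilon>4 * el_H \<theta> u))"
    unfolding F_def \<eta>_def using listed_elements_iff_pullback[OF \<delta>1 X0] unfolding Let_def by blast
  with E have E': "\<And>x. x \<in> Ix \<Longrightarrow> el_f \<eta> x = \<epsilon>1 * el_f \<theta> x * F x \<and> el_g \<eta> x = \<epsilon>1 / \<epsilon>2 * el_g \<theta> x * F x \<and>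
         el_h \<eta> x = \<epsilon>1 / \<epsilon>3 * el_h \<theta> x * F x"
      "\<And>u. u \<in> Iu \<Longrightarrow> el_H \<eta> u = \<epsilon>2 * el_H \<theta> u \<and> el_K \<eta> u = \<epsilon>3 * (el_K \<theta> u + \<epsilon>4 * el_H \<theta> u)"
    by blast+
  have "satisfies_at \<theta> u (t, x) \<longleftrightarrow>
      jet_eq \<theta> x (u (t, x)) (D_x u (t, x)) (D_t (D_t u) (t, x)) (D_x (D_x u) (t, x))"
    using A p tx
    by (intro satisfies_at_iff_jet_eq smooth_on_DERIV[OF arb_classD(2)[OF \<theta>] oI box(2)]
        smooth_on_DERIV[OF arb_classD(4)[OF \<theta>] oJ box(3)]) auto
  also have "\<dots> \<longleftrightarrow> jet_eq (pullback \<delta>1 \<delta>3 \<delta>4 X \<theta>') x (u (t, x)) (D_x u (t, x))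
      (D_t (D_t u) (t, x)) (D_x (D_x u) (t, x))"
    using jet_eq_listed[OF Ix oJ x0 \<theta> nz F_def E' box(2,3)] unfolding \<eta>_def by blast
  also have "\<dots> \<longleftrightarrow> satisfies_at \<theta>' v (\<delta>1 * t + \<delta>2, X x)"
    using satisfies_at_listed_map[OF Ix Iu L \<theta>', of V W u v t x] A p tx by blast
  finally show "satisfies_at \<theta> u p \<longleftrightarrow> satisfies_at \<theta>' v q" unfolding tx qe .
qed

lemma listed_frechet_derivative:
  assumes "open It" "open Ix" "open Iu" and L: "listed_point_map It Ix Iu \<delta>1 \<delta>2 \<delta>3 \<delta>4 X \<phi>"
    and p: "p \<in> It \<times> Ix \<times> Iu"
  shows "frechet_derivative \<phi> (at p) = (\<lambda>h. (\<delta>1 * fst h, deriv X (fst (snd p)) * fst (snd h), \<delta>3 * snd (snd h)))"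
    (is "_ = ?D")
proof -
  let ?B = "It \<times> Ix \<times> Iu"
  let ?F = "\<lambda>p::point. (\<delta>1 * fst p + \<delta>2, X (fst (snd p)), \<delta>3 * snd (snd p) + \<delta>4)"
  have op: "open ?B" using assms by (simp add: open_Times)
  have X: "smooth_on Ix X" and \<phi>: "\<And>p. p \<in> ?B \<Longrightarrow> ?F p = \<phi> p"
    using L by (auto simp: listed_point_map_def)
  have x: "fst (snd p) \<in> Ix" using p by auto
  have "(X has_derivative (*) (deriv X (fst (snd p)))) (at (fst (snd p)))"
    using smooth_on_DERIV[OF X assms(2) x] by (simp add: has_field_derivative_def)
  moreover have "((\<lambda>p. fst (snd p)) has_derivative (\<lambda>h. fst (snd h))) (at p)"
    by (auto intro!: derivative_eq_intros)
  ultimately have dX: "((\<lambda>p. X (fst (snd p))) has_derivative (\<lambda>h. deriv X (fst (snd p)) * fst (snd h))) (at p)"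
    by (rule has_derivative_compose[where f = "\<lambda>p. fst (snd p)" and g = X, rotated])
  have "(?F has_derivative ?D) (at p)"
    by (intro has_derivative_Pair dX) (auto intro!: derivative_eq_intros)
  then have "(\<phi> has_derivative ?D) (at p)"
    by (rule has_derivative_transform_within_open[OF _ op p \<phi>])
  then show ?thesis by (rule frechet_derivative_at[symmetric])
qed

lemma listed_point_transformation:
  assumes "open It" "open Ix" "open Iu" and L: "listed_point_map It Ix Iu \<delta>1 \<delta>2 \<delta>3 \<delta>4 X \<phi>"
  shows "point_transformation (It \<times> Ix \<times> Iu) \<phi>"
proof -
  let ?B = "It \<times> Ix \<times> Iu"
  let ?F = "\<lambda>p::point. (\<delta>1 * fst p + \<delta>2, X (fst (snd p)), \<delta>3 * snd (snd p) + \<delta>4)"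
  have op: "open ?B" using assms by (simp add: open_Times)
  have \<delta>: "\<delta>1 \<noteq> 0" "\<delta>3 \<noteq> 0" and X: "smooth_on Ix X" and X0: "\<And>y. y \<in> Ix \<Longrightarrow> deriv X y \<noteq> 0"
    and \<phi>: "\<And>p. p \<in> ?B \<Longrightarrow> ?F p = \<phi> p"
    using L by (auto simp: listed_point_map_def)
  have "smooth_on ?B ?F"
    by (intro smooth_on_intros smooth_on_compose[OF op assms(2) X] op) auto
  then have smooth: "smooth_on ?B \<phi>" by (rule smooth_on_cong[OF _ op \<phi>])
  have "bij (frechet_derivative \<phi> (at p))" if p: "p \<in> ?B" for p
  proof -
    have x: "fst (snd p) \<in> Ix" using p by auto
    show ?thesis
      unfolding listed_frechet_derivative[OF assms p]
      by (rule o_bij[where g = "\<lambda>h. (fst h / \<delta>1, fst (snd h) / deriv X (fst (snd p)), snd (snd h) / \<delta>3)"])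
        (use \<delta> X0[OF x] in \<open>simp_all add: fun_eq_iff\<close>)
  qed
  then show ?thesis using smooth unfolding point_transformation_def by blast
qed

section \<open>Smooth families of arbitrary elements\<close>

lemma smooth_on_reparametrise:
  fixes G :: "real \<times> real \<Rightarrow> real" and I' :: "real set"
  assumes "open I" "open I'" "smooth_on (UNIV \<times> I) G" "smooth_on I' Y" "Y ` I' \<subseteq> I"
  shows "smooth_on (UNIV \<times> I') (\<lambda>p. G (fst p, Y (snd p)))"
proof -
  have o: "open (UNIV \<times> I :: (real \<times> real) set)" "open (UNIV \<times> I' :: (real \<times> real) set)"
    using assms by (auto simp: open_Times)
  show ?thesis
    by (intro smooth_on_compose[OF o(2,1) assms(3)] smooth_on_Pair o smooth_on_fst smooth_on_ident
        smooth_on_compose[OF o(2) assms(2,4)] smooth_on_snd) (use assms(5) in auto)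
qed

lemma smooth_on_slice:
  fixes G :: "real \<times> real \<Rightarrow> real"
  assumes "open I" "smooth_on (UNIV \<times> I) G"
  shows "smooth_on I (\<lambda>y. G (s, y))"
  by (rule smooth_on_compose[OF assms(1) _ assms(2)])
    (use assms(1) in \<open>auto intro!: smooth_on_Pair smooth_on_const smooth_on_ident open_Times\<close>)

lemma smooth_on_extend:
  fixes F :: "real \<Rightarrow> real"
  assumes "open I" "smooth_on I F"
  shows "smooth_on (UNIV \<times> I) (\<lambda>p::real \<times> real. F (snd p))"
  by (rule smooth_on_compose[OF _ assms(1,2)])
    (use assms(1) in \<open>auto intro!: smooth_on_snd smooth_on_ident open_Times\<close>)

lemma smooth_family_const:
  assumes "open I" "open J" "\<theta> \<in> arb_class I J"
  shows "smooth_family I J (\<lambda>s. \<theta>)"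
  using assms arb_classD(1-5)[OF assms(3)] smooth_on_extend
  by (auto simp: smooth_family_def case_prod_unfold)

text \<open>Constant families are smooth, so the definition of \<open>smooth_operator\<close>
  applies to single tuples.\<close>

lemma smooth_operator_arb_class:
  assumes "smooth_operator I J I' J' \<Psi>" "open I" "open J" "\<theta> \<in> arb_class I J"
  shows "\<Psi> \<theta> \<in> arb_class I' J'"
proof -
  have "smooth_family I' J' (\<lambda>s. \<Psi> \<theta>)"
    using assms(1) smooth_family_const[OF assms(2-4)] unfolding smooth_operator_def by blast
  then show ?thesis unfolding smooth_family_def by blast
qed

text \<open>With constants \<epsilon>1, ..., \<epsilon>4 common to all tuples, the new elements of a
  family are explicit expressions in \<open>s\<close> and the old variable, composed with the
  inverses \<open>Y\<close> and \<open>Z\<close> of the changes of \<open>x\<close> and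
  \<open>u\<close>. The nonlocal factor is jointly smooth by
  \<open>smooth_on_antiderivative\<close>.\<close>

lemma listed_smooth_operator:
  assumes Ix: "open_interval Ix" and Iu: "open_interval Iu" and x0: "x0 \<in> Ix"
    and L: "listed_point_map It Ix Iu \<delta>1 \<delta>2 \<delta>3 \<delta>4 X \<phi>" and nz: "\<epsilon>1 * \<epsilon>2 * \<epsilon>3 \<noteq> 0"
    and E: "\<And>\<theta>. \<theta> \<in> arb_class Ix Iu \<Longrightarrow> listed_elements Ix Iu x0 \<delta>1 \<delta>3 \<delta>4 X \<epsilon>1 \<epsilon>2 \<epsilon>3 \<epsilon>4 \<theta> (\<Psi> \<theta>)"
  shows "smooth_operator Ix Iu (X ` Ix) ((\<lambda>u. \<delta>3 * u + \<delta>4) ` Iu) \<Psi>"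
  unfolding smooth_operator_def
proof (intro allI impI)
  fix \<Theta> assume \<Theta>: "smooth_family Ix Iu \<Theta>"
  note oI = open_intervalD(1)[OF Ix] and oJ = open_intervalD(1)[OF Iu]
  have \<delta>: "\<delta>1 \<noteq> 0" "\<delta>3 \<noteq> 0" and X: "smooth_on Ix X" and X0: "\<And>y. y \<in> Ix \<Longrightarrow> deriv X y \<noteq> 0"
    using L by (auto simp: listed_point_map_def)
  let ?I = "X ` Ix" and ?J = "(\<lambda>u. \<delta>3 * u + \<delta>4) ` Iu"
  define Y where "Y = inv_into Ix X"
  define Z where "Z = (\<lambda>w. (w + - \<delta>4) / \<delta>3)"
  have oI': "open ?I" and inj: "inj_on X Ix" and sY: "smooth_on ?I Y"
    unfolding Y_def by (rule smooth_on_inv_into[OF Ix X X0]; assumption)+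
  have oJ': "open ?J" by (rule open_affine_image[OF oJ \<delta>(2)])
  have sZ: "smooth_on ?J Z" unfolding Z_def
    by (intro smooth_on_divide smooth_on_add smooth_on_const smooth_on_ident oJ') (use \<delta> in auto)
  have YX: "Y (X x) = x" if "x \<in> Ix" for x using inj that by (simp add: Y_def)
  have YI: "Y y \<in> Ix" "X (Y y) = y" if "y \<in> ?I" for y
    using that by (auto simp: Y_def inv_into_into f_inv_into_f)
  have ZI: "Z w \<in> Iu" "\<delta>3 * Z w + \<delta>4 = w" if "w \<in> ?J" for w using that \<delta> by (auto simp: Z_def)
  have cls: "\<Theta> s \<in> arb_class Ix Iu" for s using \<Theta> by (simp add: smooth_family_def)
  have sm: "smooth_on (UNIV \<times> Ix) (\<lambda>p. el_f (\<Theta> (fst p)) (snd p))"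
     "smooth_on (UNIV \<times> Ix) (\<lambda>p. el_g (\<Theta> (fst p)) (snd p))"
     "smooth_on (UNIV \<times> Ix) (\<lambda>p. el_h (\<Theta> (fst p)) (snd p))"
     "smooth_on (UNIV \<times> Iu) (\<lambda>p. el_H (\<Theta> (fst p)) (snd p))"
     "smooth_on (UNIV \<times> Iu) (\<lambda>p. el_K (\<Theta> (fst p)) (snd p))"
    using \<Theta> by (auto simp: smooth_family_def case_prod_unfold)
  have oB: "open (UNIV \<times> Ix :: (real \<times> real) set)" "open (UNIV \<times> Iu :: (real \<times> real) set)"
    using oI oJ by (auto simp: open_Times)
  have oB': "open (UNIV \<times> ?I :: (real \<times> real) set)" "open (UNIV \<times> ?J :: (real \<times> real) set)"
    using oI' oJ' by (auto simp: open_Times)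
  define A where "A = (\<lambda>p. antiderivative x0 (\<lambda>y. el_h (\<Theta> (fst p)) y / el_g (\<Theta> (fst p)) y) (snd p))"
  have "smooth_on (UNIV \<times> Ix) (\<lambda>p. el_h (\<Theta> (fst p)) (snd p) / el_g (\<Theta> (fst p)) (snd p))"
    by (intro smooth_on_divide oB sm) (use cls arb_classD(7) in fastforce)
  from smooth_on_antiderivative[OF Ix x0 this] have sA: "smooth_on (UNIV \<times> Ix) A"
    by (simp add: A_def case_prod_unfold)
  define Ef where "Ef = (\<lambda>p. \<epsilon>1 * \<delta>1\<^sup>2 / deriv X (snd p) * el_f (\<Theta> (fst p)) (snd p) * exp (- \<epsilon>4 * A p))"
  define Eg where "Eg = (\<lambda>p. \<epsilon>1 * inverse \<epsilon>2 * deriv X (snd p) * el_g (\<Theta> (fst p)) (snd p) * exp (- \<epsilon>4 * A p))"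
  define Eh where "Eh = (\<lambda>p. \<epsilon>1 * inverse \<epsilon>3 * el_h (\<Theta> (fst p)) (snd p) * exp (- \<epsilon>4 * A p))"
  define EH where "EH = (\<lambda>p. \<epsilon>2 * el_H (\<Theta> (fst p)) (snd p))"
  define EK where "EK = (\<lambda>p. \<epsilon>3 * (el_K (\<Theta> (fst p)) (snd p) + \<epsilon>4 * el_H (\<Theta> (fst p)) (snd p)))"
  note sX' = smooth_on_extend[OF oI smooth_on_deriv[OF X oI]]
  have sE: "smooth_on (UNIV \<times> Ix) Ef" "smooth_on (UNIV \<times> Ix) Eg" "smooth_on (UNIV \<times> Ix) Eh"
     "smooth_on (UNIV \<times> Iu) EH" "smooth_on (UNIV \<times> Iu) EK"
    unfolding Ef_def Eg_def Eh_def EH_def EK_def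
    by (intro smooth_on_mult smooth_on_exp smooth_on_divide smooth_on_const smooth_on_add oB sm sA sX';
        use X0 in force)+
  have val: "el_f (\<Psi> (\<Theta> s)) y = Ef (s, Y y)" "el_g (\<Psi> (\<Theta> s)) y = Eg (s, Y y)"
    "el_h (\<Psi> (\<Theta> s)) y = Eh (s, Y y)" if "y \<in> ?I" for s y
    using E[OF cls[of s]] YI[OF that]
    unfolding listed_elements_def Let_def Ef_def Eg_def Eh_def A_def by (metis fst_conv snd_conv)+
  have valu: "el_H (\<Psi> (\<Theta> s)) w = EH (s, Z w)" "el_K (\<Psi> (\<Theta> s)) w = EK (s, Z w)" if "w \<in> ?J" for s w
    using E[OF cls[of s]] ZI[OF that]
    unfolding listed_elements_def Let_def EH_def EK_def by (metis fst_conv snd_conv)+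
  have YI': "Y ` ?I \<subseteq> Ix" using YI(1) by blast
  have ZJ: "Z ` ?J \<subseteq> Iu" using ZI(1) by blast
  have sm': "smooth_on (UNIV \<times> ?I) (\<lambda>p. el_f (\<Psi> (\<Theta> (fst p))) (snd p))"
     "smooth_on (UNIV \<times> ?I) (\<lambda>p. el_g (\<Psi> (\<Theta> (fst p))) (snd p))"
     "smooth_on (UNIV \<times> ?I) (\<lambda>p. el_h (\<Psi> (\<Theta> (fst p))) (snd p))"
     "smooth_on (UNIV \<times> ?J) (\<lambda>p. el_H (\<Psi> (\<Theta> (fst p))) (snd p))"
     "smooth_on (UNIV \<times> ?J) (\<lambda>p. el_K (\<Psi> (\<Theta> (fst p))) (snd p))"
    by (rule smooth_on_cong[OF smooth_on_reparametrise[OF oI oI' sE(1) sY YI'] oB'(1)], use val in force,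
       rule smooth_on_cong[OF smooth_on_reparametrise[OF oI oI' sE(2) sY YI'] oB'(1)], use val in force,
       rule smooth_on_cong[OF smooth_on_reparametrise[OF oI oI' sE(3) sY YI'] oB'(1)], use val in force,
       rule smooth_on_cong[OF smooth_on_reparametrise[OF oJ oJ' sE(4) sZ ZJ] oB'(2)], use valu in force,
       rule smooth_on_cong[OF smooth_on_reparametrise[OF oJ oJ' sE(5) sZ ZJ] oB'(2)], use valu in force)
  have "\<Psi> (\<Theta> s) \<in> arb_class ?I ?J" for s
  proof -
    note c = arb_classD[OF cls[of s]]
    have sl: "smooth_on ?I (el_f (\<Psi> (\<Theta> s)))" "smooth_on ?I (el_g (\<Psi> (\<Theta> s)))" "smooth_on ?I (el_h (\<Psi> (\<Theta> s)))"
      "smooth_on ?J (el_H (\<Psi> (\<Theta> s)))" "smooth_on ?J (el_K (\<Psi> (\<Theta> s)))"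
      using smooth_on_slice[OF oI' sm'(1)] smooth_on_slice[OF oI' sm'(2)] smooth_on_slice[OF oI' sm'(3)]
        smooth_on_slice[OF oJ' sm'(4)] smooth_on_slice[OF oJ' sm'(5)] by auto
    have "el_f (\<Psi> (\<Theta> s)) y \<noteq> 0 \<and> el_g (\<Psi> (\<Theta> s)) y \<noteq> 0" if "y \<in> ?I" for y
      unfolding val[OF that] Ef_def Eg_def using nz \<delta> X0[OF YI(1)[OF that]] c(6,7)[OF YI(1)[OF that]] by simp
    moreover have "el_H (\<Psi> (\<Theta> s)) w \<noteq> 0" if "w \<in> ?J" for w
      unfolding valu[OF that] EH_def using nz c(8)[OF ZI(1)[OF that]] by simp
    \<comment> \<open>Nonlinearity survives, because (H_u, K_u) is mapped to (\<epsilon>2 H_u,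
      \<epsilon>3 (K_u + \<epsilon>4 H_u)) / \<delta>3 by an invertible linear map.\<close>
    moreover have "\<exists>w\<in>?J. deriv (el_H (\<Psi> (\<Theta> s))) w \<noteq> 0 \<or> deriv (el_K (\<Psi> (\<Theta> s))) w \<noteq> 0"
    proof -
      obtain u where u: "u \<in> Iu" and d: "deriv (el_H (\<Theta> s)) u \<noteq> 0 \<or> deriv (el_K (\<Theta> s)) u \<noteq> 0"
        using c(9) by blast
      let ?w = "\<delta>3 * u + \<delta>4"
      have w: "?w \<in> ?J" using u by blast
      have lin: "DERIV (\<lambda>u. \<delta>3 * u + \<delta>4) u :> \<delta>3" by (auto intro!: derivative_eq_intros)
      have ev: "EH (s, Z (\<delta>3 * r + \<delta>4)) = \<epsilon>2 * el_H (\<Theta> s) r"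
        "EK (s, Z (\<delta>3 * r + \<delta>4)) = \<epsilon>3 * (el_K (\<Theta> s) r + \<epsilon>4 * el_H (\<Theta> s) r)" for r
        using \<delta> by (simp_all add: EH_def EK_def Z_def)
      have H: "deriv (el_H (\<Psi> (\<Theta> s))) ?w * \<delta>3 = \<epsilon>2 * deriv (el_H (\<Theta> s)) u"
      proof (rule DERIV_unique_on[OF _ _ oJ u])
        show "DERIV (\<lambda>u. el_H (\<Psi> (\<Theta> s)) (\<delta>3 * u + \<delta>4)) u :> deriv (el_H (\<Psi> (\<Theta> s))) ?w * \<delta>3"
          by (rule DERIV_chain2[OF smooth_on_DERIV[OF sl(4) oJ' w] lin])
        show "DERIV (\<lambda>u. \<epsilon>2 * el_H (\<Theta> s) u) u :> \<epsilon>2 * deriv (el_H (\<Theta> s)) u"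
          by (rule DERIV_cmult[OF smooth_on_DERIV[OF c(4) oJ u]])
        show "el_H (\<Psi> (\<Theta> s)) (\<delta>3 * r + \<delta>4) = \<epsilon>2 * el_H (\<Theta> s) r" if "r \<in> Iu" for r
          using valu(1)[OF imageI[OF that], of s] by (simp only: ev)
      qed
      have K: "deriv (el_K (\<Psi> (\<Theta> s))) ?w * \<delta>3 = \<epsilon>3 * (deriv (el_K (\<Theta> s)) u + \<epsilon>4 * deriv (el_H (\<Theta> s)) u)"
      proof (rule DERIV_unique_on[OF _ _ oJ u])
        show "DERIV (\<lambda>u. el_K (\<Psi> (\<Theta> s)) (\<delta>3 * u + \<delta>4)) u :> deriv (el_K (\<Psi> (\<Theta> s))) ?w * \<delta>3"
          by (rule DERIV_chain2[OF smooth_on_DERIV[OF sl(5) oJ' w] lin])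
        show "DERIV (\<lambda>u. \<epsilon>3 * (el_K (\<Theta> s) u + \<epsilon>4 * el_H (\<Theta> s) u)) u :>
            \<epsilon>3 * (deriv (el_K (\<Theta> s)) u + \<epsilon>4 * deriv (el_H (\<Theta> s)) u)"
          by (intro DERIV_cmult DERIV_add smooth_on_DERIV[OF c(5) oJ u] smooth_on_DERIV[OF c(4) oJ u])
        show "el_K (\<Psi> (\<Theta> s)) (\<delta>3 * r + \<delta>4) = \<epsilon>3 * (el_K (\<Theta> s) r + \<epsilon>4 * el_H (\<Theta> s) r)" if "r \<in> Iu" for r
          using valu(2)[OF imageI[OF that], of s] by (simp only: ev)
      qed
      have "deriv (el_H (\<Psi> (\<Theta> s))) ?w \<noteq> 0 \<or> deriv (el_K (\<Psi> (\<Theta> s))) ?w \<noteq> 0"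
      proof (rule ccontr)
        assume "\<not> ?thesis"
        then have "\<epsilon>2 * deriv (el_H (\<Theta> s)) u = 0"
          "\<epsilon>3 * (deriv (el_K (\<Theta> s)) u + \<epsilon>4 * deriv (el_H (\<Theta> s)) u) = 0" using H K by simp_all
        then show False using d nz by auto
      qed
      then show ?thesis using w by blast
    qed
    ultimately show ?thesis using sl unfolding arb_class_def by blast
  qed
  then show "smooth_family ?I ?J (\<lambda>s. \<Psi> (\<Theta> s))"
    using sm' unfolding smooth_family_def case_prod_unfold by blast
qed

subsection \<open>Transformation of 2-jets\<close>

lemma has_vector_derivative_chain:
  assumes F: "(F has_derivative F') (at (\<Gamma> s))" and \<Gamma>: "(\<Gamma> has_vector_derivative w) (at s)"
  shows "((\<lambda>s. F (\<Gamma> s)) has_vector_derivative F' w) (at s)"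
proof -
  have "((\<lambda>s. F (\<Gamma> s)) has_derivative (\<lambda>h. F' (h *\<^sub>R w))) (at s)"
    by (rule has_derivative_compose[OF \<Gamma>[unfolded has_vector_derivative_def] F])
  moreover have "(\<lambda>h. F' (h *\<^sub>R w)) = (\<lambda>h. h *\<^sub>R F' w)"
    by (rule ext) (rule linear_cmul[OF has_derivative_linear[OF F]])
  ultimately show ?thesis by (simp only: has_vector_derivative_def)
qed

text \<open>The quadratic form of the second derivative, that is, its value on the pair (w, w). Only
  the diagonal is recorded, as the equations contain pure second derivatives.\<close>

definition second_derivative :: "('a::real_normed_vector \<Rightarrow> 'b::real_normed_vector) \<Rightarrow> 'a \<Rightarrow> 'a \<Rightarrow> 'b" where
  "second_derivative F p w = frechet_derivative (\<lambda>q. frechet_derivative F (at q) w) (at p) w"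

text \<open>The direction \<Gamma>' s moves with \<open>s\<close>, so the derivative of
  \<open>F\<close> is expanded in the basis and the product rule is applied to each coefficient.
  This yields D^2F[\<Gamma>', \<Gamma>'] + DF[\<Gamma>''].\<close>

lemma second_derivative_along_curve:
  fixes F :: "'a::euclidean_space \<Rightarrow> 'b::real_normed_vector"
  assumes S: "open S" and F: "C_k_on (Suc (Suc 0)) S F" and N: "s0 \<in> N"
    and \<Gamma>: "\<And>s. s \<in> N \<Longrightarrow> (\<Gamma> has_vector_derivative \<Gamma>' s) (at s)" "\<And>s. s \<in> N \<Longrightarrow> \<Gamma> s \<in> S"
    and \<Gamma>': "(\<Gamma>' has_vector_derivative z) (at s0)" and ev: "open N"
  shows "((\<lambda>s. frechet_derivative F (at (\<Gamma> s)) (\<Gamma>' s)) has_vector_derivative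
      second_derivative F (\<Gamma> s0) (\<Gamma>' s0) + frechet_derivative F (at (\<Gamma> s0)) z) (at s0)"
proof -
  let ?G = "\<lambda>i q. frechet_derivative F (at q) i"
  let ?p = "\<Gamma> s0" and ?w = "\<Gamma>' s0"
  have p: "?p \<in> S" by (rule \<Gamma>(2)[OF N])
  have dG: "(?G i has_derivative frechet_derivative (?G i) (at ?p)) (at ?p)" for i
    by (rule C_k_on_Suc_has_derivative[OF C_k_on_Suc_derivative[OF F] S p])
  have exp: "frechet_derivative F (at q) y = (\<Sum>i\<in>Basis. (y \<bullet> i) *\<^sub>R ?G i q)" if "q \<in> S" for q y
    by (rule linear_euclidean_expansion[OF has_derivative_bounded_linear[OF C_k_on_Suc_has_derivative[OF F S that]]])
  have "((\<lambda>q. \<Sum>i\<in>Basis. (?w \<bullet> i) *\<^sub>R ?G i q) has_derivative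
      (\<lambda>h. \<Sum>i\<in>Basis. (?w \<bullet> i) *\<^sub>R frechet_derivative (?G i) (at ?p) h)) (at ?p)"
    by (intro has_derivative_sum has_derivative_scaleR_right dG)
  then have "((\<lambda>q. frechet_derivative F (at q) ?w) has_derivative
      (\<lambda>h. \<Sum>i\<in>Basis. (?w \<bullet> i) *\<^sub>R frechet_derivative (?G i) (at ?p) h)) (at ?p)"
    by (rule has_derivative_transform_within_open[OF _ S p]) (rule exp[symmetric])
  then have "frechet_derivative (\<lambda>q. frechet_derivative F (at q) ?w) (at ?p) =
      (\<lambda>h. \<Sum>i\<in>Basis. (?w \<bullet> i) *\<^sub>R frechet_derivative (?G i) (at ?p) h)"
    by (rule frechet_derivative_at[symmetric])
  then have dd: "second_derivative F ?p ?w = (\<Sum>i\<in>Basis. (?w \<bullet> i) *\<^sub>R frechet_derivative (?G i) (at ?p) ?w)"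
    unfolding second_derivative_def by simp
  have "((\<lambda>s. \<Sum>i\<in>Basis. (\<Gamma>' s \<bullet> i) *\<^sub>R ?G i (\<Gamma> s)) has_vector_derivative
      (\<Sum>i\<in>Basis. (?w \<bullet> i) *\<^sub>R frechet_derivative (?G i) (at ?p) ?w + (z \<bullet> i) *\<^sub>R ?G i ?p)) (at s0)"
  proof (intro has_vector_derivative_sum has_vector_derivative_scaleR)
    fix i :: 'a
    show "((\<lambda>s. \<Gamma>' s \<bullet> i) has_field_derivative z \<bullet> i) (at s0)"
      using bounded_linear.has_vector_derivative[OF bounded_linear_inner_left \<Gamma>']
      by (simp add: has_real_derivative_iff_has_vector_derivative)
    show "((\<lambda>s. ?G i (\<Gamma> s)) has_vector_derivative frechet_derivative (?G i) (at ?p) ?w) (at s0)"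
      by (rule has_vector_derivative_chain[OF dG \<Gamma>(1)[OF N]])
  qed
  moreover have "(\<Sum>i\<in>Basis. (?w \<bullet> i) *\<^sub>R frechet_derivative (?G i) (at ?p) ?w + (z \<bullet> i) *\<^sub>R ?G i ?p) =
      second_derivative F ?p ?w + frechet_derivative F (at ?p) z"
    unfolding dd exp[OF p, of z] by (rule sum.distrib)
  ultimately have *: "((\<lambda>s. \<Sum>i\<in>Basis. (\<Gamma>' s \<bullet> i) *\<^sub>R ?G i (\<Gamma> s)) has_vector_derivative
      second_derivative F ?p ?w + frechet_derivative F (at ?p) z) (at s0)" by simp
  show ?thesis
    by (rule has_vector_derivative_transform_within_open[OF * ev N]) (rule exp[OF \<Gamma>(2), symmetric])
qed

lemma vector_derivative_unique_on:
  fixes f g :: "real \<Rightarrow> 'a::real_normed_vector"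
  assumes "(f has_vector_derivative a) (at s)" "(g has_vector_derivative b) (at s)"
    and "open N" "s \<in> N" "\<And>r. r \<in> N \<Longrightarrow> f r = g r"
  shows "a = b"
  using has_vector_derivative_transform_within_open[OF assms(1,3,4,5)] assms(2)
    vector_derivative_unique_at by blast

section \<open>Images of graphs\<close>

definition base :: "point \<Rightarrow> real \<times> real" where
  "base p = (fst p, fst (snd p))"

lemma bounded_linear_base: "bounded_linear base"
  unfolding base_def[abs_def]
  by (intro bounded_linear_Pair bounded_linear_fst bounded_linear_compose[OF bounded_linear_fst bounded_linear_snd])

lemma bounded_linear_height: "bounded_linear (\<lambda>p::point. snd (snd p))"
  by (rule bounded_linear_compose[OF bounded_linear_snd bounded_linear_snd])

lemma plane_linear_expansion:
  fixes L :: "real \<times> real \<Rightarrow> 'b::real_vector"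
  assumes "linear L"
  shows "L d = fst d *\<^sub>R L (1, 0) + snd d *\<^sub>R L (0, 1)"
proof -
  have "L (fst d *\<^sub>R (1, 0) + snd d *\<^sub>R (0, 1)) = fst d *\<^sub>R L (1, 0) + snd d *\<^sub>R L (0, 1)"
    by (simp only: linear_add[OF assms] linear_cmul[OF assms])
  moreover have "fst d *\<^sub>R (1, 0) + snd d *\<^sub>R (0, 1) = d" by (simp add: prod_eq_iff)
  ultimately show ?thesis by simp
qed

text \<open>Adapter to the inverse function theorem: the nonzero determinant supplies the inverse of
  the derivative by Cramer's rule, and \<open>C_k_on_local_inverse_plane\<close> adds the regularity
  of \<open>G\<close>.\<close>

lemma inverse_function_plane:
  fixes F :: "real \<times> real \<Rightarrow> real \<times> real"
  assumes S: "open S" and F: "C_k_on (Suc k) S F" and r0: "r0 \<in> S"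
    and det: "fst (frechet_derivative F (at r0) (1, 0)) * snd (frechet_derivative F (at r0) (0, 1)) -
      fst (frechet_derivative F (at r0) (0, 1)) * snd (frechet_derivative F (at r0) (1, 0)) \<noteq> 0"
  obtains V W G where "open V" "V \<subseteq> S" "r0 \<in> V" "open W" "homeomorphism V W F G" "C_k_on (Suc k) W G"
proof -
  define F' where "F' r = Blinfun (frechet_derivative F (at r))" for r
  have app: "blinfun_apply (F' r) = frechet_derivative F (at r)" if "r \<in> S" for r
    unfolding F'_def
    by (rule bounded_linear_Blinfun_apply[OF has_derivative_bounded_linear[OF C_k_on_Suc_has_derivative[OF F S that]]])
  have der: "(F has_derivative blinfun_apply (F' r)) (at r)" if "r \<in> S" for r
    unfolding app[OF that] by (rule C_k_on_Suc_has_derivative[OF F S that])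
  have cont: "continuous_on S F'"
  proof (rule continuous_on_blinfun_componentwise)
    fix i :: "real \<times> real"
    have "continuous_on S (\<lambda>r. frechet_derivative F (at r) i)"
      by (rule C_k_on_continuous[OF C_k_on_Suc_derivative[OF F]])
    then show "continuous_on S (\<lambda>r. blinfun_apply (F' r) i)"
      by (rule continuous_on_eq) (simp add: app)
  qed
  define a b c d where "a = fst (frechet_derivative F (at r0) (1, 0))" "b = fst (frechet_derivative F (at r0) (0, 1))"
    "c = snd (frechet_derivative F (at r0) (1, 0))" "d = snd (frechet_derivative F (at r0) (0, 1))"
  note abcd = this
  define e where "e = a * d - b * c"
  have e: "e \<noteq> 0" using det by (simp add: e_def abcd)
  let ?I = "\<lambda>v::real \<times> real. ((d / e) * fst v - (b / e) * snd v, (a / e) * snd v - (c / e) * fst v)"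
  have blI: "bounded_linear ?I"
    by (intro bounded_linear_Pair bounded_linear_sub bounded_linear_const_mult bounded_linear_fst bounded_linear_snd)
  have ex: "frechet_derivative F (at r0) h = (fst h * a + snd h * b, fst h * c + snd h * d)" for h
    using plane_linear_expansion[OF has_derivative_linear[OF C_k_on_Suc_has_derivative[OF F S r0]], of h]
    by (simp add: prod_eq_iff abcd)
  have "Blinfun ?I o\<^sub>L F' r0 = id_blinfun"
  proof (rule blinfun_eqI)
    fix h
    have "?I (fst h * a + snd h * b, fst h * c + snd h * d) =
        ((fst h * (a * d - b * c)) / e, (snd h * (a * d - b * c)) / e)"
      by (simp add: diff_divide_distrib[symmetric] add_divide_distrib[symmetric]) (simp add: algebra_simps)
    then have "?I (fst h * a + snd h * b, fst h * c + snd h * d) = h"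
      using e by (simp add: e_def[symmetric])
    then show "blinfun_apply (Blinfun ?I o\<^sub>L F' r0) h = blinfun_apply id_blinfun h"
      by (simp only: blinfun_apply_blinfun_compose bounded_linear_Blinfun_apply[OF blI] app[OF r0] ex
          blinfun_apply_id_blinfun)
  qed
  from inverse_function_theorem[OF S der cont r0 this]
  obtain V W G G' where V: "open V" "V \<subseteq> S" "r0 \<in> V" "open W" and hom: "homeomorphism V W F G"
    and dG: "\<And>y. y \<in> W \<Longrightarrow> (G has_derivative G' y) (at y)"
      "\<And>y. y \<in> W \<Longrightarrow> G' y = inv (blinfun_apply (F' (G y)))"
      "\<And>y. y \<in> W \<Longrightarrow> bij (blinfun_apply (F' (G y)))"
    by metis
  have GV: "G y \<in> V" if "y \<in> W" for y using hom that by (auto simp: homeomorphism_def)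
  have "C_k_on (Suc k) W G"
  proof (rule C_k_on_local_inverse_plane[OF V(1) C_k_on_subset[OF F V(2)] V(4) GV dG(1)])
    fix y v assume y: "y \<in> W"
    have "G y \<in> S" using GV[OF y] V(2) by blast
    then show "frechet_derivative F (at (G y)) (G' y v) = v"
      using dG(2,3)[OF y] by (simp add: app bij_is_surj surj_f_inv_f)
  next
    fix p assume "p \<in> V"
    then show "bounded_linear (frechet_derivative F (at p))"
      using V(2) by (intro has_derivative_bounded_linear[OF C_k_on_Suc_has_derivative[OF F S]]) blast
  qed
  then show thesis using that V hom by blast
qed

text \<open>\<open>L (1, 0, p)\<close> and \<open>L (0, 1, q)\<close> are the images of two tangent
  vectors of the graph of \<open>u\<close>. If their projections to the plane are independent, the
  map \<open>F\<close> from the plane to the graph, through \<phi> and down by \<open>base\<close>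
  is a local diffeomorphism. With its inverse \<open>G\<close>, the height of the image over
  \<open>y\<close> is a function \<open>v\<close> of \<open>y\<close>.\<close>

lemma local_graph_image:
  assumes B: "open B" and \<phi>: "smooth_on B \<phi>" and u: "smooth_on UNIV u"
    and r0: "(fst r0, snd r0, u r0) \<in> B" and du: "(u has_derivative (\<lambda>d. p * fst d + q * snd d)) (at r0)"
    and L: "L = frechet_derivative \<phi> (at (fst r0, snd r0, u r0))"
    and det: "fst (L (1, 0, p)) * fst (snd (L (0, 1, q))) - fst (L (0, 1, q)) * fst (snd (L (1, 0, p))) \<noteq> 0"
  obtains V W v where "open V" "open W" "r0 \<in> V" "C_k_on 2 W v" "graph_over V u \<subseteq> B"
    "\<phi> ` graph_over V u = graph_over W v"
    "\<And>r. r \<in> V \<Longrightarrow> base (\<phi> (fst r, snd r, u r)) \<in> W \<and>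
      v (base (\<phi> (fst r, snd r, u r))) = snd (snd (\<phi> (fst r, snd r, u r)))"
proof -
  let ?g = "\<lambda>r. (fst r, snd r, u r)"
  have sg: "smooth_on UNIV ?g" by (intro smooth_on_intros u) auto
  define S where "S = ?g -` B"
  have S: "open S" unfolding S_def
    by (rule open_vimage[OF B]) (rule smooth_on_continuous[OF sg])
  have sgS: "smooth_on S ?g" by (rule smooth_on_subset[OF sg]) simp
  have s\<phi>: "smooth_on S (\<lambda>r. \<phi> (?g r))"
    by (rule smooth_on_compose[OF S B \<phi> sgS]) (auto simp: S_def)
  define F where "F r = base (\<phi> (?g r))" for r
  have CF: "C_k_on k S F" for k
    unfolding F_def[abs_def]
    by (rule C_k_on_bounded_linear_compose[OF S bounded_linear_base]) (use s\<phi> in \<open>simp add: smooth_on_def\<close>)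
  have r0S: "r0 \<in> S" using r0 by (simp add: S_def)
  have "(?g has_derivative (\<lambda>d. (fst d, snd d, p * fst d + q * snd d))) (at r0)"
    by (intro has_derivative_Pair du) (auto intro!: derivative_eq_intros)
  from has_derivative_compose[OF this smooth_on_has_derivative[OF \<phi> B r0]]
  have "(F has_derivative (\<lambda>d. base (L (fst d, snd d, p * fst d + q * snd d)))) (at r0)"
    unfolding F_def[abs_def] L by (rule bounded_linear.has_derivative[OF bounded_linear_base])
  then have dF: "frechet_derivative F (at r0) = (\<lambda>d. base (L (fst d, snd d, p * fst d + q * snd d)))"
    by (rule frechet_derivative_at[symmetric])
  have "fst (frechet_derivative F (at r0) (1, 0)) * snd (frechet_derivative F (at r0) (0, 1)) -
      fst (frechet_derivative F (at r0) (0, 1)) * snd (frechet_derivative F (at r0) (1, 0)) \<noteq> 0"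
    using det unfolding dF by (simp add: base_def)
  from inverse_function_plane[OF S CF r0S this, of 1]
  obtain V W G where V: "open V" "V \<subseteq> S" "r0 \<in> V" "open W" and hom: "homeomorphism V W F G"
    and CG: "C_k_on (Suc 1) W G" by blast
  have FG: "F r \<in> W" "G (F r) = r" if "r \<in> V" for r using hom that by (auto simp: homeomorphism_def)
  have GF: "G y \<in> V" "F (G y) = y" if "y \<in> W" for y using hom that by (auto simp: homeomorphism_def)
  define v where "v y = snd (snd (\<phi> (?g (G y))))" for y
  have "C_k_on (Suc 1) W (\<lambda>y. \<phi> (?g (G y)))"
    by (rule C_k_on_compose[OF V(4) S CG, of "\<lambda>r. \<phi> (?g r)"])
      (use s\<phi> GF V(2) in \<open>auto simp: smooth_on_def simp del: C_k_on.simps\<close>)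
  then have "C_k_on (Suc 1) W v"
    unfolding v_def[abs_def] by (rule C_k_on_bounded_linear_compose[OF V(4) bounded_linear_height])
  then have Cv: "C_k_on 2 W v" by (simp only: numeral_2_eq_2 One_nat_def)
  have eq: "\<phi> (?g r) = (fst (F r), snd (F r), v (F r))" if "r \<in> V" for r
    using FG(2)[OF that] by (simp add: v_def F_def base_def)
  have "\<phi> ` graph_over V u = graph_over W v"
  proof
    show "\<phi> ` graph_over V u \<subseteq> graph_over W v"
    proof
      fix w assume "w \<in> \<phi> ` graph_over V u"
      then obtain r where r: "r \<in> V" "w = \<phi> (?g r)" by (auto simp: graph_over_def)
      then show "w \<in> graph_over W v" using eq[OF r(1)] FG(1)[OF r(1)]
        by (auto simp: graph_over_def intro!: exI[of _ "fst (F r)"] exI[of _ "snd (F r)"])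
    qed
    show "graph_over W v \<subseteq> \<phi> ` graph_over V u"
    proof
      fix w assume "w \<in> graph_over W v"
      then obtain y where y: "y \<in> W" "w = (fst y, snd y, v y)" by (auto simp: graph_over_def)
      have "w = \<phi> (?g (G y))" using eq[OF GF(1)[OF y(1)]] GF(2)[OF y(1)] y(2) by simp
      moreover have "?g (G y) \<in> graph_over V u"
        using GF(1)[OF y(1)] by (auto simp: graph_over_def intro!: exI[of _ "fst (G y)"] exI[of _ "snd (G y)"])
      ultimately show "w \<in> \<phi> ` graph_over V u" by blast
    qed
  qed
  moreover have "graph_over V u \<subseteq> B"
    using V(2) by (auto simp: graph_over_def S_def)
  moreover have "base (\<phi> (?g r)) \<in> W \<and> v (base (\<phi> (?g r))) = snd (snd (\<phi> (?g r)))" if "r \<in> V" for r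
    using FG[OF that] by (simp add: F_def[symmetric] v_def)
  ultimately show thesis using that V(1,3,4) Cv by blast
qed


text \<open>A quadratic polynomial realises every 2-jet. The mixed coefficient \<open>b\<close> is
  not seen by the equation for \<open>u\<close>, but it enters the second derivatives of the
  transform, and this freedom yields one of the symbol relations.\<close>

lemma quadratic_jet:
  fixes t0 x0 u0 p q a b c :: real
  defines "u \<equiv> \<lambda>r::real \<times> real. u0 + p * (fst r + - t0) + q * (snd r + - x0) + a / 2 * ((fst r + - t0) * (fst r + - t0))
    + b * ((fst r + - t0) * (snd r + - x0)) + c / 2 * ((snd r + - x0) * (snd r + - x0))"
  shows "smooth_on UNIV u" "(u has_derivative (\<lambda>d. p * fst d + q * snd d)) (at (t0, x0))"
    "D_t u (t0, x0) = p" "D_x u (t0, x0) = q" "D_t (D_t u) (t0, x0) = a" "D_x (D_x u) (t0, x0) = c"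
proof -
  show "smooth_on UNIV u"
    unfolding u_def
    by (intro smooth_on_add smooth_on_mult smooth_on_const smooth_on_fst smooth_on_snd smooth_on_ident open_UNIV)
  have "(u has_derivative (\<lambda>d. p * fst d + q * snd d +
      a / 2 * ((fst (t0, x0) + - t0) * fst d + fst d * (fst (t0, x0) + - t0)) +
      b * ((fst (t0, x0) + - t0) * snd d + fst d * (snd (t0, x0) + - x0)) +
      c / 2 * ((snd (t0, x0) + - x0) * snd d + snd d * (snd (t0, x0) + - x0)))) (at (t0, x0))"
    unfolding u_def by (rule derivative_eq_intros refl)+ auto
  then show "(u has_derivative (\<lambda>d. p * fst d + q * snd d)) (at (t0, x0))" by simp
  have 1: "D_t u = (\<lambda>r. p + a * (fst r - t0) + b * (snd r - x0))"
  proof (rule ext, clarify)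
    fix s y
    have "DERIV (\<lambda>s. u (s, y)) s :> p + a * (s - t0) + b * (y - x0)"
      unfolding u_def fst_conv snd_conv by (rule derivative_eq_intros refl)+ (simp add: field_simps)
    then show "D_t u (s, y) = p + a * (fst (s, y) - t0) + b * (snd (s, y) - x0)"
      by (simp add: D_t_def DERIV_imp_deriv)
  qed
  have 2: "D_x u = (\<lambda>r. q + b * (fst r - t0) + c * (snd r - x0))"
  proof (rule ext, clarify)
    fix s y
    have "DERIV (\<lambda>y. u (s, y)) y :> q + b * (s - t0) + c * (y - x0)"
      unfolding u_def fst_conv snd_conv by (rule derivative_eq_intros refl)+ (simp add: field_simps)
    then show "D_x u (s, y) = q + b * (fst (s, y) - t0) + c * (snd (s, y) - x0)"
      by (simp add: D_x_def DERIV_imp_deriv)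
  qed
  show "D_t u (t0, x0) = p" "D_x u (t0, x0) = q" by (simp_all add: 1 2)
  show "D_t (D_t u) (t0, x0) = a"
    unfolding 1 unfolding D_t_def by (auto intro!: DERIV_imp_deriv derivative_eq_intros)
  show "D_x (D_x u) (t0, x0) = c"
    unfolding 2 unfolding D_x_def by (auto intro!: DERIV_imp_deriv derivative_eq_intros)
qed

lemma second_derivatives_eq:
  assumes W: "open W" and v: "C_k_on 2 W v" and y: "y \<in> W"
  shows "D_x v y = frechet_derivative v (at y) (0, 1)"
    "D_t (D_t v) y = second_derivative v y (1, 0)" "D_x (D_x v) y = second_derivative v y (0, 1)"
proof -
  have v2: "C_k_on (Suc (Suc 0)) W v" using v by (simp only: numeral_2_eq_2)
  note d = C_k_on_Suc_has_derivative[OF v2 W]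
  have t: "D_t v y = frechet_derivative v (at y) (1, 0)" if "y \<in> W" for y by (rule D_t_eq[OF d[OF that]])
  have x: "D_x v y = frechet_derivative v (at y) (0, 1)" if "y \<in> W" for y by (rule D_x_eq[OF d[OF that]])
  show "D_x v y = frechet_derivative v (at y) (0, 1)" by (rule x[OF y])
  have dd: "((\<lambda>q. frechet_derivative v (at q) w) has_derivative
      frechet_derivative (\<lambda>q. frechet_derivative v (at q) w) (at y)) (at y)" for w
    by (rule C_k_on_Suc_has_derivative[OF C_k_on_Suc_derivative[OF v2] W y])
  have "(D_t v has_derivative frechet_derivative (\<lambda>q. frechet_derivative v (at q) (1, 0)) (at y)) (at y)"
    by (rule has_derivative_transform_within_open[OF dd W y]) (rule t[symmetric])
  from D_t_eq[OF this] show "D_t (D_t v) y = second_derivative v y (1, 0)"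
    unfolding second_derivative_def .
  have "(D_x v has_derivative frechet_derivative (\<lambda>q. frechet_derivative v (at q) (0, 1)) (at y)) (at y)"
    by (rule has_derivative_transform_within_open[OF dd W y]) (rule x[symmetric])
  from D_x_eq[OF this] show "D_x (D_x v) y = second_derivative v y (0, 1)"
    unfolding second_derivative_def .
qed

text \<open>On the graph, \<open>v\<close> of the projection of \<phi> equals the height of \<phi>.
  This identity is restricted to the line through (t0, x0) with direction (d1, d2) and
  differentiated twice; \<open>Q\<close> is the second derivative of \<open>u\<close> along the
  line.\<close>

lemma graph_second_derivative:
  fixes d1 d2 t0 x0 u0 p q Q :: real
  assumes B: "open B" and \<phi>: "smooth_on B \<phi>" and W: "open W" and v: "C_k_on 2 W v" and V: "open V"
    and r0: "(t0, x0) \<in> V" and gr: "graph_over V u \<subseteq> B"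
    and vu: "\<And>r. r \<in> V \<Longrightarrow> base (\<phi> (fst r, snd r, u r)) \<in> W \<and>
      v (base (\<phi> (fst r, snd r, u r))) = snd (snd (\<phi> (fst r, snd r, u r)))"
    and u: "\<And>s. u (t0 + s * d1, x0 + s * d2) = u0 + s * (p * d1 + q * d2) + s\<^sup>2 / 2 * Q"
  defines "z \<equiv> (t0, x0, u0)" and "e \<equiv> (d1, d2, p * d1 + q * d2)"
  defines "L \<equiv> frechet_derivative \<phi> (at z)" and "N \<equiv> frechet_derivative v (at (base (\<phi> z)))"
  shows "N (base (L e)) = snd (snd (L e))"
    "second_derivative v (base (\<phi> z)) (base (L e)) + N (base (second_derivative \<phi> z e)) + Q * N (base (L (0, 0, 1)))
      = snd (snd (second_derivative \<phi> z e)) + Q * snd (snd (L (0, 0, 1)))"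
proof -
  let ?h = "\<lambda>p::point. snd (snd p)"
  \<comment> \<open>The line lifted to the graph of \<open>u\<close>. Its acceleration is
    \<open>(0, 0, Q)\<close>, which is the origin of the terms with
    \<open>L (0, 0, 1)\<close>.\<close>
  define \<Gamma> where "\<Gamma> s = (t0 + s * d1, x0 + s * d2, u0 + s * (p * d1 + q * d2) + s\<^sup>2 / 2 * Q)" for s
  define \<Gamma>' where "\<Gamma>' s = (d1, d2, p * d1 + q * d2 + s * Q)" for s
  define M where "M = (\<lambda>s. (t0 + s * d1, x0 + s * d2)) -` V"
  have M: "open M" unfolding M_def by (rule open_vimage[OF V]) (intro continuous_intros)
  have 0: "0 \<in> M" using r0 by (simp add: M_def)
  have \<Gamma>u: "\<Gamma> s = (fst (t0 + s * d1, x0 + s * d2), snd (t0 + s * d1, x0 + s * d2), u (t0 + s * d1, x0 + s * d2))" for s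
    by (simp add: \<Gamma>_def u)
  have \<Gamma>B: "\<Gamma> s \<in> B" if "s \<in> M" for s
  proof -
    have "(t0 + s * d1, x0 + s * d2) \<in> V" using that by (simp add: M_def)
    then have "\<Gamma> s \<in> graph_over V u" unfolding \<Gamma>u graph_over_def by auto
    then show ?thesis using gr by blast
  qed
  have \<Gamma>0: "\<Gamma> 0 = z" "\<Gamma>' 0 = e" by (simp_all add: \<Gamma>_def \<Gamma>'_def z_def e_def)
  have d\<Gamma>: "(\<Gamma> has_vector_derivative \<Gamma>' s) (at s)" for s
    unfolding \<Gamma>_def[abs_def] \<Gamma>'_def
    by (intro has_vector_derivative_Pair)
      (auto simp: has_real_derivative_iff_has_vector_derivative[symmetric] intro!: derivative_eq_intros)
  have d\<Gamma>': "(\<Gamma>' has_vector_derivative (0, 0, Q)) (at s)" for s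
    unfolding \<Gamma>'_def[abs_def]
    by (intro has_vector_derivative_Pair)
      (auto simp: has_real_derivative_iff_has_vector_derivative[symmetric] intro!: derivative_eq_intros)
  have \<phi>2: "C_k_on (Suc (Suc 0)) B \<phi>" using \<phi> unfolding smooth_on_def by blast
  have v2: "C_k_on (Suc (Suc 0)) W v" using v by (simp only: numeral_2_eq_2)
  define c where "c s = \<phi> (\<Gamma> s)" for s
  define c' where "c' s = frechet_derivative \<phi> (at (\<Gamma> s)) (\<Gamma>' s)" for s
  have dc: "(c has_vector_derivative c' s) (at s)" if "s \<in> M" for s
    unfolding c_def[abs_def] c'_def
    by (rule has_vector_derivative_chain[OF smooth_on_has_derivative[OF \<phi> B \<Gamma>B[OF that]] d\<Gamma>])
  define C where "C = second_derivative \<phi> z e"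
  have linL: "linear L"
    unfolding L_def z_def[symmetric] \<Gamma>0(1)[symmetric]
    by (rule has_derivative_linear[OF smooth_on_has_derivative[OF \<phi> B \<Gamma>B[OF 0]]])
  have "L (Q *\<^sub>R (0, 0, 1)) = Q *\<^sub>R L (0, 0, 1)" by (rule linear_cmul[OF linL])
  then have LQ: "L (0, 0, Q) = Q *\<^sub>R L (0, 0, 1)" by simp
  have dc': "(c' has_vector_derivative (C + Q *\<^sub>R L (0, 0, 1))) (at 0)"
    using second_derivative_along_curve[OF B \<phi>2 0 d\<Gamma> \<Gamma>B d\<Gamma>' M]
    unfolding c'_def[abs_def] C_def \<Gamma>0 L_def[symmetric] LQ .
  have bc: "((\<lambda>s. base (c s)) has_vector_derivative base (c' s)) (at s)" if "s \<in> M" for s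
    by (rule bounded_linear.has_vector_derivative[OF bounded_linear_base dc[OF that]])
  have hc: "((\<lambda>s. ?h (c s)) has_vector_derivative ?h (c' s)) (at s)" if "s \<in> M" for s
    by (rule bounded_linear.has_vector_derivative[OF bounded_linear_height dc[OF that]])
  have bc': "((\<lambda>s. base (c' s)) has_vector_derivative base (C + Q *\<^sub>R L (0, 0, 1))) (at 0)"
    by (rule bounded_linear.has_vector_derivative[OF bounded_linear_base dc'])
  have hc': "((\<lambda>s. ?h (c' s)) has_vector_derivative ?h (C + Q *\<^sub>R L (0, 0, 1))) (at 0)"
    by (rule bounded_linear.has_vector_derivative[OF bounded_linear_height dc'])
  have cW: "base (c s) \<in> W" "v (base (c s)) = ?h (c s)" if "s \<in> M" for s
    using vu[of "(t0 + s * d1, x0 + s * d2)"] that unfolding M_def c_def \<Gamma>u by auto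
  have first: "frechet_derivative v (at (base (c s))) (base (c' s)) = ?h (c' s)" if s: "s \<in> M" for s
    by (rule vector_derivative_unique_on[OF
          has_vector_derivative_chain[OF C_k_on_Suc_has_derivative[OF v2 W cW(1)[OF s]] bc[OF s]] hc[OF s] M s cW(2)])
  have c0: "base (c 0) = base (\<phi> z)" "c' 0 = L e"
    by (simp_all add: c_def c'_def \<Gamma>0 L_def)
  show "N (base (L e)) = snd (snd (L e))"
    using first[OF 0] unfolding c0 N_def .
  have second: "second_derivative v (base (\<phi> z)) (base (L e)) + N (base (C + Q *\<^sub>R L (0, 0, 1))) = ?h (C + Q *\<^sub>R L (0, 0, 1))"
    using vector_derivative_unique_on[OF second_derivative_along_curve[OF W v2 0 bc cW(1) bc' M] hc' M 0 first]
    unfolding c0 N_def .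
  have linN: "linear N"
    unfolding N_def c0(1)[symmetric]
    by (rule has_derivative_linear[OF C_k_on_Suc_has_derivative[OF v2 W cW(1)[OF 0]]])
  have lb: "linear base" by (rule bounded_linear.linear[OF bounded_linear_base])
  have "N (base (C + Q *\<^sub>R L (0, 0, 1))) = N (base C) + Q * N (base (L (0, 0, 1)))"
    by (simp only: linear_add[OF lb] linear_cmul[OF lb] linear_add[OF linN] linear_cmul[OF linN] real_scaleR_def)
  then show "second_derivative v (base (\<phi> z)) (base (L e)) + N (base (second_derivative \<phi> z e)) + Q * N (base (L (0, 0, 1)))
      = snd (snd (second_derivative \<phi> z e)) + Q * snd (snd (L (0, 0, 1)))"
    using second unfolding C_def by simp
qed


text \<open>\<open>v\<close> is the transform of a function \<open>u\<close> with the prescribed values \<open>u0\<close>, \<open>p\<close>, \<open>q\<close>, \<open>a\<close>, \<open>c\<close>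
  of \<open>u\<close>, \<open>u\<^sub>t\<close>, \<open>u\<^sub>x\<close>, \<open>u\<^sub>t\<^sub>t\<close>, \<open>u\<^sub>x\<^sub>x\<close> at \<open>(t0, x0)\<close>.\<close>

definition jet_pair :: "point set \<Rightarrow> (point \<Rightarrow> point) \<Rightarrow> real \<Rightarrow> real \<Rightarrow> real \<Rightarrow> real \<Rightarrow> real \<Rightarrow> real \<Rightarrow> real \<Rightarrow>
    (real \<times> real) set \<Rightarrow> (real \<times> real) set \<Rightarrow> (real \<times> real \<Rightarrow> real) \<Rightarrow> (real \<times> real \<Rightarrow> real) \<Rightarrow> bool" where
  "jet_pair B \<phi> t0 x0 u0 p q a c V W u v \<longleftrightarrow>
      open V \<and> open W \<and> C_k_on 2 V u \<and> C_k_on 2 W v \<and>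
      graph_over V u \<subseteq> B \<and> \<phi> ` graph_over V u = graph_over W v \<and> (t0, x0) \<in> V \<and> u (t0, x0) = u0 \<and>
      D_t u (t0, x0) = p \<and> D_x u (t0, x0) = q \<and> D_t (D_t u) (t0, x0) = a \<and> D_x (D_x u) (t0, x0) = c \<and>
      base (\<phi> (t0, x0, u0)) \<in> W \<and> v (base (\<phi> (t0, x0, u0))) = snd (snd (\<phi> (t0, x0, u0)))"

text \<open>The second derivatives of \<open>v\<close> are read off along the two directions whose
  images project to (1, 0) and (0, 1). Everything but the second derivative of \<open>u\<close>
  along them is fixed by the first-order jet, which is why \<open>lam\<close>, \<open>v2\<close>,
  \<open>A1\<close> and \<open>A2\<close> come before \<open>a\<close>, \<open>b\<close>,
  \<open>c\<close>.\<close>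

lemma jet_transform:
  fixes p q t0 x0 u0 :: real
  assumes B: "open B" and \<phi>: "smooth_on B \<phi>" and z: "(t0, x0, u0) \<in> B"
    and L: "L = frechet_derivative \<phi> (at (t0, x0, u0))" and bij: "bij L"
    and T: "Tt = fst (L (1, 0, p))" "Tx = fst (L (0, 1, q))"
    and X: "Xt = fst (snd (L (1, 0, p)))" "Xx = fst (snd (L (0, 1, q)))"
    and det: "Tt * Xx - Tx * Xt \<noteq> 0"
  shows "\<exists>lam v2 A1 A2. lam \<noteq> 0 \<and> (\<forall>a b c. \<exists>V W u v.
      jet_pair B \<phi> t0 x0 u0 p q a c V W u v \<and>
      D_x v (base (\<phi> (t0, x0, u0))) = v2 \<and>
      D_t (D_t v) (base (\<phi> (t0, x0, u0))) = A1 + lam * (a * Xx\<^sup>2 - 2 * b * Xx * Xt + c * Xt\<^sup>2) \<and>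
      D_x (D_x v) (base (\<phi> (t0, x0, u0))) = A2 + lam * (a * Tx\<^sup>2 - 2 * b * Tx * Tt + c * Tt\<^sup>2))"
proof -
  let ?z = "(t0, x0, u0)" and ?h = "\<lambda>p::point. snd (snd p)"
  define D where "D = Tt * Xx - Tx * Xt"
  have D: "D \<noteq> 0" using det by (simp add: D_def)
  have lin: "linear L" unfolding L by (rule has_derivative_linear[OF smooth_on_has_derivative[OF \<phi> B z]])
  have Le: "L (d1, d2, p * d1 + q * d2) = d1 *\<^sub>R L (1, 0, p) + d2 *\<^sub>R L (0, 1, q)" for d1 d2
  proof -
    have "L (d1 *\<^sub>R (1, 0, p) + d2 *\<^sub>R (0, 1, q)) = d1 *\<^sub>R L (1, 0, p) + d2 *\<^sub>R L (0, 1, q)"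
      by (simp only: linear_add[OF lin] linear_cmul[OF lin])
    then show ?thesis by (simp add: mult.commute)
  qed
  have J: "base (L (d1, d2, p * d1 + q * d2)) = (d1 * Tt + d2 * Tx, d1 * Xt + d2 * Xx)" for d1 d2
    unfolding Le base_def T X by simp
  \<comment> \<open>The columns of the inverse of the matrix with rows (Tt, Tx) and (Xt, Xx), lifted
    to tangent vectors of the graph.\<close>
  define e1 where "e1 = (Xx / D, - Xt / D, p * (Xx / D) + q * (- Xt / D))"
  define e2 where "e2 = (- Tx / D, Tt / D, p * (- Tx / D) + q * (Tt / D))"
  have J1: "base (L e1) = (1, 0)" and J2: "base (L e2) = (0, 1)"
    unfolding e1_def e2_def J using D by (auto simp: field_simps) (auto simp: D_def algebra_simps)
  define n1 n2 where "n1 = ?h (L e1)" "n2 = ?h (L e2)"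
  note n = this
  define N where "N y = n1 * fst y + n2 * snd y" for y
  define k where "k = L (0, 0, 1)"
  \<comment> \<open>The part of the image of the u-axis that is transversal to the tangent plane of
    the image graph, measured along the new u-axis. If it vanished, the whole image of the bijection
    \<open>L\<close> would lie in that plane.\<close>
  define \<kappa> where "\<kappa> = ?h k - N (base k)"
  define C1 C2 where "C1 = second_derivative \<phi> ?z e1" "C2 = second_derivative \<phi> ?z e2"
  note C = this
  have \<kappa>: "\<kappa> \<noteq> 0"
  proof
    assume 0: "\<kappa> = 0"
    have tangent: "?h (L (d1, d2, p * d1 + q * d2)) = N (base (L (d1, d2, p * d1 + q * d2)))" for d1 d2
    proof -
      have "L e1 = (Xx / D) *\<^sub>R L (1, 0, p) + (- Xt / D) *\<^sub>R L (0, 1, q)"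
        "L e2 = (- Tx / D) *\<^sub>R L (1, 0, p) + (Tt / D) *\<^sub>R L (0, 1, q)"
        unfolding e1_def e2_def by (rule Le)+
      then have n': "n1 = (Xx * ?h (L (1, 0, p)) - Xt * ?h (L (0, 1, q))) / D"
        "n2 = (Tt * ?h (L (0, 1, q)) - Tx * ?h (L (1, 0, p))) / D"
        unfolding n by (simp_all add: diff_divide_distrib)
      have nD: "n1 * D = Xx * ?h (L (1, 0, p)) - Xt * ?h (L (0, 1, q))"
        "n2 * D = Tt * ?h (L (0, 1, q)) - Tx * ?h (L (1, 0, p))" using n' D by simp_all
      have "N (base (L (d1, d2, p * d1 + q * d2))) * D =
          n1 * D * (d1 * Tt + d2 * Tx) + n2 * D * (d1 * Xt + d2 * Xx)"
        unfolding N_def J by (simp add: algebra_simps)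
      also have "\<dots> = (d1 * ?h (L (1, 0, p)) + d2 * ?h (L (0, 1, q))) * D"
        unfolding nD by (simp add: D_def algebra_simps)
      finally show ?thesis using D unfolding Le by simp
    qed
    obtain g where g: "L g = (0, 0, 1)" using bij by (metis bij_pointE)
    define r where "r = ?h g - (p * fst g + q * fst (snd g))"
    have "g = (fst g, fst (snd g), p * fst g + q * fst (snd g)) + r *\<^sub>R (0, 0, 1)"
      by (simp add: prod_eq_iff r_def)
    then have "L g = L (fst g, fst (snd g), p * fst g + q * fst (snd g)) + r *\<^sub>R k"
      unfolding k_def using linear_add[OF lin] linear_cmul[OF lin] by metis
    then have Lg: "(0, 0, 1) = L (fst g, fst (snd g), p * fst g + q * fst (snd g)) + r *\<^sub>R k"
      using g by simp
    define y where "y = L (fst g, fst (snd g), p * fst g + q * fst (snd g))"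
    have y: "?h y = N (base y)" unfolding y_def by (rule tangent)
    have "fst y + r * fst k = 0" "fst (snd y) + r * fst (snd k) = 0" "?h y + r * ?h k = 1"
      using Lg unfolding y_def[symmetric] by (auto simp: prod_eq_iff)
    moreover have "?h y + r * ?h k = n1 * (fst y + r * fst k) + n2 * (fst (snd y) + r * fst (snd k)) + r * \<kappa>"
      unfolding y \<kappa>_def N_def base_def by (simp add: algebra_simps)
    ultimately show False using 0 by simp
  qed
  show ?thesis
  proof (rule exI[of _ "\<kappa> / D\<^sup>2"], rule exI[of _ n2], rule exI[of _ "?h C1 - N (base C1)"],
      rule exI[of _ "?h C2 - N (base C2)"], intro conjI allI)
    show "\<kappa> / D\<^sup>2 \<noteq> 0" using \<kappa> D by simp
    fix a b c
    define u where "u = (\<lambda>r::real \<times> real. u0 + p * (fst r + - t0) + q * (snd r + - x0) + a / 2 * ((fst r + - t0) * (fst r + - t0))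
      + b * ((fst r + - t0) * (snd r + - x0)) + c / 2 * ((snd r + - x0) * (snd r + - x0)))"
    note uj = quadratic_jet[of u0 p t0 q x0 a b c, folded u_def]
    have u0: "u (t0, x0) = u0" by (simp add: u_def)
    have L': "L = frechet_derivative \<phi> (at (fst (t0, x0), snd (t0, x0), u (t0, x0)))"
      unfolding L u0 by simp
    have z': "(fst (t0, x0), snd (t0, x0), u (t0, x0)) \<in> B" using z u0 by simp
    have det': "fst (L (1, 0, p)) * fst (snd (L (0, 1, q))) - fst (L (0, 1, q)) * fst (snd (L (1, 0, p))) \<noteq> 0"
      using det unfolding T X .
    obtain V W v where V: "open V" "open W" "(t0, x0) \<in> V" and v: "C_k_on 2 W v" and gr: "graph_over V u \<subseteq> B"
      "\<phi> ` graph_over V u = graph_over W v" and vu: "\<And>r. r \<in> V \<Longrightarrow> base (\<phi> (fst r, snd r, u r)) \<in> W \<and>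
      v (base (\<phi> (fst r, snd r, u r))) = snd (snd (\<phi> (fst r, snd r, u r)))"
      by (rule local_graph_image[OF B \<phi> uj(1) z' uj(2) L' det']) blast
    have Cu: "C_k_on 2 V u" using uj(1) unfolding smooth_on_def by (meson C_k_on_subset subset_UNIV)
    have y0: "base (\<phi> ?z) \<in> W" "v (base (\<phi> ?z)) = ?h (\<phi> ?z)"
      using vu[OF V(3)] u0 by auto
    have line: "u (t0 + s * d1, x0 + s * d2) = u0 + s * (p * d1 + q * d2) +
        s\<^sup>2 / 2 * (a * d1\<^sup>2 + 2 * b * d1 * d2 + c * d2\<^sup>2)" for s d1 d2
      by (simp add: u_def power2_eq_square field_simps)
    note G = graph_second_derivative[OF B \<phi> V(2) v V(1,3) gr(1) vu line, folded L]
    note sd = second_derivatives_eq[OF V(2) v y0(1)]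
    let ?N = "frechet_derivative v (at (base (\<phi> ?z)))"
    have v2: "C_k_on (Suc (Suc 0)) W v" using v by (simp only: numeral_2_eq_2)
    have linN: "linear ?N" by (rule has_derivative_linear[OF C_k_on_Suc_has_derivative[OF v2 V(2) y0(1)]])
    have N1: "?N (1, 0) = n1" using G(1)[of "Xx / D" "- Xt / D"] unfolding e1_def[symmetric] J1 n(1) .
    have N2: "?N (0, 1) = n2" using G(1)[of "- Tx / D" "Tt / D"] unfolding e2_def[symmetric] J2 n(2) .
    have NN: "?N y = N y" for y
      unfolding plane_linear_expansion[OF linN, of y] N1 N2 N_def by simp
    have rearr: "d = h - n + Q * (h' - n')" if "d + n + Q * n' = h + Q * h'" for d n Q n' h h' :: real
      using that by (simp add: algebra_simps)
    have tt: "D_t (D_t v) (base (\<phi> ?z)) = ?h C1 - N (base C1) +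
        (a * (Xx / D)\<^sup>2 + 2 * b * (Xx / D) * (- Xt / D) + c * (- Xt / D)\<^sup>2) * \<kappa>"
      using G(2)[of "Xx / D" "- Xt / D"]
      unfolding e1_def[symmetric] J1 sd(2)[symmetric] NN C(1)[symmetric] k_def[symmetric] \<kappa>_def
      by (rule rearr)
    have xx: "D_x (D_x v) (base (\<phi> ?z)) = ?h C2 - N (base C2) +
        (a * (- Tx / D)\<^sup>2 + 2 * b * (- Tx / D) * (Tt / D) + c * (Tt / D)\<^sup>2) * \<kappa>"
      using G(2)[of "- Tx / D" "Tt / D"]
      unfolding e2_def[symmetric] J2 sd(3)[symmetric] NN C(2)[symmetric] k_def[symmetric] \<kappa>_def
      by (rule rearr)
    have tt': "D_t (D_t v) (base (\<phi> ?z)) = ?h C1 - N (base C1) + \<kappa> / D\<^sup>2 * (a * Xx\<^sup>2 - 2 * b * Xx * Xt + c * Xt\<^sup>2)"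
      unfolding tt using D by (simp add: field_simps power2_eq_square)
    have xx': "D_x (D_x v) (base (\<phi> ?z)) = ?h C2 - N (base C2) + \<kappa> / D\<^sup>2 * (a * Tx\<^sup>2 - 2 * b * Tx * Tt + c * Tt\<^sup>2)"
      unfolding xx using D by (simp add: field_simps power2_eq_square)
    have vx: "D_x v (base (\<phi> ?z)) = n2" unfolding sd(1) by (rule N2)
    show "\<exists>V W u v.
      jet_pair B \<phi> t0 x0 u0 p q a c V W u v \<and> D_x v (base (\<phi> ?z)) = n2 \<and>
      D_t (D_t v) (base (\<phi> ?z)) = ?h C1 - N (base C1) + \<kappa> / D\<^sup>2 * (a * Xx\<^sup>2 - 2 * b * Xx * Xt + c * Xt\<^sup>2) \<and>
      D_x (D_x v) (base (\<phi> ?z)) = ?h C2 - N (base C2) + \<kappa> / D\<^sup>2 * (a * Tx\<^sup>2 - 2 * b * Tx * Tt + c * Tt\<^sup>2)"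
      unfolding jet_pair_def
      by (rule exI[of _ V], rule exI[of _ W], rule exI[of _ u], rule exI[of _ v], intro conjI)
        (rule V Cu v gr u0 uj y0 vx tt' xx')+
  qed
qed

lemma jet_pair_exists:
  fixes p q t0 x0 u0 :: real
  assumes B: "open B" and \<phi>: "smooth_on B \<phi>" and z: "(t0, x0, u0) \<in> B"
    and L: "L = frechet_derivative \<phi> (at (t0, x0, u0))" and bij: "bij L"
    and det: "fst (L (1, 0, p)) * fst (snd (L (0, 1, q))) - fst (L (0, 1, q)) * fst (snd (L (1, 0, p))) \<noteq> 0"
  obtains V W u v where "jet_pair B \<phi> t0 x0 u0 p q a c V W u v"
  using jet_transform[OF B \<phi> z L bij refl refl refl refl det]
  by (elim exE conjE, drule_tac x = a in spec, drule_tac x = 0 in spec, drule_tac x = c in spec, elim exE conjE)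
    (rule that)

subsection \<open>The principal symbol\<close>

text \<open>An invertible derivative makes each coordinate of \<phi> a submersion. Openness allows
  the new elements to be differentiated at image points.\<close>

lemma open_ranges:
  assumes B: "open B" and pt: "point_transformation B \<phi>"
  shows "open (x_range B \<phi>)" "open (u_range B \<phi>)"
proof -
  have \<phi>: "smooth_on B \<phi>" and bij: "\<And>p. p \<in> B \<Longrightarrow> bij (frechet_derivative \<phi> (at p))"
    using pt by (auto simp: point_transformation_def)
  have *: "open ((\<lambda>p. l (\<phi> p)) ` B)" if l: "bounded_linear l" and e: "l e = (1::real)" for l e
  proof (rule open_image_submersion[OF B])
    fix p assume p: "p \<in> B"
    let ?L = "frechet_derivative \<phi> (at p)"
    note d = smooth_on_has_derivative[OF \<phi> B p]
    show "((\<lambda>p. l (\<phi> p)) has_derivative (\<lambda>h. l (?L h))) (at p)"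
      by (rule bounded_linear.has_derivative[OF l d])
    obtain w where w: "?L w = e" using bij[OF p] by (metis bij_pointE)
    have "l (?L (y *\<^sub>R w)) = y" for y
      by (simp add: linear_cmul[OF has_derivative_linear[OF d]] linear_cmul[OF bounded_linear.linear[OF l]] w e)
    then show "\<exists>g'. bounded_linear g' \<and> (\<lambda>h. l (?L h)) \<circ> g' = id"
      by (intro exI[of _ "\<lambda>y. y *\<^sub>R w"]) (auto simp: bounded_linear_scaleR_left)
  qed
  show "open (x_range B \<phi>)" unfolding x_range_def
    by (rule *[of "\<lambda>p. fst (snd p)" "(0, 1, 0)"])
      (auto intro: bounded_linear_compose[OF bounded_linear_fst bounded_linear_snd])
  show "open (u_range B \<phi>)" unfolding u_range_def
    by (rule *[OF bounded_linear_height, of "(0, 0, 1)"]) auto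
qed

text \<open>Changing \<open>b\<close> alone gives M = 0, and moving (a, c) by (G, f), along the
  solution set of the first equation, gives G P + f S = 0. So the form with entries (P, M, S) is
  \<mu> times (f, 0, - G), where \<mu> = P / f.\<close>

lemma same_zero_set_quadratic_forms:
  fixes f G f' G' R R' A1 A2 lam Xx Xt Tx Tt :: real
  assumes nz: "f \<noteq> 0" "lam \<noteq> 0" "f' \<noteq> 0" and det: "Tt * Xx - Tx * Xt \<noteq> 0"
    and eq: "\<And>a b c. f * a = R + G * c \<Longrightarrow>
      f' * (A1 + lam * (a * Xx\<^sup>2 - 2 * b * Xx * Xt + c * Xt\<^sup>2)) =
      R' + G' * (A2 + lam * (a * Tx\<^sup>2 - 2 * b * Tx * Tt + c * Tt\<^sup>2))"
  obtains \<mu> where "\<mu> \<noteq> 0" "f' * Xx\<^sup>2 - G' * Tx\<^sup>2 = \<mu> * f" "f' * Xt\<^sup>2 - G' * Tt\<^sup>2 = - \<mu> * G"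
    "f' * Xx * Xt = G' * Tx * Tt"
proof -
  define P M S k where "P = f' * Xx\<^sup>2 - G' * Tx\<^sup>2" "M = f' * Xx * Xt - G' * Tx * Tt"
    "S = f' * Xt\<^sup>2 - G' * Tt\<^sup>2" "k = f' * A1 - R' - G' * A2"
  note defs = this
  have E: "k + lam * (a * P - 2 * b * M + c * S) = 0" if "f * a = R + G * c" for a b c
    using eq[OF that, of b] unfolding defs by (simp add: algebra_simps)
  have 0: "f * (R / f) = R + G * 0" using nz by simp
  have "k + lam * (R / f * P) = 0" using E[OF 0, of 0] by simp
  moreover have "k + lam * (R / f * P) - lam * (2 * M) = 0" using E[OF 0, of 1] by (simp add: algebra_simps)
  ultimately have M: "M = 0" using nz by simp
  have 1: "f * (R / f + G) = R + G * f" using nz by (simp add: distrib_left)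
  have "k + lam * (R / f * P) + lam * (G * P + f * S) = 0" using E[OF 1, of 0] by (simp add: algebra_simps)
  with \<open>k + lam * (R / f * P) = 0\<close> have GP: "G * P + f * S = 0" using nz by simp
  \<comment> \<open>Otherwise the form would vanish, but its value at (Tt, - Tx) is f' times the
    square of the Jacobian determinant.\<close>
  have "P \<noteq> 0"
  proof
    assume P: "P = 0"
    then have "S = 0" using GP nz by simp
    have "f' * (Tt * Xx - Tx * Xt)\<^sup>2 = Tt\<^sup>2 * P - 2 * Tt * Tx * M + Tx\<^sup>2 * S"
      unfolding defs by (simp add: algebra_simps power2_eq_square)
    then show False using P M \<open>S = 0\<close> nz det by simp
  qed
  moreover have "P = P / f * f" "S = - (P / f) * G"
    using nz GP by (auto simp: field_simps)
  ultimately show thesis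
    using that[of "P / f"] M nz unfolding defs by simp
qed

text \<open>For fixed (p, q) all terms of order at most one are constants, collected in
  \<open>R\<close> and \<open>R'\<close>, so that only the principal parts are compared. The freedom
  in (p, q) is exploited in \<open>pointwise_form\<close>.\<close>

lemma symbol_relation:
  fixes t0 x0 u0 p q :: real and \<phi> :: "point \<Rightarrow> point"
  assumes I: "open It" "open Ix" "open Iu" and pt: "point_transformation (It \<times> Ix \<times> Iu) \<phi>"
    and \<theta>: "\<theta> \<in> arb_class Ix Iu"
    and \<theta>': "\<theta>' \<in> arb_class (x_range (It \<times> Ix \<times> Iu) \<phi>) (u_range (It \<times> Ix \<times> Iu) \<phi>)"
    and map: "maps_equation (It \<times> Ix \<times> Iu) \<phi> \<theta> \<theta>'"
    and z: "(t0, x0, u0) \<in> It \<times> Ix \<times> Iu" and L: "L = frechet_derivative \<phi> (at (t0, x0, u0))"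
    and T: "Tt = fst (L (1, 0, p))" "Tx = fst (L (0, 1, q))"
    and X: "Xt = fst (snd (L (1, 0, p)))" "Xx = fst (snd (L (0, 1, q)))"
    and det: "Tt * Xx - Tx * Xt \<noteq> 0"
    and f': "f' = el_f \<theta>' (fst (snd (\<phi> (t0, x0, u0))))"
    and G': "G' = el_g \<theta>' (fst (snd (\<phi> (t0, x0, u0)))) * el_H \<theta>' (snd (snd (\<phi> (t0, x0, u0))))"
  obtains \<mu> where "\<mu> \<noteq> 0" "f' * Xx\<^sup>2 - G' * Tx\<^sup>2 = \<mu> * el_f \<theta> x0"
    "f' * Xt\<^sup>2 - G' * Tt\<^sup>2 = - \<mu> * (el_g \<theta> x0 * el_H \<theta> u0)" "f' * Xx * Xt = G' * Tx * Tt"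
proof -
  let ?B = "It \<times> Ix \<times> Iu" and ?z = "(t0, x0, u0)"
  have B: "open ?B" using I by (simp add: open_Times)
  have \<phi>: "smooth_on ?B \<phi>" and bij: "bij L" using pt z L by (auto simp: point_transformation_def)
  have x0: "x0 \<in> Ix" and u0: "u0 \<in> Iu" using z by auto
  define Xz Uz where "Xz = fst (snd (\<phi> ?z))" "Uz = snd (snd (\<phi> ?z))"
  note Z = this
  have Xz: "Xz \<in> x_range ?B \<phi>" and Uz: "Uz \<in> u_range ?B \<phi>"
    unfolding Z x_range_def u_range_def by (rule imageI[OF z])+
  note ranges = open_ranges[OF B pt]
  obtain lam v2 A1 A2 where lam: "lam \<noteq> 0" and jets: "\<forall>a b c. \<exists>V W u v.
      jet_pair ?B \<phi> t0 x0 u0 p q a c V W u v \<and>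
      D_x v (base (\<phi> ?z)) = v2 \<and>
      D_t (D_t v) (base (\<phi> ?z)) = A1 + lam * (a * Xx\<^sup>2 - 2 * b * Xx * Xt + c * Xt\<^sup>2) \<and>
      D_x (D_x v) (base (\<phi> ?z)) = A2 + lam * (a * Tx\<^sup>2 - 2 * b * Tx * Tt + c * Tt\<^sup>2)"
    using jet_transform[OF B \<phi> z L bij T X det] by (elim exE conjE) (rule that)
  define R where "R = (deriv (el_g \<theta>) x0 * el_H \<theta> u0 + el_h \<theta> x0 * el_K \<theta> u0) * q
       + el_g \<theta> x0 * deriv (el_H \<theta>) u0 * q\<^sup>2"
  define R' where "R' = (deriv (el_g \<theta>') Xz * el_H \<theta>' Uz + el_h \<theta>' Xz * el_K \<theta>' Uz) * v2
       + el_g \<theta>' Xz * deriv (el_H \<theta>') Uz * v2\<^sup>2"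
  have key: "f' * (A1 + lam * (a * Xx\<^sup>2 - 2 * b * Xx * Xt + c * Xt\<^sup>2)) =
      R' + G' * (A2 + lam * (a * Tx\<^sup>2 - 2 * b * Tx * Tt + c * Tt\<^sup>2))"
    if ac: "el_f \<theta> x0 * a = R + el_g \<theta> x0 * el_H \<theta> u0 * c" for a b c
  proof -
    obtain V W u v where A: "jet_pair ?B \<phi> t0 x0 u0 p q a c V W u v \<and>
      D_x v (base (\<phi> ?z)) = v2 \<and>
      D_t (D_t v) (base (\<phi> ?z)) = A1 + lam * (a * Xx\<^sup>2 - 2 * b * Xx * Xt + c * Xt\<^sup>2) \<and>
      D_x (D_x v) (base (\<phi> ?z)) = A2 + lam * (a * Tx\<^sup>2 - 2 * b * Tx * Tt + c * Tt\<^sup>2)"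
      using jets[THEN spec[of _ a], THEN spec[of _ b], THEN spec[of _ c]] by (elim exE) (rule that)
    have V: "open V" "open W" and C: "C_k_on 2 V u" "C_k_on 2 W v" and
      gr: "graph_over V u \<subseteq> ?B" "\<phi> ` graph_over V u = graph_over W v" and r0: "(t0, x0) \<in> V" and u: "u (t0, x0) = u0"
      and uj: "D_x u (t0, x0) = q" "D_t (D_t u) (t0, x0) = a" "D_x (D_x u) (t0, x0) = c" and
      y0: "base (\<phi> ?z) \<in> W" and v: "v (base (\<phi> ?z)) = snd (snd (\<phi> ?z))" and
      vj: "D_x v (base (\<phi> ?z)) = v2"
      "D_t (D_t v) (base (\<phi> ?z)) = A1 + lam * (a * Xx\<^sup>2 - 2 * b * Xx * Xt + c * Xt\<^sup>2)"
      "D_x (D_x v) (base (\<phi> ?z)) = A2 + lam * (a * Tx\<^sup>2 - 2 * b * Tx * Tt + c * Tt\<^sup>2)"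
      using A unfolding jet_pair_def by - (elim conjE; assumption)+
    have y: "base (\<phi> ?z) = (fst (\<phi> ?z), Xz)" by (simp add: base_def Z)
    have vU: "v (fst (\<phi> ?z), Xz) = Uz" using v unfolding y Z .
    have e: "\<phi> (fst (t0, x0), snd (t0, x0), u (t0, x0)) =
        (fst (base (\<phi> ?z)), snd (base (\<phi> ?z)), v (base (\<phi> ?z)))"
      using u v by (simp add: base_def)
    have hyp: "open V \<and> open W \<and> C_k_on 2 V u \<and> C_k_on 2 W v \<and> graph_over V u \<subseteq> ?B \<and>
        \<phi> ` graph_over V u = graph_over W v" using V C gr by blast
    from map[unfolded maps_equation_def, rule_format, OF this r0 y0 e]
    have iff: "satisfies_at \<theta> u (t0, x0) \<longleftrightarrow> satisfies_at \<theta>' v (base (\<phi> ?z))" .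
    have H: "DERIV (el_H \<theta>) (u (t0, x0)) :> deriv (el_H \<theta>) (u (t0, x0))"
      unfolding u by (rule smooth_on_DERIV[OF arb_classD(4)[OF \<theta>] I(3) u0])
    have H': "DERIV (el_H \<theta>') (v (fst (\<phi> ?z), Xz)) :> deriv (el_H \<theta>') (v (fst (\<phi> ?z), Xz))"
      unfolding vU by (rule smooth_on_DERIV[OF arb_classD(4)[OF \<theta>'] ranges(2) Uz])
    have "jet_eq \<theta> x0 u0 q a c" using ac unfolding jet_eq_def R_def by simp
    then have "satisfies_at \<theta> u (t0, x0)"
      using satisfies_at_iff_jet_eq[OF V(1) C(1) r0 smooth_on_DERIV[OF arb_classD(2)[OF \<theta>] I(2) x0] H]
      unfolding u uj by blast
    then have "satisfies_at \<theta>' v (fst (\<phi> ?z), Xz)" using iff unfolding y by blast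
    then have "jet_eq \<theta>' Xz Uz v2 (A1 + lam * (a * Xx\<^sup>2 - 2 * b * Xx * Xt + c * Xt\<^sup>2))
        (A2 + lam * (a * Tx\<^sup>2 - 2 * b * Tx * Tt + c * Tt\<^sup>2))"
      using satisfies_at_iff_jet_eq[OF V(2) C(2) y0[unfolded y]
          smooth_on_DERIV[OF arb_classD(2)[OF \<theta>'] ranges(1) Xz] H']
      unfolding vU vj[unfolded y] by blast
    then show ?thesis unfolding jet_eq_def R'_def f' G' Z by simp
  qed
  have "f' \<noteq> 0" unfolding f' using arb_classD(6)[OF \<theta>' Xz] by (simp add: Z)
  from same_zero_set_quadratic_forms[OF arb_classD(6)[OF \<theta> x0] lam this det key]
  show thesis using that by blast
qed

text \<open>The determinant is affine in (p, q) and not identically zero. If (T_t + p T_u) (X_t + p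
  X_u) were nonzero for some \<open>p\<close>, it would be so for a second value, the determinant
  would vanish at both for all \<open>q\<close>, and hence everywhere. So this product and its
  counterpart in \<open>q\<close> vanish as polynomials, and their coefficients give the
  alternatives.\<close>

lemma characteristic_directions:
  fixes a b c d e k :: real \<comment> \<open>\<open>T\<^sub>t, T\<^sub>x, T\<^sub>u, X\<^sub>t, X\<^sub>x, X\<^sub>u\<close>\<close>
  assumes minors: "a * e - b * d \<noteq> 0 \<or> c * e - b * k \<noteq> 0 \<or> a * k - c * d \<noteq> 0"
    and zero: "\<And>p q. (a + p * c) * (e + q * k) - (b + q * c) * (d + p * k) \<noteq> 0 \<Longrightarrow>
      (a + p * c) * (d + p * k) = 0 \<and> (b + q * c) * (e + q * k) = 0"
  shows "c = 0" "k = 0" "b = 0 \<and> d = 0 \<and> a \<noteq> 0 \<and> e \<noteq> 0 \<or> a = 0 \<and> e = 0 \<and> b \<noteq> 0 \<and> d \<noteq> 0"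
proof -
  define D0 D1 D2 where "D0 = a * e - b * d" "D1 = c * e - b * k" "D2 = a * k - c * d"
  note D = this
  have det: "(a + p * c) * (e + q * k) - (b + q * c) * (d + p * k) = D0 + p * D1 + q * D2" for p q
    unfolding D by (simp add: algebra_simps)
  \<comment> \<open>Each linear factor is nonzero at \<open>p0\<close> and so has at most one zero;
    together they cannot cover p0 + 1, p0 + 2 and p0 + 3.\<close>
  have other: "\<exists>p1. p1 \<noteq> p0 \<and> (m + p1 * c) * (n + p1 * k) \<noteq> 0"
    if "(m + p0 * c) * (n + p0 * k) \<noteq> 0" for p0 m n
  proof (rule ccontr)
    assume A: "\<not> ?thesis"
    have B: "(m + p0 * c + j * c) * (n + p0 * k + j * k) = 0" if "j \<noteq> 0" for j
      using A that by (auto simp: algebra_simps dest!: spec[of _ "p0 + j"])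
    have "m + p0 * c \<noteq> 0" "n + p0 * k \<noteq> 0" using that by auto
    then show False using B[of 1] B[of 2] B[of 3] by auto
  qed
  have P: "(a + p * c) * (d + p * k) = 0" for p
  proof (rule ccontr)
    assume A: "(a + p * c) * (d + p * k) \<noteq> 0"
    obtain p1 where p1: "p1 \<noteq> p" "(a + p1 * c) * (d + p1 * k) \<noteq> 0" using other[OF A] by blast
    have "D0 + r * D1 + q * D2 = 0" if "(a + r * c) * (d + r * k) \<noteq> 0" for r q
      using zero[of r q] that unfolding det by blast
    from this[OF A, of 0] this[OF A, of 1] this[OF p1(2), of 0]
    have "D2 = 0" "D0 + p * D1 = 0" "D0 + p1 * D1 = 0" by auto
    then have "p * D1 - p1 * D1 = 0" by linarith
    then have "(p - p1) * D1 = 0" by (simp only: left_diff_distrib)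
    then have "D1 = 0" using p1(1) by simp
    then show False using \<open>D2 = 0\<close> \<open>D0 + p * D1 = 0\<close> minors unfolding D by auto
  qed
  have Q: "(b + q * c) * (e + q * k) = 0" for q
  proof (rule ccontr)
    assume A: "(b + q * c) * (e + q * k) \<noteq> 0"
    obtain q1 where q1: "q1 \<noteq> q" "(b + q1 * c) * (e + q1 * k) \<noteq> 0" using other[OF A] by blast
    have "D0 + p * D1 + r * D2 = 0" if "(b + r * c) * (e + r * k) \<noteq> 0" for r p
      using zero[of p r] that unfolding det by blast
    from this[OF A, of 0] this[OF A, of 1] this[OF q1(2), of 0]
    have "D1 = 0" "D0 + q * D2 = 0" "D0 + q1 * D2 = 0" by auto
    then have "q * D2 - q1 * D2 = 0" by linarith
    then have "(q - q1) * D2 = 0" by (simp only: left_diff_distrib)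
    then have "D2 = 0" using q1(1) by simp
    then show False using \<open>D1 = 0\<close> \<open>D0 + q * D2 = 0\<close> minors unfolding D by auto
  qed
  have "a * d = 0" "b * e = 0" using P[of 0] Q[of 0] by auto
  have "c * k = 0" "a * k + c * d = 0" using P[of 1] P[of "-1"] \<open>a * d = 0\<close> by (auto simp: algebra_simps)
  have "b * k + c * e = 0" using Q[of 1] \<open>c * k = 0\<close> \<open>b * e = 0\<close> by (auto simp: algebra_simps)
  show "c = 0"
  proof (rule ccontr)
    assume "c \<noteq> 0"
    then have "k = 0" using \<open>c * k = 0\<close> by simp
    then have "d = 0" "e = 0" using \<open>c \<noteq> 0\<close> \<open>a * k + c * d = 0\<close> \<open>b * k + c * e = 0\<close> by auto
    then show False using minors \<open>k = 0\<close> by simp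
  qed
  show "k = 0"
  proof (rule ccontr)
    assume "k \<noteq> 0"
    then have "a = 0" "b = 0" using \<open>c = 0\<close> \<open>a * k + c * d = 0\<close> \<open>b * k + c * e = 0\<close> by auto
    then show False using minors \<open>c = 0\<close> by simp
  qed
  then have "a * e - b * d \<noteq> 0" using minors \<open>c = 0\<close> by simp
  then show "b = 0 \<and> d = 0 \<and> a \<noteq> 0 \<and> e \<noteq> 0 \<or> a = 0 \<and> e = 0 \<and> b \<noteq> 0 \<and> d \<noteq> 0"
    using \<open>a * d = 0\<close> \<open>b * e = 0\<close> by auto
qed

text \<open>Test tuples. K = u secures membership in the class for all admissible \<open>f\<close>
  and \<open>H\<close>, including constants.\<close>

definition probe :: "(real \<Rightarrow> real) \<Rightarrow> (real \<Rightarrow> real) \<Rightarrow> arb_elements" where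
  "probe f H = \<lparr>el_f = f, el_g = \<lambda>x. 1, el_h = \<lambda>x. 1, el_H = H, el_K = \<lambda>u. u\<rparr>"

lemma probe_simps [simp]:
  "el_f (probe f H) = f" "el_g (probe f H) = (\<lambda>x. 1)" "el_H (probe f H) = H"
  by (simp_all add: probe_def)

lemma probe_arb_class:
  assumes "open I" "open J" "J \<noteq> {}" "smooth_on I f" "smooth_on J H"
    and "\<And>x. x \<in> I \<Longrightarrow> f x \<noteq> 0" "\<And>u. u \<in> J \<Longrightarrow> H u \<noteq> 0"
  shows "probe f H \<in> arb_class I J"
proof -
  have "deriv (\<lambda>u::real. u) u = 1" for u by (rule DERIV_imp_deriv[OF DERIV_ident])
  then show ?thesis
    using assms unfolding arb_class_def probe_def by (auto intro: smooth_on_const smooth_on_ident)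
qed

lemma pointwise_form:
  fixes t0 x0 u0 :: real and \<phi> :: "point \<Rightarrow> point"
  assumes I: "open It" "open Ix" "open Iu" and pt: "point_transformation (It \<times> Ix \<times> Iu) \<phi>"
    and \<Psi>: "\<And>\<theta>. \<theta> \<in> arb_class Ix Iu \<Longrightarrow>
      \<Psi> \<theta> \<in> arb_class (x_range (It \<times> Ix \<times> Iu) \<phi>) (u_range (It \<times> Ix \<times> Iu) \<phi>) \<and>
      maps_equation (It \<times> Ix \<times> Iu) \<phi> \<theta> (\<Psi> \<theta>)"
    and z: "(t0, x0, u0) \<in> It \<times> Ix \<times> Iu" and L: "L = frechet_derivative \<phi> (at (t0, x0, u0))"
  shows "fst (L (0, 0, 1)) = 0" "fst (snd (L (0, 0, 1))) = 0"
    "fst (L (0, 1, 0)) = 0 \<and> fst (snd (L (1, 0, 0))) = 0 \<and> fst (L (1, 0, 0)) \<noteq> 0 \<and> fst (snd (L (0, 1, 0))) \<noteq> 0 \<or>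
     fst (L (1, 0, 0)) = 0 \<and> fst (snd (L (0, 1, 0))) = 0 \<and> fst (L (0, 1, 0)) \<noteq> 0 \<and> fst (snd (L (1, 0, 0))) \<noteq> 0"
proof -
  let ?B = "It \<times> Ix \<times> Iu" and ?z = "(t0, x0, u0)"
  have B: "open ?B" using I by (simp add: open_Times)
  have \<phi>: "smooth_on ?B \<phi>" and bij: "bij L" using pt z L by (auto simp: point_transformation_def)
  have lin: "linear L" unfolding L by (rule has_derivative_linear[OF smooth_on_has_derivative[OF \<phi> B z]])
  define a b c where "a = fst (L (1, 0, 0))" "b = fst (L (0, 1, 0))" "c = fst (L (0, 0, 1))"
  define d e k where "d = fst (snd (L (1, 0, 0)))" "e = fst (snd (L (0, 1, 0)))" "k = fst (snd (L (0, 0, 1)))"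
  note defs = \<open>a = _\<close> \<open>b = _\<close> \<open>c = _\<close> \<open>d = _\<close> \<open>e = _\<close> \<open>k = _\<close>
  have Lh: "L h = fst h *\<^sub>R L (1, 0, 0) + fst (snd h) *\<^sub>R L (0, 1, 0) + snd (snd h) *\<^sub>R L (0, 0, 1)" for h
  proof -
    have "L (fst h *\<^sub>R (1, 0, 0) + fst (snd h) *\<^sub>R (0, 1, 0) + snd (snd h) *\<^sub>R (0, 0, 1)) =
        fst h *\<^sub>R L (1, 0, 0) + fst (snd h) *\<^sub>R L (0, 1, 0) + snd (snd h) *\<^sub>R L (0, 0, 1)"
      by (simp only: linear_add[OF lin] linear_cmul[OF lin])
    moreover have "fst h *\<^sub>R (1, 0, 0) + fst (snd h) *\<^sub>R (0, 1, 0) + snd (snd h) *\<^sub>R (0, 0, 1) = h"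
      by (simp add: prod_eq_iff)
    ultimately show ?thesis by simp
  qed
  have comps: "fst (L h) = fst h * a + fst (snd h) * b + snd (snd h) * c"
    "fst (snd (L h)) = fst h * d + fst (snd h) * e + snd (snd h) * k" for h
    by (subst Lh, simp add: defs)+
  have minors: "a * e - b * d \<noteq> 0 \<or> c * e - b * k \<noteq> 0 \<or> a * k - c * d \<noteq> 0"
  proof (rule ccontr)
    assume "\<not> ?thesis"
    then have 0: "a * e - b * d = 0" "c * e - b * k = 0" "a * k - c * d = 0" by auto
    obtain h where h: "L h = (1, 0, 0)" using bij by (metis bij_pointE)
    obtain g where g: "L g = (0, 1, 0)" using bij by (metis bij_pointE)
    have "1 = fst (L h) * fst (snd (L g)) - fst (snd (L h)) * fst (L g)" unfolding h g by simp
    also have "\<dots> = (a * e - b * d) * (fst h * fst (snd g) - fst (snd h) * fst g)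
        + (a * k - c * d) * (fst h * snd (snd g) - snd (snd h) * fst g)
        + (c * e - b * k) * (snd (snd h) * fst (snd g) - fst (snd h) * snd (snd g))"
      unfolding comps by (simp add: algebra_simps)
    finally show False unfolding 0 by simp
  qed
  have zero: "(a + p * c) * (d + p * k) = 0 \<and> (b + q * c) * (e + q * k) = 0"
    if det: "(a + p * c) * (e + q * k) - (b + q * c) * (d + p * k) \<noteq> 0" for p q
  proof -
    have T: "a + p * c = fst (L (1, 0, p))" "b + q * c = fst (L (0, 1, q))"
      and X: "d + p * k = fst (snd (L (1, 0, p)))" "e + q * k = fst (snd (L (0, 1, q)))"
      unfolding comps by simp_all
    \<comment> \<open>For f = g = 1 and H = s, eliminating the new \<open>f\<close> and
      \<open>g H\<close> from the symbol relations leaves T_t X_t = s T_x X_x for the total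
      derivatives along the graph. As \<phi> does not depend on \<open>s\<close>, the values s = 1
      and s = 2 together make both products zero.\<close>
    have rel: "(a + p * c) * (d + p * k) = s * ((b + q * c) * (e + q * k))" if s: "s > 0" for s :: real
    proof -
      have cl: "probe (\<lambda>_. 1) (\<lambda>_. s) \<in> arb_class Ix Iu"
        using s z I by (intro probe_arb_class) (auto intro: smooth_on_const)
      note \<theta>' = conjunct1[OF \<Psi>[OF cl]] and mp = conjunct2[OF \<Psi>[OF cl]]
      obtain \<mu> f' G' where m: "\<mu> \<noteq> 0" "f' * (e + q * k)\<^sup>2 - G' * (b + q * c)\<^sup>2 = \<mu> * 1"
        "f' * (d + p * k)\<^sup>2 - G' * (a + p * c)\<^sup>2 = - \<mu> * (1 * s)"
        "f' * (e + q * k) * (d + p * k) = G' * (b + q * c) * (a + p * c)"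
        by (rule symbol_relation[OF I pt cl \<theta>' mp z L T X det refl refl]) (use that in simp)
      have "\<mu> * ((a + p * c) * (d + p * k) - s * ((b + q * c) * (e + q * k))) =
          (\<mu> * 1) * ((a + p * c) * (d + p * k)) + (- \<mu> * (1 * s)) * ((b + q * c) * (e + q * k))"
        by (simp add: algebra_simps)
      also have "\<dots> = (f' * (e + q * k) * (d + p * k) - G' * (b + q * c) * (a + p * c)) *
          ((a + p * c) * (e + q * k) + (b + q * c) * (d + p * k))"
        unfolding m(2,3)[symmetric] by (simp add: power2_eq_square algebra_simps)
      finally show ?thesis using m(1,4) by simp
    qed
    from rel[of 1] rel[of 2] show ?thesis by simp
  qed
  note cd = characteristic_directions[OF minors zero]
  show "fst (L (0, 0, 1)) = 0" "fst (snd (L (0, 0, 1))) = 0"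
    using cd(1,2) unfolding defs by auto
  show "fst (L (0, 1, 0)) = 0 \<and> fst (snd (L (1, 0, 0))) = 0 \<and> fst (L (1, 0, 0)) \<noteq> 0 \<and> fst (snd (L (0, 1, 0))) \<noteq> 0 \<or>
     fst (L (1, 0, 0)) = 0 \<and> fst (snd (L (0, 1, 0))) = 0 \<and> fst (L (0, 1, 0)) \<noteq> 0 \<and> fst (snd (L (1, 0, 0))) \<noteq> 0"
    using cd(3) unfolding defs by blast
qed

subsection \<open>The form of the point transformation\<close>

lemma DERIV_zero_const:
  assumes "open_interval I" "\<And>x. x \<in> I \<Longrightarrow> DERIV f x :> (0::real)" "x \<in> I" "y \<in> I"
  shows "f x = f y"
proof (rule has_derivative_zero_unique[OF open_intervalD(2)[OF assms(1)] _ assms(3,4)])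
  fix z assume "z \<in> I"
  then have "(f has_derivative (*) 0) (at z)" using assms(2) by (simp add: has_field_derivative_def)
  moreover have "(*) 0 = (\<lambda>h::real. 0::real)" by auto
  ultimately show "(f has_derivative (\<lambda>h. 0)) (at z within I)"
    by (auto intro: has_derivative_at_withinI)
qed

lemma two_points:
  assumes "open_interval I"
  obtains x y where "x \<in> I" "y \<in> I" "x \<noteq> y"
proof -
  obtain x where x: "x \<in> I" using open_intervalD(4)[OF assms] by blast
  obtain c d where "c < x" "{c..d} \<subseteq> I" "x < d" using interval_between[OF assms x x] by blast
  then have "c \<in> I" by (intro subsetD[of "{c..d}" I]) auto
  then show thesis using that[of x c] x \<open>c < x\<close> by simp
qed

text \<open>Membership in the group, tuple by tuple, which determines the form of \<phi>. The
  smoothness of \<Psi> enters later, with the arbitrary elements.\<close>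

locale equivalence_transformation =
  fixes It Ix Iu :: "real set" and \<phi> :: "point \<Rightarrow> point" and \<Psi> :: "arb_elements \<Rightarrow> arb_elements"
  assumes It: "open_interval It" and Ix: "open_interval Ix" and Iu: "open_interval Iu"
    and pt: "point_transformation (It \<times> Ix \<times> Iu) \<phi>"
    and cls: "\<And>\<theta>. \<theta> \<in> arb_class Ix Iu \<Longrightarrow>
      \<Psi> \<theta> \<in> arb_class (x_range (It \<times> Ix \<times> Iu) \<phi>) (u_range (It \<times> Ix \<times> Iu) \<phi>)"
    and map: "\<And>\<theta>. \<theta> \<in> arb_class Ix Iu \<Longrightarrow> maps_equation (It \<times> Ix \<times> Iu) \<phi> \<theta> (\<Psi> \<theta>)"
begin

abbreviation "B \<equiv> It \<times> Ix \<times> Iu"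
abbreviation "X z \<equiv> fst (snd (\<phi> z))"
abbreviation "U z \<equiv> snd (snd (\<phi> z))"
definition "L z = frechet_derivative \<phi> (at z)"

lemmas oIt = open_intervalD(1)[OF It]
lemmas oIx = open_intervalD(1)[OF Ix]
lemmas oIu = open_intervalD(1)[OF Iu]

lemma oB: "open B"
  using oIt oIx oIu by (simp add: open_Times)

lemma smooth: "smooth_on B \<phi>" and bij: "z \<in> B \<Longrightarrow> bij (L z)"
  using pt by (auto simp: point_transformation_def L_def)

lemma partials:
  fixes l :: "point \<Rightarrow> real"
  assumes z: "(t, x, u) \<in> B" and l: "bounded_linear l"
  shows "DERIV (\<lambda>s. l (\<phi> (s, x, u))) t :> l (L (t, x, u) (1, 0, 0))"
    "DERIV (\<lambda>s. l (\<phi> (t, s, u))) x :> l (L (t, x, u) (0, 1, 0))"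
    "DERIV (\<lambda>s. l (\<phi> (t, x, s))) u :> l (L (t, x, u) (0, 0, 1))"
proof -
  note d = smooth_on_has_derivative[OF smooth oB z, folded L_def]
  have c: "((\<lambda>s. (s, x, u)) has_vector_derivative (1, 0, 0)) (at t)"
    "((\<lambda>s. (t, s, u)) has_vector_derivative (0, 1, 0)) (at x)"
    "((\<lambda>s. (t, x, s)) has_vector_derivative (0, 0, 1)) (at u)"
    by (auto intro!: has_vector_derivative_Pair)
  show "DERIV (\<lambda>s. l (\<phi> (s, x, u))) t :> l (L (t, x, u) (1, 0, 0))"
    "DERIV (\<lambda>s. l (\<phi> (t, s, u))) x :> l (L (t, x, u) (0, 1, 0))"
    "DERIV (\<lambda>s. l (\<phi> (t, x, s))) u :> l (L (t, x, u) (0, 0, 1))"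
    unfolding has_real_derivative_iff_has_vector_derivative
    by (rule bounded_linear.has_vector_derivative[OF l] has_vector_derivative_chain[where F = \<phi>] d c)+
qed

lemmas partials_T = partials[OF _ bounded_linear_fst]
lemmas partials_X = partials[OF _ bounded_linear_compose[OF bounded_linear_fst bounded_linear_snd]]
lemmas partials_U = partials[OF _ bounded_linear_height]

lemma form:
  assumes z: "z \<in> B"
  shows "fst (L z (0, 0, 1)) = 0" "fst (snd (L z (0, 0, 1))) = 0" "snd (snd (L z (0, 0, 1))) \<noteq> 0"
    "fst (L z (0, 1, 0)) = 0 \<and> fst (snd (L z (1, 0, 0))) = 0 \<and> fst (L z (1, 0, 0)) \<noteq> 0 \<and> fst (snd (L z (0, 1, 0))) \<noteq> 0 \<or>
     fst (L z (1, 0, 0)) = 0 \<and> fst (snd (L z (0, 1, 0))) = 0 \<and> fst (L z (0, 1, 0)) \<noteq> 0 \<and> fst (snd (L z (1, 0, 0))) \<noteq> 0"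
proof -
  obtain t x u where e: "z = (t, x, u)" using prod_cases3 by blast
  have *: "\<And>\<theta>. \<theta> \<in> arb_class Ix Iu \<Longrightarrow> \<Psi> \<theta> \<in> arb_class (x_range B \<phi>) (u_range B \<phi>) \<and> maps_equation B \<phi> \<theta> (\<Psi> \<theta>)"
    using cls map by blast
  note pf = pointwise_form[OF oIt oIx oIu pt * z[unfolded e] L_def, folded e]
  show 1: "fst (L z (0, 0, 1)) = 0" by (rule pf(1))
  show 2: "fst (snd (L z (0, 0, 1))) = 0" by (rule pf(2))
  show "snd (snd (L z (0, 0, 1))) \<noteq> 0"
  proof
    assume "snd (snd (L z (0, 0, 1))) = 0"
    then have "L z (0, 0, 1) = L z 0"
      using 1 2 linear_0[OF has_derivative_linear[OF smooth_on_has_derivative[OF smooth oB z]]]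
      by (simp add: prod_eq_iff L_def)
    then show False using bij[OF z] by (simp add: bij_is_inj inj_eq zero_prod_def)
  qed
  show "fst (L z (0, 1, 0)) = 0 \<and> fst (snd (L z (1, 0, 0))) = 0 \<and> fst (L z (1, 0, 0)) \<noteq> 0 \<and> fst (snd (L z (0, 1, 0))) \<noteq> 0 \<or>
     fst (L z (1, 0, 0)) = 0 \<and> fst (snd (L z (0, 1, 0))) = 0 \<and> fst (L z (0, 1, 0)) \<noteq> 0 \<and> fst (snd (L z (1, 0, 0))) \<noteq> 0"
    by (rule pf(3))
qed

lemma ranges: "open (x_range B \<phi>)" "open (u_range B \<phi>)"
  using open_ranges[OF oB pt] .

lemma in_ranges: "z \<in> B \<Longrightarrow> X z \<in> x_range B \<phi>" "z \<in> B \<Longrightarrow> U z \<in> u_range B \<phi>"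
  by (auto simp: x_range_def u_range_def)

text \<open>The factor \<mu> is eliminated between two symbol relations at p = q = 0. In the first
  case \<open>f\<close> and \<open>g H\<close> keep their roles, in the second they are
  exchanged.\<close>

lemma relations:
  assumes \<theta>: "\<theta> \<in> arb_class Ix Iu" and z: "(t, x, u) \<in> B"
  shows "fst (L (t, x, u) (0, 1, 0)) = 0 \<Longrightarrow>
      el_g (\<Psi> \<theta>) (X (t, x, u)) * el_H (\<Psi> \<theta>) (U (t, x, u)) * el_f \<theta> x * (fst (L (t, x, u) (1, 0, 0)))\<^sup>2 =
      el_g \<theta> x * el_H \<theta> u * el_f (\<Psi> \<theta>) (X (t, x, u)) * (fst (snd (L (t, x, u) (0, 1, 0))))\<^sup>2"
    "fst (L (t, x, u) (0, 1, 0)) \<noteq> 0 \<Longrightarrow>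
      el_g (\<Psi> \<theta>) (X (t, x, u)) * el_H (\<Psi> \<theta>) (U (t, x, u)) * el_g \<theta> x * el_H \<theta> u * (fst (L (t, x, u) (0, 1, 0)))\<^sup>2 =
      el_f \<theta> x * el_f (\<Psi> \<theta>) (X (t, x, u)) * (fst (snd (L (t, x, u) (1, 0, 0))))\<^sup>2"
proof -
  let ?z = "(t, x, u)"
  have det: "fst (L ?z (1, 0, 0)) * fst (snd (L ?z (0, 1, 0))) - fst (L ?z (0, 1, 0)) * fst (snd (L ?z (1, 0, 0))) \<noteq> 0"
    using form(4)[OF z] by auto
  obtain \<mu> f' G' where d: "f' = el_f (\<Psi> \<theta>) (X ?z)" "G' = el_g (\<Psi> \<theta>) (X ?z) * el_H (\<Psi> \<theta>) (U ?z)"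
    and m: "f' * (fst (snd (L ?z (0, 1, 0))))\<^sup>2 - G' * (fst (L ?z (0, 1, 0)))\<^sup>2 = \<mu> * el_f \<theta> x"
    "f' * (fst (snd (L ?z (1, 0, 0))))\<^sup>2 - G' * (fst (L ?z (1, 0, 0)))\<^sup>2 = - \<mu> * (el_g \<theta> x * el_H \<theta> u)"
    by (rule symbol_relation[OF oIt oIx oIu pt \<theta> cls[OF \<theta>] map[OF \<theta>] z L_def refl refl refl refl det refl refl])
      (use that in blast)
  show "el_g (\<Psi> \<theta>) (X ?z) * el_H (\<Psi> \<theta>) (U ?z) * el_f \<theta> x * (fst (L ?z (1, 0, 0)))\<^sup>2 =
      el_g \<theta> x * el_H \<theta> u * el_f (\<Psi> \<theta>) (X ?z) * (fst (snd (L ?z (0, 1, 0))))\<^sup>2"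
    if 0: "fst (L ?z (0, 1, 0)) = 0"
  proof -
    have "fst (snd (L ?z (1, 0, 0))) = 0" using form(4)[OF z] 0 by auto
    then have "G' * (fst (L ?z (1, 0, 0)))\<^sup>2 = \<mu> * (el_g \<theta> x * el_H \<theta> u)" using m(2) by simp
    moreover have "f' * (fst (snd (L ?z (0, 1, 0))))\<^sup>2 = \<mu> * el_f \<theta> x" using m(1) 0 by simp
    ultimately have "G' * (fst (L ?z (1, 0, 0)))\<^sup>2 * el_f \<theta> x =
        el_g \<theta> x * el_H \<theta> u * (f' * (fst (snd (L ?z (0, 1, 0))))\<^sup>2)"
      by (simp only: mult_ac)
    then show ?thesis unfolding d(1)[symmetric] d(2)[symmetric] by (simp only: mult_ac)
  qed
  show "el_g (\<Psi> \<theta>) (X ?z) * el_H (\<Psi> \<theta>) (U ?z) * el_g \<theta> x * el_H \<theta> u * (fst (L ?z (0, 1, 0)))\<^sup>2 =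
      el_f \<theta> x * el_f (\<Psi> \<theta>) (X ?z) * (fst (snd (L ?z (1, 0, 0))))\<^sup>2"
    if 0: "fst (L ?z (0, 1, 0)) \<noteq> 0"
  proof -
    have Z: "fst (L ?z (1, 0, 0)) = 0" "fst (snd (L ?z (0, 1, 0))) = 0" using form(4)[OF z] 0 by auto
    have "f' * (fst (snd (L ?z (1, 0, 0))))\<^sup>2 = - \<mu> * (el_g \<theta> x * el_H \<theta> u)" using m(2) Z by simp
    moreover have "G' * (fst (L ?z (0, 1, 0)))\<^sup>2 = - \<mu> * el_f \<theta> x" using m(1) Z by simp
    ultimately have "G' * (fst (L ?z (0, 1, 0)))\<^sup>2 * (el_g \<theta> x * el_H \<theta> u) =
        el_f \<theta> x * (f' * (fst (snd (L ?z (1, 0, 0))))\<^sup>2)"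
      by (simp only: mult_ac)
    then show ?thesis unfolding d(1)[symmetric] d(2)[symmetric] by (simp only: mult_ac)
  qed
qed

text \<open>Along a curve \<open>c\<close>, the new \<open>f\<close> and \<open>g\<close> see only
  the motion of \<open>X\<close>, the new \<open>H\<close> only that of \<open>U\<close>.\<close>

lemma image_DERIV:
  assumes \<theta>: "\<theta> \<in> arb_class Ix Iu" and z: "z \<in> B" and "c r = z"
    and dX: "DERIV (\<lambda>r. X (c r)) r :> dX" and dU: "DERIV (\<lambda>r. U (c r)) r :> dU"
  shows "DERIV (\<lambda>r. el_f (\<Psi> \<theta>) (X (c r))) r :> deriv (el_f (\<Psi> \<theta>)) (X z) * dX"
    "DERIV (\<lambda>r. el_g (\<Psi> \<theta>) (X (c r))) r :> deriv (el_g (\<Psi> \<theta>)) (X z) * dX"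
    "DERIV (\<lambda>r. el_H (\<Psi> \<theta>) (U (c r))) r :> deriv (el_H (\<Psi> \<theta>)) (U z) * dU"
proof -
  note c = arb_classD[OF cls[OF \<theta>]]
  have "DERIV (el_f (\<Psi> \<theta>)) (X (c r)) :> deriv (el_f (\<Psi> \<theta>)) (X z)"
    "DERIV (el_g (\<Psi> \<theta>)) (X (c r)) :> deriv (el_g (\<Psi> \<theta>)) (X z)"
    "DERIV (el_H (\<Psi> \<theta>)) (U (c r)) :> deriv (el_H (\<Psi> \<theta>)) (U z)"
    unfolding assms(3)
    by (rule smooth_on_DERIV[OF c(1) ranges(1) in_ranges(1)[OF z]] smooth_on_DERIV[OF c(2) ranges(1) in_ranges(1)[OF z]]
        smooth_on_DERIV[OF c(4) ranges(2) in_ranges(2)[OF z]])+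
  from DERIV_chain2[OF this(1) dX] DERIV_chain2[OF this(2) dX] DERIV_chain2[OF this(3) dU]
  show "DERIV (\<lambda>r. el_f (\<Psi> \<theta>) (X (c r))) r :> deriv (el_f (\<Psi> \<theta>)) (X z) * dX"
    "DERIV (\<lambda>r. el_g (\<Psi> \<theta>) (X (c r))) r :> deriv (el_g (\<Psi> \<theta>)) (X z) * dX"
    "DERIV (\<lambda>r. el_H (\<Psi> \<theta>) (U (c r))) r :> deriv (el_H (\<Psi> \<theta>)) (U z) * dU" .
qed

lemma probe_cls:
  assumes "smooth_on Ix f" "smooth_on Iu H" "\<And>x. x \<in> Ix \<Longrightarrow> f x \<noteq> 0" "\<And>u. u \<in> Iu \<Longrightarrow> H u \<noteq> 0"
  shows "probe f H \<in> arb_class Ix Iu"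
  by (rule probe_arb_class[OF oIx oIu open_intervalD(4)[OF Iu] assms])

lemma probe1: "probe (\<lambda>_. 1) (\<lambda>_. 1) \<in> arb_class Ix Iu"
  by (intro probe_cls smooth_on_const oIx oIu) auto

text \<open>An exchange of the roles of \<open>t\<close> and \<open>x\<close> is impossible: it would make \<open>f\<close> and \<open>g H\<close> change
  places, but the new \<open>f\<close> and \<open>g\<close> depend on \<open>X = X(t)\<close> only, so that there is no room for
  the old \<open>f(x)\<close>.\<close>

lemma no_exchange:
  assumes z: "z \<in> B"
  shows "fst (L z (0, 1, 0)) = 0"
proof (rule ccontr)
  assume nz: "fst (L z (0, 1, 0)) \<noteq> 0"
  obtain t x u where e: "z = (t, x, u)" using prod_cases3 by blast
  \<comment> \<open>The exchanged alternative persists on an open set, so the identity derived from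
    it may be differentiated.\<close>
  define N where "N = B \<inter> (\<lambda>z. fst (L z (0, 1, 0))) -` (- {0})"
  have "continuous_on B (\<lambda>z. fst (L z (0, 1, 0)))"
    unfolding L_def by (intro continuous_on_fst smooth_on_continuous[OF smooth_on_derivative[OF smooth]])
  then have N: "open N"
    unfolding N_def by (rule continuous_open_preimage[OF _ oB]) auto
  have zN: "(t, x, u) \<in> N" using z nz by (simp add: N_def e)
  define \<theta>1 \<theta>2 where "\<theta>1 = probe (\<lambda>_. 1) (\<lambda>_. 1)" "\<theta>2 = probe exp (\<lambda>_. 1)"
  note \<theta> = this
  have c1: "\<theta>1 \<in> arb_class Ix Iu" unfolding \<theta> by (rule probe1)
  have c2: "\<theta>2 \<in> arb_class Ix Iu" unfolding \<theta>
    by (intro probe_cls smooth_on_const smooth_on_exp smooth_on_ident oIx oIu) auto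
  define a1 a2 b1 b2 H1 H2 where "a1 = el_f (\<Psi> \<theta>1)" "a2 = el_f (\<Psi> \<theta>2)" "b1 = el_g (\<Psi> \<theta>1)"
    "b2 = el_g (\<Psi> \<theta>2)" "H1 = el_H (\<Psi> \<theta>1)" "H2 = el_H (\<Psi> \<theta>2)"
  note defs = this
  \<comment> \<open>The relations for f = 1 and f = exp, multiplied crosswise to remove the unknown
    squares T_x^2 and X_t^2, say that \<open>F\<close> vanishes on \<open>N\<close>.\<close>
  define F where "F p = b2 (X p) * H2 (U p) * a1 (X p) - exp (fst (snd p)) * (a2 (X p) * b1 (X p) * H1 (U p))" for p
  have F0: "F p = 0" if p: "p \<in> N" for p
  proof -
    obtain t x u where pe: "p = (t, x, u)" using prod_cases3 by blast
    have pB: "(t, x, u) \<in> B" and q: "fst (L (t, x, u) (0, 1, 0)) \<noteq> 0" using p by (auto simp: N_def pe)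
    have "fst (snd (L (t, x, u) (1, 0, 0))) \<noteq> 0" using form(4)[OF pB] q by auto
    note r = relations(2)[OF c1 pB q] relations(2)[OF c2 pB q]
    define P Q where "P = (fst (L (t, x, u) (0, 1, 0)))\<^sup>2" "Q = (fst (snd (L (t, x, u) (1, 0, 0))))\<^sup>2"
    note PQ = this
    have P: "P \<noteq> 0" "Q \<noteq> 0" using q \<open>fst (snd (L (t, x, u) (1, 0, 0))) \<noteq> 0\<close> by (auto simp: PQ)
    have r1: "b1 (X p) * H1 (U p) * P = a1 (X p) * Q" and r2: "b2 (X p) * H2 (U p) * P = exp x * a2 (X p) * Q"
      using r unfolding PQ[symmetric] defs \<theta> pe by simp_all
    have "F p * (P * Q) = (b2 (X p) * H2 (U p) * P) * (a1 (X p) * Q) - exp x * a2 (X p) * Q * (b1 (X p) * H1 (U p) * P)"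
      unfolding F_def pe by (simp add: algebra_simps)
    also have "\<dots> = 0" unfolding r1 r2 by simp
    finally show ?thesis using P by simp
  qed
  note zB = z[unfolded e]
  have Xu: "DERIV (\<lambda>r. X (t, x, r)) u :> 0" using partials_X(3)[OF zB] form(2)[OF zB] by simp
  have Xx: "DERIV (\<lambda>r. X (t, r, u)) x :> 0" using partials_X(2)[OF zB] form(4)[OF zB] nz e by auto
  define Uu Ux where "Uu = snd (snd (L (t, x, u) (0, 0, 1)))" "Ux = snd (snd (L (t, x, u) (0, 1, 0)))"
  note UU = this
  have dUu: "DERIV (\<lambda>r. U (t, x, r)) u :> Uu" and dUx: "DERIV (\<lambda>r. U (t, r, u)) x :> Ux"
    unfolding UU by (rule partials_U[OF zB])+
  note du1 = image_DERIV[OF c1 zB, of "\<lambda>r. (t, x, r)", OF refl Xu dUu, folded defs]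
  note du2 = image_DERIV[OF c2 zB, of "\<lambda>r. (t, x, r)", OF refl Xu dUu, folded defs]
  note dx1 = image_DERIV[OF c1 zB, of "\<lambda>r. (t, r, u)", OF refl Xx dUx, folded defs]
  note dx2 = image_DERIV[OF c2 zB, of "\<lambda>r. (t, r, u)", OF refl Xx dUx, folded defs]
  \<comment> \<open>The derivative of \<open>F\<close> with respect to the new \<open>u\<close>. As
    X_u = X_x = 0, the u-derivative of \<open>F\<close> is \<Delta> U_u, so \<Delta> = 0. The
    x-derivative then reduces to that of the explicit factor exp x, which is a product of
    nonvanishing elements.\<close>
  define \<Delta> where "\<Delta> = b2 (X (t, x, u)) * deriv H2 (U (t, x, u)) * a1 (X (t, x, u)) -
    exp x * (a2 (X (t, x, u)) * b1 (X (t, x, u)) * deriv H1 (U (t, x, u)))"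
  have "\<Delta> * Uu = 0"
  proof (rule DERIV_unique_on)
    show "DERIV (\<lambda>r. F (t, x, r)) u :> \<Delta> * Uu"
      unfolding F_def \<Delta>_def fst_conv snd_conv
      by (rule derivative_eq_intros du1 du2 refl)+ (simp add: algebra_simps)
    show "DERIV (\<lambda>r::real. 0::real) u :> 0" by simp
    show "open ((\<lambda>r. (t, x, r)) -` N)" by (rule open_vimage[OF N]) (intro continuous_intros)
    show "u \<in> (\<lambda>r. (t, x, r)) -` N" using zN by simp
    show "F (t, x, r) = 0" if "r \<in> (\<lambda>r. (t, x, r)) -` N" for r using F0 that by simp
  qed
  then have \<Delta>: "\<Delta> = 0" using form(3)[OF zB] unfolding UU by simp
  have "\<Delta> * Ux - exp x * (a2 (X (t, x, u)) * b1 (X (t, x, u)) * H1 (U (t, x, u))) = 0"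
  proof (rule DERIV_unique_on)
    show "DERIV (\<lambda>r. F (t, r, u)) x :> \<Delta> * Ux - exp x * (a2 (X (t, x, u)) * b1 (X (t, x, u)) * H1 (U (t, x, u)))"
      unfolding F_def \<Delta>_def fst_conv snd_conv
      by (rule derivative_eq_intros dx1 dx2 refl)+ (simp add: algebra_simps)
    show "DERIV (\<lambda>r::real. 0::real) x :> 0" by simp
    show "open ((\<lambda>r. (t, r, u)) -` N)" by (rule open_vimage[OF N]) (intro continuous_intros)
    show "x \<in> (\<lambda>r. (t, r, u)) -` N" using zN by simp
    show "F (t, r, u) = 0" if "r \<in> (\<lambda>r. (t, r, u)) -` N" for r using F0 that by simp
  qed
  then have "a2 (X (t, x, u)) * b1 (X (t, x, u)) * H1 (U (t, x, u)) = 0" using \<Delta> by simp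
  moreover have "a2 (X (t, x, u)) \<noteq> 0" "b1 (X (t, x, u)) \<noteq> 0" "H1 (U (t, x, u)) \<noteq> 0"
    unfolding defs using arb_classD(6-8)[OF cls[OF c1]] arb_classD(6-8)[OF cls[OF c2]] in_ranges[OF zB] by auto
  ultimately show False by simp
qed

lemma separated:
  assumes z: "z \<in> B"
  shows "fst (snd (L z (1, 0, 0))) = 0" "fst (L z (1, 0, 0)) \<noteq> 0" "fst (snd (L z (0, 1, 0))) \<noteq> 0"
  using form(4)[OF z] no_exchange[OF z] by auto

end

context equivalence_transformation
begin

section \<open>Reduction to functions of one variable\<close>

lemma L_linear: "z \<in> B \<Longrightarrow> linear (L z)"
  unfolding L_def by (rule has_derivative_linear[OF smooth_on_has_derivative[OF smooth oB]])

lemma T_depends_on_t: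
  assumes "t \<in> It" "x \<in> Ix" "u \<in> Iu" "x' \<in> Ix" "u' \<in> Iu"
  shows "fst (\<phi> (t, x, u)) = fst (\<phi> (t, x', u'))"
proof -
  have "fst (\<phi> (t, x, u)) = fst (\<phi> (t, x', u))"
  proof (rule DERIV_zero_const[OF Ix _ assms(2,4)])
    fix y assume "y \<in> Ix"
    then have z: "(t, y, u) \<in> B" using assms by simp
    show "DERIV (\<lambda>y. fst (\<phi> (t, y, u))) y :> 0" using partials_T(2)[OF z] no_exchange[OF z] by simp
  qed
  also have "\<dots> = fst (\<phi> (t, x', u'))"
  proof (rule DERIV_zero_const[OF Iu _ assms(3,5)])
    fix y assume "y \<in> Iu"
    then have z: "(t, x', y) \<in> B" using assms by simp
    show "DERIV (\<lambda>y. fst (\<phi> (t, x', y))) y :> 0" using partials_T(3)[OF z] form(1)[OF z] by simp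
  qed
  finally show ?thesis .
qed

lemma X_depends_on_x:
  assumes "t \<in> It" "x \<in> Ix" "u \<in> Iu" "t' \<in> It" "u' \<in> Iu"
  shows "X (t, x, u) = X (t', x, u')"
proof -
  have "X (t, x, u) = X (t', x, u)"
  proof (rule DERIV_zero_const[OF It _ assms(1,4)])
    fix y assume "y \<in> It"
    then have z: "(y, x, u) \<in> B" using assms by simp
    show "DERIV (\<lambda>y. X (y, x, u)) y :> 0" using partials_X(1)[OF z] separated(1)[OF z] by simp
  qed
  also have "\<dots> = X (t', x, u')"
  proof (rule DERIV_zero_const[OF Iu _ assms(3,5)])
    fix y assume "y \<in> Iu"
    then have z: "(t', x, y) \<in> B" using assms by simp
    show "DERIV (\<lambda>y. X (t', x, y)) y :> 0" using partials_X(3)[OF z] form(2)[OF z] by simp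
  qed
  finally show ?thesis .
qed

definition "ts = (SOME t. t \<in> It)"
definition "xs = (SOME x. x \<in> Ix)"
definition "us = (SOME u. u \<in> Iu)"

lemma base_point: "ts \<in> It" "xs \<in> Ix" "us \<in> Iu"
  unfolding ts_def xs_def us_def using open_intervalD(4)[OF It] open_intervalD(4)[OF Ix] open_intervalD(4)[OF Iu]
  by (simp_all add: some_in_eq)

definition "Tf t = fst (\<phi> (t, xs, us))"
definition "Xf x = X (ts, x, us)"
definition "Uf u = U (ts, xs, u)"

lemma Tf: "(t, x, u) \<in> B \<Longrightarrow> fst (\<phi> (t, x, u)) = Tf t"
  unfolding Tf_def by (rule T_depends_on_t) (simp_all add: base_point)

lemma Xf: "(t, x, u) \<in> B \<Longrightarrow> X (t, x, u) = Xf x"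
  unfolding Xf_def by (rule X_depends_on_x) (simp_all add: base_point)

lemma smooth_on_component:
  assumes "open I" "bounded_linear l" "smooth_on I c" "c ` I \<subseteq> B"
  shows "smooth_on I (\<lambda>r::real. l (\<phi> (c r)) :: real)"
  by (rule smooth_on_compose[OF assms(1) open_UNIV smooth_on_linear[OF open_UNIV assms(2)]
        smooth_on_compose[OF assms(1) oB smooth assms(3,4)]]) simp

lemma smooth_Tf: "smooth_on It Tf"
  unfolding Tf_def[abs_def] using base_point
  by (intro smooth_on_component[OF oIt bounded_linear_fst] smooth_on_Pair smooth_on_const smooth_on_ident oIt) auto

lemma smooth_Xf: "smooth_on Ix Xf"
  unfolding Xf_def[abs_def] using base_point
  by (intro smooth_on_component[OF oIx bounded_linear_compose[OF bounded_linear_fst bounded_linear_snd]]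
      smooth_on_Pair smooth_on_const smooth_on_ident oIx) auto

lemma smooth_Uf: "smooth_on Iu Uf"
  unfolding Uf_def[abs_def] using base_point
  by (intro smooth_on_component[OF oIu bounded_linear_height] smooth_on_Pair smooth_on_const smooth_on_ident oIu) auto

lemma Xf_range: "Xf ` Ix \<subseteq> x_range B \<phi>"
  unfolding Xf_def using in_ranges(1) base_point by auto

lemma deriv_Tf: "(t, x, u) \<in> B \<Longrightarrow> fst (L (t, x, u) (1, 0, 0)) = deriv Tf t"
  by (rule DERIV_unique_on[OF partials_T(1) smooth_on_DERIV[OF smooth_Tf oIt] oIt]) (auto simp: Tf)

lemma deriv_Xf: "(t, x, u) \<in> B \<Longrightarrow> fst (snd (L (t, x, u) (0, 1, 0))) = deriv Xf x"
  by (rule DERIV_unique_on[OF partials_X(2) smooth_on_DERIV[OF smooth_Xf oIx] oIx]) (auto simp: Xf)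

lemma deriv_Xf_nz: "x \<in> Ix \<Longrightarrow> deriv Xf x \<noteq> 0"
  using separated(3)[of "(ts, x, us)"] deriv_Xf[of ts x us] base_point by auto

lemma deriv_Tf_nz: "t \<in> It \<Longrightarrow> deriv Tf t \<noteq> 0"
  using separated(2)[of "(t, xs, us)"] deriv_Tf[of t xs us] base_point by auto

lemma probe_relation:
  assumes cl: "probe (\<lambda>_. 1) H \<in> arb_class Ix Iu" and z: "(t, x, u) \<in> B"
  defines "\<theta>' \<equiv> \<Psi> (probe (\<lambda>_. 1) H)"
  shows "el_g \<theta>' (Xf x) * el_H \<theta>' (U (t, x, u)) * (deriv Tf t)\<^sup>2 = H u * el_f \<theta>' (Xf x) * (deriv Xf x)\<^sup>2"
  using relations(1)[OF cl z no_exchange[OF z]] unfolding deriv_Tf[OF z] deriv_Xf[OF z] Xf[OF z] \<theta>'_def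
  by simp

text \<open>For f = g = H = 1 the relation is b1(X) H1(U) T_t^2 = a1(X) X_x^2. Its u-derivative
  shows that H1 is stationary at \<open>U\<close>, because U_u is nonzero. Then T_t^2 is the only
  factor that could vary with \<open>t\<close> to first order, so T_tt = 0.\<close>

lemma deriv2_Tf:
  assumes t: "t \<in> It"
  shows "deriv (deriv Tf) t = 0"
proof -
  let ?x = xs and ?u = us
  have z: "(t, xs, us) \<in> B" using t base_point by simp
  define H1 b1 a1 where "H1 = el_H (\<Psi> (probe (\<lambda>_. 1) (\<lambda>_. 1)))"
    "b1 = el_g (\<Psi> (probe (\<lambda>_. 1) (\<lambda>_. 1)))" "a1 = el_f (\<Psi> (probe (\<lambda>_. 1) (\<lambda>_. 1)))"
  note defs = this
  note rel = probe_relation[OF probe1, folded defs]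
  have b1: "b1 (Xf xs) \<noteq> 0" and h1: "H1 (U (t, xs, us)) \<noteq> 0"
    unfolding defs using arb_classD(7,8)[OF cls[OF probe1]] Xf_range base_point in_ranges(2)[OF z] by auto
  have Xu: "DERIV (\<lambda>r. X (t, xs, r)) us :> 0" using partials_X(3)[OF z] form(2)[OF z] by simp
  have Xt: "DERIV (\<lambda>r. X (r, xs, us)) t :> 0" using partials_X(1)[OF z] separated(1)[OF z] by simp
  note du = image_DERIV(3)[OF probe1 z, of "\<lambda>r. (t, xs, r)", OF refl Xu partials_U(3)[OF z], folded defs]
  note dt = image_DERIV(3)[OF probe1 z, of "\<lambda>r. (r, xs, us)", OF refl Xt partials_U(1)[OF z], folded defs]
  have "b1 (Xf xs) * (deriv H1 (U (t, xs, us)) * snd (snd (L (t, xs, us) (0, 0, 1)))) * (deriv Tf t)\<^sup>2 = 0"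
  proof (rule DERIV_unique_on[OF _ _ oIu base_point(3)])
    show "DERIV (\<lambda>r. b1 (Xf xs) * H1 (U (t, xs, r)) * (deriv Tf t)\<^sup>2) us :>
        b1 (Xf xs) * (deriv H1 (U (t, xs, us)) * snd (snd (L (t, xs, us) (0, 0, 1)))) * (deriv Tf t)\<^sup>2"
      by (intro DERIV_cmult_right DERIV_cmult du)
    show "DERIV (\<lambda>r::real. 1 * a1 (Xf xs) * (deriv Xf xs)\<^sup>2) us :> 0" by simp
    show "b1 (Xf xs) * H1 (U (t, xs, r)) * (deriv Tf t)\<^sup>2 = 1 * a1 (Xf xs) * (deriv Xf xs)\<^sup>2" if "r \<in> Iu" for r
      by (rule rel) (use that t base_point in simp)
  qed
  then have H1': "deriv H1 (U (t, xs, us)) = 0" using b1 deriv_Tf_nz[OF t] form(3)[OF z] by simp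
  have "b1 (Xf xs) * (0 * (deriv Tf t)\<^sup>2 + (2 * deriv Tf t * deriv (deriv Tf) t) * H1 (U (t, xs, us))) = 0"
  proof (rule DERIV_unique_on[OF _ _ oIt t])
    have "DERIV (\<lambda>r. (deriv Tf r)\<^sup>2) t :> 2 * deriv Tf t * deriv (deriv Tf) t"
      using smooth_on_DERIV[OF smooth_on_deriv[OF smooth_Tf oIt] oIt t]
      by (auto intro!: derivative_eq_intros)
    moreover have "DERIV (\<lambda>r. H1 (U (r, xs, us))) t :> 0" using dt unfolding H1' by simp
    ultimately show "DERIV (\<lambda>r. b1 (Xf xs) * (H1 (U (r, xs, us)) * (deriv Tf r)\<^sup>2)) t :>
      b1 (Xf xs) * (0 * (deriv Tf t)\<^sup>2 + (2 * deriv Tf t * deriv (deriv Tf) t) * H1 (U (t, xs, us)))"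
      by (intro DERIV_cmult DERIV_mult)
    show "DERIV (\<lambda>r::real. 1 * a1 (Xf xs) * (deriv Xf xs)\<^sup>2) t :> 0" by simp
    show "b1 (Xf xs) * (H1 (U (r, xs, us)) * (deriv Tf r)\<^sup>2) = 1 * a1 (Xf xs) * (deriv Xf xs)\<^sup>2" if "r \<in> It" for r
      using rel[of r xs us] that base_point by simp
  qed
  then show ?thesis using b1 h1 deriv_Tf_nz[OF t] by simp
qed

lemma deriv_Tf_const:
  assumes t: "t \<in> It"
  shows "deriv Tf t = deriv Tf ts"
proof (rule DERIV_zero_const[OF It _ t base_point(1)])
  fix r assume r: "r \<in> It"
  show "DERIV (deriv Tf) r :> 0"
    using smooth_on_DERIV[OF smooth_on_deriv[OF smooth_Tf oIt] oIt r] unfolding deriv2_Tf[OF r] .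
qed

lemma Tf_affine: "t \<in> It \<Longrightarrow> Tf t = deriv Tf ts * t + (Tf ts - deriv Tf ts * ts)"
proof -
  assume t: "t \<in> It"
  have "Tf t - deriv Tf ts * t = Tf ts - deriv Tf ts * ts"
  proof (rule DERIV_zero_const[OF It _ t base_point(1)])
    fix r assume r: "r \<in> It"
    show "DERIV (\<lambda>t. Tf t - deriv Tf ts * t) r :> 0"
      by (rule derivative_eq_intros smooth_on_DERIV[OF smooth_Tf oIt r] refl)+
        (simp add: deriv_Tf_const[OF r])
  qed
  then show ?thesis by simp
qed

text \<open>With f = g = 1 and T_t constant, the relation says that the new \<open>H\<close> at U(t,
  x, u) is H(u) r(x), where r = a X_x^2 / (b T_t^2). Its three partial derivatives constrain those
  of \<open>U\<close>; \<open>H'\<close> is the derivative of the new \<open>H\<close>.\<close>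

lemma probe_derivatives:
  assumes H: "smooth_on Iu H" "\<And>u. u \<in> Iu \<Longrightarrow> H u \<noteq> 0"
  obtains r H' where "\<And>x. x \<in> Ix \<Longrightarrow> r x \<noteq> 0"
    "\<And>t x u. (t, x, u) \<in> B \<Longrightarrow> H' (U (t, x, u)) * snd (snd (L (t, x, u) (1, 0, 0))) = 0"
    "\<And>t x u. (t, x, u) \<in> B \<Longrightarrow> H' (U (t, x, u)) * snd (snd (L (t, x, u) (0, 1, 0))) = H u * deriv r x"
    "\<And>t x u. (t, x, u) \<in> B \<Longrightarrow> H' (U (t, x, u)) * snd (snd (L (t, x, u) (0, 0, 1))) = deriv H u * r x"
proof -
  let ?\<theta> = "probe (\<lambda>_. 1) H"
  have cl: "?\<theta> \<in> arb_class Ix Iu" by (intro probe_cls smooth_on_const oIx H) auto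
  define Ht b a where "Ht = el_H (\<Psi> ?\<theta>)" "b = el_g (\<Psi> ?\<theta>)" "a = el_f (\<Psi> ?\<theta>)"
  note defs = this
  note c = arb_classD[OF cls[OF cl], folded defs]
  define r where "r x = a (Xf x) * (deriv Xf x * deriv Xf x) / (b (Xf x) * (deriv Tf ts * deriv Tf ts))" for x
  have nz: "a (Xf x) \<noteq> 0" "b (Xf x) \<noteq> 0" if "x \<in> Ix" for x
    using c(6,7) Xf_range that by auto
  have T0: "deriv Tf ts \<noteq> 0" by (rule deriv_Tf_nz[OF base_point(1)])
  have sX': "smooth_on Ix (deriv Xf)" by (rule smooth_on_deriv[OF smooth_Xf oIx])
  have sr: "smooth_on Ix r"
    unfolding r_def[abs_def]
    by (intro smooth_on_divide smooth_on_mult smooth_on_const oIx sX'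
        smooth_on_compose[OF oIx ranges(1) _ smooth_Xf Xf_range] c(1,2)) (use nz T0 in auto)
  have Hr: "Ht (U (t, x, u)) = H u * r x" if z: "(t, x, u) \<in> B" for t x u
  proof -
    have t: "t \<in> It" "x \<in> Ix" using z by auto
    have "b (Xf x) * Ht (U (t, x, u)) * (deriv Tf ts)\<^sup>2 = H u * a (Xf x) * (deriv Xf x)\<^sup>2"
      using probe_relation[OF cl z, folded defs] unfolding deriv_Tf_const[OF t(1)] .
    then show ?thesis
      unfolding r_def using nz(2)[OF t(2)] T0 by (simp add: field_simps power2_eq_square)
  qed
  have D: "deriv Ht (U z) * dU = d"
    if z: "z \<in> B" and c0: "c s = z" and "open N" "s \<in> N" "\<And>s. s \<in> N \<Longrightarrow> c s \<in> B"
      and dU: "DERIV (\<lambda>s. U (c s)) s :> dU"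
      and dR: "DERIV (\<lambda>s. H (snd (snd (c s))) * r (fst (snd (c s)))) s :> d" for z c s N dU d
  proof (rule DERIV_unique_on[OF _ dR that(3,4)])
    have "DERIV Ht (U (c s)) :> deriv Ht (U z)"
      unfolding c0 by (rule smooth_on_DERIV[OF c(4) ranges(2) in_ranges(2)[OF z]])
    from DERIV_chain2[OF this dU] show "DERIV (\<lambda>s. Ht (U (c s))) s :> deriv Ht (U z) * dU" .
    show "Ht (U (c s)) = H (snd (snd (c s))) * r (fst (snd (c s)))" if "s \<in> N" for s
      using Hr[of "fst (c s)" "fst (snd (c s))" "snd (snd (c s))"] \<open>\<And>s. s \<in> N \<Longrightarrow> c s \<in> B\<close>[OF that] by simp
  qed
  show thesis
  proof (rule that[of r "deriv Ht"])
    show "r x \<noteq> 0" if "x \<in> Ix" for x using nz[OF that] T0 deriv_Xf_nz[OF that] by (simp add: r_def)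
    fix t x u assume z: "(t, x, u) \<in> B"
    then have m: "t \<in> It" "x \<in> Ix" "u \<in> Iu" by auto
    show "deriv Ht (U (t, x, u)) * snd (snd (L (t, x, u) (1, 0, 0))) = 0"
      by (rule D[OF z, of "\<lambda>s. (s, x, u)" t It, OF refl oIt m(1) _ partials_U(1)[OF z]]) (use m in auto)
    show "deriv Ht (U (t, x, u)) * snd (snd (L (t, x, u) (0, 1, 0))) = H u * deriv r x"
      by (rule D[OF z, of "\<lambda>s. (t, s, u)" x Ix, OF refl oIx m(2) _ partials_U(2)[OF z]])
        (use m in \<open>auto intro!: DERIV_cmult smooth_on_DERIV[OF sr oIx]\<close>)
    show "deriv Ht (U (t, x, u)) * snd (snd (L (t, x, u) (0, 0, 1))) = deriv H u * r x"
      by (rule D[OF z, of "\<lambda>s. (t, x, s)" u Iu, OF refl oIu m(3) _ partials_U(3)[OF z]])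
        (use m in \<open>auto intro!: DERIV_cmult_right smooth_on_DERIV[OF H(1) oIu]\<close>)
  qed
qed

text \<open>Comparing \<open>H = exp u\<close> and \<open>H = exp (u\<^sup>2)\<close>: \<open>U\<^sub>x / U\<^sub>u\<close> depends on \<open>x\<close> only,
  and so does \<open>2 u U\<^sub>x / U\<^sub>u\<close>.\<close>

lemma U_depends_on_u:
  assumes z: "(t, x, u) \<in> B"
  shows "snd (snd (L (t, x, u) (1, 0, 0))) = 0" "snd (snd (L (t, x, u) (0, 1, 0))) = 0"
proof -
  have m: "t \<in> It" "x \<in> Ix" "u \<in> Iu" using z by auto
  obtain r2 H2 where r2: "\<And>x. x \<in> Ix \<Longrightarrow> r2 x \<noteq> 0" and
    d2: "\<And>t x u. (t, x, u) \<in> B \<Longrightarrow> H2 (U (t, x, u)) * snd (snd (L (t, x, u) (1, 0, 0))) = 0"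
    "\<And>t x u. (t, x, u) \<in> B \<Longrightarrow> H2 (U (t, x, u)) * snd (snd (L (t, x, u) (0, 1, 0))) = exp u * deriv r2 x"
    "\<And>t x u. (t, x, u) \<in> B \<Longrightarrow> H2 (U (t, x, u)) * snd (snd (L (t, x, u) (0, 0, 1))) = deriv exp u * r2 x"
    by (rule probe_derivatives[of exp]) (use smooth_on_exp[OF oIu smooth_on_ident[OF oIu]] in auto)
  have s3: "smooth_on Iu (\<lambda>u. exp (u * u))" by (intro smooth_on_exp smooth_on_mult smooth_on_ident oIu)
  obtain r3 H3 where r3: "\<And>x. x \<in> Ix \<Longrightarrow> r3 x \<noteq> 0" and
    d3: "\<And>t x u. (t, x, u) \<in> B \<Longrightarrow> H3 (U (t, x, u)) * snd (snd (L (t, x, u) (0, 1, 0))) = exp (u * u) * deriv r3 x"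
    "\<And>t x u. (t, x, u) \<in> B \<Longrightarrow> H3 (U (t, x, u)) * snd (snd (L (t, x, u) (0, 0, 1))) = deriv (\<lambda>u. exp (u * u)) u * r3 x"
    by (rule probe_derivatives[OF s3]) auto
  have e2: "deriv exp u = exp u" for u :: real by (rule DERIV_imp_deriv) simp
  have e3: "deriv (\<lambda>u. exp (u * u)) u = exp (u * u) * (2 * u)" for u :: real
    by (rule DERIV_imp_deriv) (auto intro!: derivative_eq_intros)
  have H2nz: "H2 (U (t, x, u)) \<noteq> 0" if "(t, x, u) \<in> B" for t x u
    using d2(3)[OF that] r2[of x] that by (auto simp: e2)
  show "snd (snd (L (t, x, u) (1, 0, 0))) = 0" using d2(1)[OF z] H2nz[OF z] by simp
  have key: "deriv r3 x * r2 x = 2 * w * (deriv r2 x * r3 x)" if w: "w \<in> Iu" for w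
  proof -
    have zw: "(t, x, w) \<in> B" using z w by simp
    define Ux Uu where "Ux = snd (snd (L (t, x, w) (0, 1, 0)))" "Uu = snd (snd (L (t, x, w) (0, 0, 1)))"
    note U = this
    define h2 h3 where "h2 = H2 (U (t, x, w))" "h3 = H3 (U (t, x, w))"
    note h = this
    have A: "h2 * Ux = exp w * deriv r2 x" "h2 * Uu = exp w * r2 x"
      "h3 * Ux = exp (w * w) * deriv r3 x" "h3 * Uu = exp (w * w) * (2 * w) * r3 x"
      using d2(2,3)[OF zw] d3[OF zw] unfolding U h e2 e3 by auto
    have "(h3 * Ux) * (h2 * Uu) = (h3 * Uu) * (h2 * Ux)" by simp
    then have "exp (w * w) * exp w * (deriv r3 x * r2 x) = exp (w * w) * exp w * (2 * w * (deriv r2 x * r3 x))"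
      unfolding A by (simp only: mult_ac)
    then show ?thesis by simp
  qed
  \<comment> \<open>The left side of \<open>key\<close> does not depend on \<open>w\<close>, so two
    values of \<open>w\<close> force the derivative of \<open>r2\<close> to vanish.\<close>
  obtain w w' where w: "w \<in> Iu" "w' \<in> Iu" "w \<noteq> w'" using two_points[OF Iu] by blast
  have "2 * w * (deriv r2 x * r3 x) = 2 * w' * (deriv r2 x * r3 x)" using key[OF w(1)] key[OF w(2)] by linarith
  then have "deriv r2 x = 0" using w(3) r3[OF m(2)] by auto
  then show "snd (snd (L (t, x, u) (0, 1, 0))) = 0" using d2(2)[OF z] H2nz[OF z] by simp
qed

lemma Uf: 
  assumes z: "(t, x, u) \<in> B"
  shows "U (t, x, u) = Uf u"
proof -
  have m: "t \<in> It" "x \<in> Ix" "u \<in> Iu" using z by auto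
  have "U (t, x, u) = U (ts, x, u)"
  proof (rule DERIV_zero_const[OF It _ m(1) base_point(1)])
    fix y assume "y \<in> It"
    then have z: "(y, x, u) \<in> B" using m by simp
    show "DERIV (\<lambda>y. U (y, x, u)) y :> 0" using partials_U(1)[OF z] U_depends_on_u(1)[OF z] by simp
  qed
  also have "\<dots> = U (ts, xs, u)"
  proof (rule DERIV_zero_const[OF Ix _ m(2) base_point(2)])
    fix y assume "y \<in> Ix"
    then have z: "(ts, y, u) \<in> B" using m base_point by simp
    show "DERIV (\<lambda>y. U (ts, y, u)) y :> 0" using partials_U(2)[OF z] U_depends_on_u(2)[OF z] by simp
  qed
  finally show ?thesis by (simp add: Uf_def)
qed

lemma deriv_Uf_nz:
  assumes u: "u \<in> Iu"
  shows "deriv Uf u \<noteq> 0"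
proof -
  have z: "(ts, xs, u) \<in> B" using u base_point by simp
  have "deriv Uf u = snd (snd (L (ts, xs, u) (0, 0, 1)))"
    using partials_U(3)[OF z] unfolding Uf_def[symmetric] by (rule DERIV_imp_deriv)
  then show ?thesis using form(3)[OF z] by simp
qed

text \<open>A nonzero \<open>U\<^sub>u\<^sub>u\<close> would bring a term with \<open>u\<^sub>t\<^sup>2\<close> into the equation.\<close>

lemma deriv2_Uf:
  assumes u0: "u0 \<in> Iu"
  shows "deriv (deriv Uf) u0 = 0"
proof -
  have z: "(ts, xs, u0) \<in> B" using u0 base_point by simp
  let ?z = "(ts, xs, u0)" and ?\<theta> = "probe (\<lambda>_. 1) (\<lambda>_. 1)"
  have l1: "L ?z (1, 0, 1) = L ?z (1, 0, 0) + L ?z (0, 0, 1)"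
    using linear_add[OF L_linear[OF z], of "(1, 0, 0)" "(0, 0, 1)"] by simp
  have det: "fst (L ?z (1, 0, 1)) * fst (snd (L ?z (0, 1, 0))) - fst (L ?z (0, 1, 0)) * fst (snd (L ?z (1, 0, 1))) \<noteq> 0"
    unfolding l1 using form(1,2)[OF z] no_exchange[OF z] separated[OF z] by simp
  \<comment> \<open>The jet u_t = 1, u_x = u_tt = u_xx = 0 solves the equation with f = g = H = 1.
    Its transform has v_x = v_xx = 0, hence v_tt = 0, and v_tt is U_uu u_t^2 up to a nonzero
    factor.\<close>
  obtain V W u v where "jet_pair B \<phi> ts xs u0 1 0 0 0 V W u v"
    by (rule jet_pair_exists[OF oB smooth z L_def bij[OF z] det])
  then have A: "open V" "open W" "C_k_on 2 V u" "C_k_on 2 W v"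
      "graph_over V u \<subseteq> B" "\<phi> ` graph_over V u = graph_over W v" "(ts, xs) \<in> V" "u (ts, xs) = u0"
      "D_t u (ts, xs) = 1" "D_x u (ts, xs) = 0" "D_t (D_t u) (ts, xs) = 0" "D_x (D_x u) (ts, xs) = 0"
    unfolding jet_pair_def by - (elim conjE; assumption)+
  have dT: "deriv Tf ts \<noteq> 0" by (rule deriv_Tf_nz[OF base_point(1)])
  let ?d2 = "Tf ts - deriv Tf ts * ts"
  have \<phi>: "\<phi> (s, y, w) = (deriv Tf ts * s + ?d2, Xf y, Uf w)" if "(s, y, w) \<in> B" for s y w
    using Tf[OF that] Xf[OF that] Uf[OF that] Tf_affine[of s] that by (auto simp: prod_eq_iff)
  note box = graph_subset_boxD[OF A(5)]
  have vu: "(deriv Tf ts * s + ?d2, Xf y) \<in> W \<and> v (deriv Tf ts * s + ?d2, Xf y) = Uf (u (s, y))" if sy: "(s, y) \<in> V" for s y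
  proof -
    obtain a b where ab: "(a, b) \<in> W" "\<phi> (s, y, u (s, y)) = (a, b, v (a, b))"
      using graph_image_eqD[OF A(6) sy] by blast
    then show ?thesis using \<phi>[of s y "u (s, y)"] box[OF sy] by auto
  qed
  have dX: "DERIV Xf y :> deriv Xf y" if "(s, y) \<in> V" for s y
    using smooth_on_DERIV[OF smooth_Xf oIx] box[OF that] by blast
  have dX2: "DERIV (deriv Xf) xs :> deriv (deriv Xf) xs"
    by (rule smooth_on_DERIV[OF smooth_on_deriv[OF smooth_Xf oIx] oIx base_point(2)])
  have dU: "DERIV Uf (u (s, y)) :> deriv Uf (u (s, y))" if "(s, y) \<in> V" for s y
    using smooth_on_DERIV[OF smooth_Uf oIu] box[OF that] by blast
  have dU2: "DERIV (deriv Uf) (u (ts, xs)) :> deriv (deriv Uf) u0"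
    unfolding A(8) by (rule smooth_on_DERIV[OF smooth_on_deriv[OF smooth_Uf oIu] oIu u0])
  note jets = separated_jets[OF A(1-4,7) vu dX dX2 dU dU2, unfolded A(8-12)]
  let ?q = "(deriv Tf ts * ts + ?d2, Xf xs)"
  have q: "\<phi> (fst (ts, xs), snd (ts, xs), u (ts, xs)) = (fst ?q, snd ?q, v ?q)"
    using \<phi>[of ts xs u0] z vu[OF A(7)] A(8) by simp
  have vq: "v ?q = U ?z" using vu[OF A(7)] Uf[OF z] A(8) by simp
  have Xq: "Xf xs = X ?z" using Xf[OF z] by simp
  have D0: "deriv (\<lambda>_. 1::real) y = 0" for y :: real by (rule DERIV_imp_deriv) simp
  have hyp: "open V \<and> open W \<and> C_k_on 2 V u \<and> C_k_on 2 W v \<and> graph_over V u \<subseteq> B \<and> \<phi> ` graph_over V u = graph_over W v"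
    using A by blast
  have "jet_eq ?\<theta> xs u0 0 0 0" by (simp add: jet_eq_def)
  moreover have "satisfies_at ?\<theta> u (ts, xs) \<longleftrightarrow> jet_eq ?\<theta> xs u0 0 0 0"
    using satisfies_at_iff_jet_eq[OF A(1,3,7), of ?\<theta>] unfolding A(8-12) by (simp add: D0)
  moreover have "satisfies_at ?\<theta> u (ts, xs) \<longleftrightarrow> satisfies_at (\<Psi> ?\<theta>) v ?q"
    by (rule map[OF probe1, unfolded maps_equation_def, rule_format, OF hyp A(7) conjunct1[OF vu[OF A(7)]] q])
  moreover note c = arb_classD[OF cls[OF probe1]]
  have g: "DERIV (el_g (\<Psi> ?\<theta>)) (Xf xs) :> deriv (el_g (\<Psi> ?\<theta>)) (Xf xs)"
    unfolding Xq by (rule smooth_on_DERIV[OF c(2) ranges(1) in_ranges(1)[OF z]])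
  have H: "DERIV (el_H (\<Psi> ?\<theta>)) (v ?q) :> deriv (el_H (\<Psi> ?\<theta>)) (v ?q)"
    unfolding vq by (rule smooth_on_DERIV[OF c(4) ranges(2) in_ranges(2)[OF z]])
  have "satisfies_at (\<Psi> ?\<theta>) v ?q \<longleftrightarrow>
      jet_eq (\<Psi> ?\<theta>) (Xf xs) (v ?q) (D_x v ?q) (D_t (D_t v) ?q) (D_x (D_x v) ?q)"
    by (rule satisfies_at_iff_jet_eq[OF A(2,4) conjunct1[OF vu[OF A(7)]] g H])
  ultimately have "jet_eq (\<Psi> ?\<theta>) (Xf xs) (v ?q) (D_x v ?q) (D_t (D_t v) ?q) (D_x (D_x v) ?q)"
    by blast
  moreover have x1: "D_x v ?q = 0" using jets(2) deriv_Xf_nz[OF base_point(2)] by simp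
  moreover have "D_x (D_x v) ?q = 0" using jets(4) x1 deriv_Xf_nz[OF base_point(2)] by simp
  ultimately have "el_f (\<Psi> ?\<theta>) (X ?z) * D_t (D_t v) ?q = 0" unfolding Xq by (simp add: jet_eq_def)
  then have "D_t (D_t v) ?q = 0" using c(6)[OF in_ranges(1)[OF z]] by simp
  then show ?thesis using jets(3) by simp
qed

lemma listed: "\<exists>\<delta>1 \<delta>2 \<delta>3 \<delta>4. listed_point_map It Ix Iu \<delta>1 \<delta>2 \<delta>3 \<delta>4 Xf \<phi>"
proof -
  have U1: "deriv Uf u = deriv Uf us" if "u \<in> Iu" for u
  proof (rule DERIV_zero_const[OF Iu _ that base_point(3)])
    fix r assume r: "r \<in> Iu"
    show "DERIV (deriv Uf) r :> 0"
      using smooth_on_DERIV[OF smooth_on_deriv[OF smooth_Uf oIu] oIu r] unfolding deriv2_Uf[OF r] .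
  qed
  have Ua: "Uf u = deriv Uf us * u + (Uf us - deriv Uf us * us)" if u: "u \<in> Iu" for u
  proof -
    have "Uf u - deriv Uf us * u = Uf us - deriv Uf us * us"
    proof (rule DERIV_zero_const[OF Iu _ u base_point(3)])
      fix r assume r: "r \<in> Iu"
      show "DERIV (\<lambda>u. Uf u - deriv Uf us * u) r :> 0"
        by (rule derivative_eq_intros smooth_on_DERIV[OF smooth_Uf oIu r] refl)+ (simp add: U1[OF r])
    qed
    then show ?thesis by simp
  qed
  have "\<phi> (t, x, u) = (deriv Tf ts * t + (Tf ts - deriv Tf ts * ts), Xf x, deriv Uf us * u + (Uf us - deriv Uf us * us))"
    if "t \<in> It" "x \<in> Ix" "u \<in> Iu" for t x u
    using Tf[of t x u] Xf[of t x u] Uf[of t x u] Tf_affine[OF that(1)] Ua[OF that(3)] that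
    by (auto simp: prod_eq_iff)
  then have "listed_point_map It Ix Iu (deriv Tf ts) (Tf ts - deriv Tf ts * ts) (deriv Uf us)
      (Uf us - deriv Uf us * us) Xf \<phi>"
    unfolding listed_point_map_def
    using deriv_Tf_nz[OF base_point(1)] deriv_Uf_nz[OF base_point(3)] smooth_Xf deriv_Xf_nz by auto
  then show ?thesis by blast
qed

end

subsection \<open>The form of the arbitrary elements\<close>

text \<open>What the coefficient of u_x still demands once the leading coefficients are matched;
  \<open>l\<close> is the factor between the two equations.\<close>

definition reduced :: "real set \<Rightarrow> real set \<Rightarrow> (real \<Rightarrow> real) \<Rightarrow> (real \<Rightarrow> real) \<Rightarrow> (real \<Rightarrow> real) \<Rightarrow>
    (real \<Rightarrow> real) \<Rightarrow> (real \<Rightarrow> real) \<Rightarrow> (real \<Rightarrow> real) \<Rightarrow> (real \<Rightarrow> real) \<Rightarrow> bool" where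
  "reduced I J g h H K l h1 K1 \<longleftrightarrow>
     (\<forall>x\<in>I. l x \<noteq> 0 \<and> DERIV l x :> deriv l x) \<and>
     (\<forall>x\<in>I. \<forall>u\<in>J. h1 x * K1 u = l x * h x * K u - deriv l x * g x * H u)"

text \<open>The part of the listed formulas that concerns \<open>l\<close>, \<open>h\<close> and
  \<open>K\<close>. \<epsilon>2 does not occur, as it is fixed by the leading coefficients
  alone.\<close>

definition listed_form :: "real \<Rightarrow> real set \<Rightarrow> real set \<Rightarrow> (real \<Rightarrow> real) \<Rightarrow> (real \<Rightarrow> real) \<Rightarrow> (real \<Rightarrow> real) \<Rightarrow>
    (real \<Rightarrow> real) \<Rightarrow> (real \<Rightarrow> real) \<Rightarrow> (real \<Rightarrow> real) \<Rightarrow> (real \<Rightarrow> real) \<Rightarrow> bool" where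
  "listed_form x0 I J g h H K l h1 K1 \<longleftrightarrow>
     (\<exists>\<epsilon>1 \<epsilon>3 \<epsilon>4. \<epsilon>1 \<noteq> 0 \<and> \<epsilon>3 \<noteq> 0 \<and>
       (\<forall>x\<in>I. l x = \<epsilon>1 * exp (- \<epsilon>4 * antiderivative x0 (\<lambda>y. h y / g y) x) \<and> h1 x = l x * h x / \<epsilon>3) \<and>
       (\<forall>u\<in>J. K1 u = \<epsilon>3 * (K u + \<epsilon>4 * H u)))"

lemma antiderivative_eqI:
  assumes I: "open_interval I" "x0 \<in> I" "x \<in> I" and k: "continuous_on I k"
    and F: "\<And>x. x \<in> I \<Longrightarrow> DERIV F x :> k x" "F x0 = 0"
  shows "antiderivative x0 k x = F x"
proof -
  have "antiderivative x0 k x - F x = antiderivative x0 k x0 - F x0"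
  proof (rule DERIV_zero_const[OF I(1) _ I(3,2)])
    fix r assume r: "r \<in> I"
    show "DERIV (\<lambda>x. antiderivative x0 k x - F x) r :> 0"
      using DERIV_diff[OF DERIV_antiderivative[OF I(1,2) k r] F(1)[OF r]] by simp
  qed
  then show ?thesis using F(2) by simp
qed

lemma antiderivative_nonzero:
  assumes I: "open_interval I" "x0 \<in> I" and k: "continuous_on I k" and x: "x \<in> I" "k x \<noteq> 0"
  obtains y where "y \<in> I" "antiderivative x0 k y \<noteq> 0"
proof (rule ccontr)
  assume "\<not> thesis"
  then have 0: "antiderivative x0 k y = 0" if "y \<in> I" for y using that \<open>\<And>y. y \<in> I \<Longrightarrow> antiderivative x0 k y \<noteq> 0 \<Longrightarrow> thesis\<close> by blast
  have "k x = 0"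
    by (rule DERIV_unique_on[OF DERIV_antiderivative[OF I k x(1)] DERIV_const open_intervalD(1)[OF I(1)] x(1) 0])
  then show False using x(2) by simp
qed

text \<open>The integrating factor exp (e A), with \<open>A\<close> the antiderivative, makes the
  product with \<open>l\<close> constant.\<close>

lemma exp_antiderivative_unique:
  assumes I: "open_interval I" "x0 \<in> I" and k: "continuous_on I k"
    and l: "\<And>x. x \<in> I \<Longrightarrow> DERIV l x :> - e * k x * l x" and x: "x \<in> I"
  shows "l x = l x0 * exp (- e * antiderivative x0 k x)"
proof -
  have "l x * exp (e * antiderivative x0 k x) = l x0 * exp (e * antiderivative x0 k x0)"
  proof (rule DERIV_zero_const[OF I(1) _ x I(2)])
    fix r assume r: "r \<in> I"
    show "DERIV (\<lambda>x. l x * exp (e * antiderivative x0 k x)) r :> 0"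
      by (rule derivative_eq_intros l[OF r] DERIV_antiderivative[OF I k r] refl)+ (simp add: algebra_simps)
  qed
  then have "l x * (exp (e * antiderivative x0 k x) * exp (- e * antiderivative x0 k x)) =
      l x0 * exp (- e * antiderivative x0 k x)" by simp
  then show ?thesis by (simp add: exp_add[symmetric])
qed

text \<open>Separation of variables. At a point \<open>xa\<close> with h1 xa nonzero, the relation
  expresses \<open>K1\<close> as \<alpha> K + \<beta> H. Since \<open>K\<close> is no multiple of
  \<open>H\<close>, comparing coefficients at every \<open>x\<close> gives h1 \<alpha> = l h and h1
  \<beta> = - l_x g, hence l_x = - (\<beta> / \<alpha>) (h / g) l. So \<epsilon>3 = \<alpha> and
  \<epsilon>4 = \<beta> / \<alpha>.\<close>

lemma listed_form_generic:
  assumes I: "open_interval I" "x0 \<in> I" and g: "\<And>x. x \<in> I \<Longrightarrow> g x \<noteq> 0"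
    and k: "continuous_on I (\<lambda>y. h y / g y)" and H: "\<And>u. u \<in> J \<Longrightarrow> H u \<noteq> 0" and J: "J \<noteq> {}"
    and red: "reduced I J g h H K l h1 K1" and x1: "x1 \<in> I" "h x1 \<noteq> 0"
    and np: "\<And>c. \<exists>u\<in>J. K u \<noteq> c * H u"
  shows "listed_form x0 I J g h H K l h1 K1"
proof -
  have l0: "\<And>x. x \<in> I \<Longrightarrow> l x \<noteq> 0" and dl: "\<And>x. x \<in> I \<Longrightarrow> DERIV l x :> deriv l x"
    and eq: "\<And>x u. x \<in> I \<Longrightarrow> u \<in> J \<Longrightarrow> h1 x * K1 u = l x * h x * K u - deriv l x * g x * H u"
    using red by (auto simp: reduced_def)
  \<comment> \<open>If h1 x1 were 0, the relation at \<open>x1\<close> would make \<open>K\<close> a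
    multiple of \<open>H\<close>.\<close>
  obtain xa where xa: "xa \<in> I" "h1 xa \<noteq> 0"
  proof (rule ccontr)
    assume "\<not> thesis"
    then have 0: "h1 x1 = 0" using that x1 by blast
    obtain u where u: "u \<in> J" "K u \<noteq> (deriv l x1 * g x1 / (l x1 * h x1)) * H u" using np by blast
    have "l x1 * h x1 * K u = deriv l x1 * g x1 * H u" using eq[OF x1(1) u(1)] 0 by simp
    then show False using u(2) l0[OF x1(1)] x1(2) by (simp add: field_simps)
  qed
  define \<alpha> \<beta> where "\<alpha> = l xa * h xa / h1 xa" "\<beta> = - deriv l xa * g xa / h1 xa"
  have K1: "K1 u = \<alpha> * K u + \<beta> * H u" if u: "u \<in> J" for u
  proof -
    have "h1 xa * K1 u = h1 xa * (\<alpha> * K u + \<beta> * H u)"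
      unfolding eq[OF xa(1) u] \<open>\<alpha> = _\<close> \<open>\<beta> = _\<close> using xa(2) by (simp add: field_simps)
    then show ?thesis using xa(2) by simp
  qed
  have a: "h1 x * \<alpha> = l x * h x" and b: "h1 x * \<beta> = - deriv l x * g x" if x: "x \<in> I" for x
  proof -
    have E: "(h1 x * \<alpha> - l x * h x) * K u = - (deriv l x * g x + h1 x * \<beta>) * H u" if "u \<in> J" for u
      using eq[OF x that] unfolding K1[OF that] by (simp add: algebra_simps)
    show 1: "h1 x * \<alpha> = l x * h x"
    proof (rule ccontr)
      assume n: "h1 x * \<alpha> \<noteq> l x * h x"
      obtain u where u: "u \<in> J" "K u \<noteq> (- (deriv l x * g x + h1 x * \<beta>) / (h1 x * \<alpha> - l x * h x)) * H u"
        using np by blast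
      then show False using E[OF u(1)] n by (simp add: field_simps)
    qed
    obtain u where u: "u \<in> J" using J by blast
    show "h1 x * \<beta> = - deriv l x * g x" using E[OF u] 1 H[OF u] by auto
  qed
  have \<alpha>: "\<alpha> \<noteq> 0" using a[OF x1(1)] l0[OF x1(1)] x1(2) by auto
  have D: "DERIV l x :> - (\<beta> / \<alpha>) * (h x / g x) * l x" if x: "x \<in> I" for x
  proof -
    have "h1 x = l x * h x / \<alpha>" using a[OF x] \<alpha> by (simp add: field_simps)
    then have "deriv l x * g x = - (\<beta> / \<alpha>) * h x * l x" using b[OF x] by (simp add: mult_ac)
    then have "deriv l x = - (\<beta> / \<alpha>) * h x * l x / g x" using g[OF x] by (metis nonzero_mult_div_cancel_right)
    then have "deriv l x = - (\<beta> / \<alpha>) * (h x / g x) * l x" by simp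
    then show ?thesis using dl[OF x] by simp
  qed
  show ?thesis
    unfolding listed_form_def
  proof (rule exI[of _ "l x0"], rule exI[of _ \<alpha>], rule exI[of _ "\<beta> / \<alpha>"], intro conjI ballI)
    show "l x0 \<noteq> 0" by (rule l0[OF I(2)])
    show "\<alpha> \<noteq> 0" by (rule \<alpha>)
    show "l x = l x0 * exp (- (\<beta> / \<alpha>) * antiderivative x0 (\<lambda>y. h y / g y) x)" if "x \<in> I" for x
      by (rule exp_antiderivative_unique[OF I k D that])
    show "h1 x = l x * h x / \<alpha>" if "x \<in> I" for x using a[OF that] \<alpha> by (simp add: field_simps)
    show "K1 u = \<alpha> * (K u + \<beta> / \<alpha> * H u)" if "u \<in> J" for u using K1[OF that] \<alpha> by (simp add: field_simps)
  qed
qed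

section \<open>Limits of listed forms along families\<close>

lemma eq_at_limit:
  fixes F G :: "real \<Rightarrow> real"
  assumes "isCont F 0" "isCont G 0" "\<And>s. s \<noteq> 0 \<Longrightarrow> F s = G s"
  shows "F 0 = G 0"
proof -
  have "(F \<longlongrightarrow> F 0) (at 0)" "(G \<longlongrightarrow> G 0) (at 0)" using assms by (auto simp: isCont_def)
  moreover have "(F \<longlongrightarrow> G 0) (at 0) \<longleftrightarrow> (G \<longlongrightarrow> G 0) (at 0)"
    by (rule tendsto_cong) (auto simp: eventually_at_filter assms(3))
  ultimately show ?thesis using tendsto_unique[of "at (0::real)" F] by auto
qed

lemma positive_at_limit:
  fixes F :: "real \<Rightarrow> real"
  assumes "isCont F 0" "\<And>s. s \<noteq> 0 \<Longrightarrow> F s > 0" "F 0 \<noteq> 0"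
  shows "F 0 > 0"
proof -
  have "F 0 \<ge> 0"
    by (rule tendsto_lowerbound[of F "F 0" "at 0"])
      (use assms in \<open>auto simp: isCont_def eventually_at_filter less_imp_le\<close>)
  then show ?thesis using assms(3) by simp
qed

text \<open>If \<open>K = c H\<close>, the equation does not determine the new elements.  Here \<open>K\<close> is deformed to
  \<open>K + s \<kappa> H\<close>, for which the new elements are determined when \<open>s \<noteq> 0\<close>; \<open>\<eta>\<close> is the limit of
  \<open>1 / \<epsilon>3\<close> and \<open>e\<close> is the limit of \<open>\<epsilon>4\<close> as \<open>s\<close> tends to \<open>0\<close>.\<close>

lemma proportional_limit:
  fixes l h1 K1 :: "real \<Rightarrow> real \<Rightarrow> real"
  assumes I: "open_interval I" "x0 \<in> I" and g: "\<And>x. x \<in> I \<Longrightarrow> g x \<noteq> 0"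
    and k: "continuous_on I (\<lambda>y. h y / g y)" and H: "\<And>u. u \<in> J \<Longrightarrow> H u \<noteq> 0"
    and x1: "x1 \<in> I" "h x1 \<noteq> 0" and u0: "u0 \<in> J"
    and l0: "\<And>s x. x \<in> I \<Longrightarrow> l s x \<noteq> 0"
    and l: "\<And>x. x \<in> I \<Longrightarrow> DERIV (\<lambda>s. l s x) 0 :> dl x" and h1: "DERIV (\<lambda>s. h1 s x1) 0 :> dh1"
    and h1c: "\<And>x. x \<in> I \<Longrightarrow> isCont (\<lambda>s. h1 s x) 0"
    and K1: "\<And>u. u \<in> J \<Longrightarrow> DERIV (\<lambda>s. K1 s u) 0 :> dK1 u"
    and listed: "\<And>s. s \<noteq> 0 \<Longrightarrow> listed_form x0 I J g h H (\<lambda>u. c * H u + s * (\<kappa> u * H u)) (l s) (h1 s) (K1 s)"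
  obtains \<eta> e where "\<And>x. x \<in> I \<Longrightarrow> l 0 x = l 0 x0 * exp (- e * antiderivative x0 (\<lambda>y. h y / g y) x)"
    "\<And>x. x \<in> I \<Longrightarrow> h1 0 x = l 0 x * h x * \<eta>" "\<And>u. u \<in> J \<Longrightarrow> K1 0 u * \<eta> = (c + e) * H u"
    "\<eta> = 0 \<Longrightarrow> \<exists>D. \<forall>u\<in>J. \<forall>u'\<in>J. (K1 0 u / H u - K1 0 u' / H u') * D = \<kappa> u - \<kappa> u'"
proof -
  let ?A = "antiderivative x0 (\<lambda>y. h y / g y)"
  have "h x1 / g x1 \<noteq> 0" using x1 g by simp
  then obtain x2 where x2: "x2 \<in> I" "?A x2 \<noteq> 0" using antiderivative_nonzero[OF I k x1(1)] by blast
  \<comment> \<open>The constants 1 / \<epsilon>3 and \<epsilon>4 of the listed form at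
    \<open>s\<close> are recovered from values of \<open>l s\<close> and \<open>h1 s\<close>: \<eta>
    at \<open>x1\<close>, where \<open>h\<close> is nonzero, and \<open>e\<close> at
    \<open>x2\<close>, where the antiderivative is nonzero. Written so, they make sense at s = 0 and
    are continuous there.\<close>
  define \<eta> where "\<eta> s = h1 s x1 / (l s x1 * h x1)" for s
  define r where "r s = l s x2 / l s x0" for s
  define e where "e s = - ln (r s) / ?A x2" for s
  have lc: "isCont (\<lambda>s. l s x) 0" if "x \<in> I" for x using l[OF that] DERIV_isCont by blast
  have K1c: "isCont (\<lambda>s. K1 s u) 0" if "u \<in> J" for u using K1[OF that] DERIV_isCont by blast
  have form: "l s x = l s x0 * exp (- e s * ?A x)" "h1 s x = l s x * h x * \<eta> s"
    "K1 s u * \<eta> s = c * H u + s * (\<kappa> u * H u) + e s * H u" "r s > 0"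
    if s: "s \<noteq> 0" and x: "x \<in> I" and u: "u \<in> J" for s x u
  proof -
    obtain \<epsilon>1 \<epsilon>3 \<epsilon>4 where e: "\<epsilon>1 \<noteq> 0" "\<epsilon>3 \<noteq> 0" and
      ex: "\<And>x. x \<in> I \<Longrightarrow> l s x = \<epsilon>1 * exp (- \<epsilon>4 * ?A x) \<and> h1 s x = l s x * h x / \<epsilon>3" and
      eu: "\<And>u. u \<in> J \<Longrightarrow> K1 s u = \<epsilon>3 * (c * H u + s * (\<kappa> u * H u) + \<epsilon>4 * H u)"
      using listed[OF s] unfolding listed_form_def by blast
    have l00: "l s x0 = \<epsilon>1" using ex[OF I(2)] by simp
    have rs: "r s = exp (- \<epsilon>4 * ?A x2)" using ex[OF x2(1)] e unfolding r_def l00 by simp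
    have es: "e s = \<epsilon>4" using x2(2) unfolding e_def rs by simp
    have \<eta>s: "\<eta> s = 1 / \<epsilon>3"
      using ex[OF x1(1)] l0[OF x1(1), of s] x1(2) unfolding \<eta>_def by (simp add: field_simps)
    show "l s x = l s x0 * exp (- e s * ?A x)" unfolding es l00 using ex[OF x] by simp
    show "h1 s x = l s x * h x * \<eta> s" unfolding \<eta>s using ex[OF x] by simp
    show "K1 s u * \<eta> s = c * H u + s * (\<kappa> u * H u) + e s * H u" unfolding es \<eta>s eu[OF u] using e by simp
    show "r s > 0" unfolding rs by simp
  qed
  have rc: "isCont r 0"
    unfolding r_def[abs_def] by (intro continuous_divide lc x2(1) I(2)) (rule l0[OF I(2)])
  \<comment> \<open>A nonzero limit of positive quotients; this keeps the logarithm in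
    \<open>e\<close> continuous at 0.\<close>
  have r0: "r 0 > 0"
    by (rule positive_at_limit[OF rc form(4)[OF _ I(2) u0]]) (simp_all add: r_def l0 x2(1) I(2))
  have ec: "isCont e 0"
    unfolding e_def[abs_def] using r0 x2(2)
    by (intro continuous_divide continuous_minus isCont_ln' rc continuous_const) auto
  have hx: "l 0 x1 * h x1 \<noteq> 0" using l0[OF x1(1)] x1(2) by simp
  obtain D where D: "DERIV \<eta> 0 :> D"
    using DERIV_divide[OF h1 DERIV_cmult_right[OF l[OF x1(1)]] hx] unfolding \<eta>_def[abs_def] by blast
  have \<eta>c: "isCont \<eta> 0" using D DERIV_isCont by blast
  show thesis
  proof (rule that)
    show "l 0 x = l 0 x0 * exp (- e 0 * ?A x)" if x: "x \<in> I" for x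
      by (rule eq_at_limit[OF lc[OF x] _ form(1)[OF _ x u0]])
        (intro continuous_mult lc I(2) isCont_exp' continuous_minus ec continuous_const)
    show "h1 0 x = l 0 x * h x * \<eta> 0" if x: "x \<in> I" for x
      by (rule eq_at_limit[OF h1c[OF x] _ form(2)[OF _ x u0]])
        (intro continuous_mult lc[OF x] \<eta>c continuous_const)
    have Klim: "K1 0 u * \<eta> 0 = c * H u + 0 * (\<kappa> u * H u) + e 0 * H u" if u: "u \<in> J" for u
      by (rule eq_at_limit[OF _ _ form(3)[OF _ I(2) u]])
        (intro continuous_mult continuous_add K1c[OF u] \<eta>c ec continuous_const continuous_ident)+
    then show "K1 0 u * \<eta> 0 = (c + e 0) * H u" if u: "u \<in> J" for u
      using that by (simp add: algebra_simps)
    show "\<exists>D. \<forall>u\<in>J. \<forall>u'\<in>J. (K1 0 u / H u - K1 0 u' / H u') * D = \<kappa> u - \<kappa> u'" if \<eta>0: "\<eta> 0 = 0"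
    proof (intro exI ballI)
      fix u u' assume u: "u \<in> J" and u': "u' \<in> J"
      \<comment> \<open>Dividing by \<open>H\<close> and taking differences in \<open>u\<close>
        eliminates \<open>c\<close> and \<open>e s\<close>. Then q \<eta> is linear in
        \<open>s\<close>, and if \<eta> 0 = 0, its derivative at 0 is \<open>q 0\<close> times the
        derivative of \<eta>.\<close>
      define q where "q s = K1 s u / H u - K1 s u' / H u'" for s
      have q: "q s * \<eta> s = s * (\<kappa> u - \<kappa> u')" for s
      proof (cases "s = 0")
        case True
        then show ?thesis using \<eta>0 by simp
      next
        case False
        have "K1 s w * \<eta> s / H w = c + s * \<kappa> w + e s" if "w \<in> J" for w
          unfolding form(3)[OF False I(2) that] using H[OF that] by (simp add: field_simps)
        from this[OF u] this[OF u'] show ?thesis unfolding q_def by (simp add: algebra_simps)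
      qed
      have dq: "DERIV q 0 :> dK1 u / H u - dK1 u' / H u'"
        unfolding q_def[abs_def] by (intro DERIV_diff DERIV_cdivide K1 u u')
      have "(dK1 u / H u - dK1 u' / H u') * \<eta> 0 + D * q 0 = \<kappa> u - \<kappa> u'"
      proof (rule DERIV_unique_on[OF DERIV_mult[OF dq D] _ open_UNIV UNIV_I])
        show "DERIV (\<lambda>s. s * (\<kappa> u - \<kappa> u')) 0 :> \<kappa> u - \<kappa> u'"
          by (auto intro!: derivative_eq_intros)
        show "q s * \<eta> s = s * (\<kappa> u - \<kappa> u')" for s by (rule q)
      qed
      then show "(K1 0 u / H u - K1 0 u' / H u') * D = \<kappa> u - \<kappa> u'"
        using \<eta>0 by (simp add: q_def mult.commute)
    qed
  qed
qed

text \<open>\<eta> and \<eta>' are both the quotient of \<open>h1\<close> by \<open>l h\<close> at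
  \<open>x1\<close>, so they vanish together. Then the increments of K1 / H would be proportional to
  those of \<open>u\<close> and to those of u^2, giving (u + u') D = D' for all distinct
  \<open>u\<close>, \<open>u'\<close>. Three points refute this, so 1 / \<eta> can serve as
  \<epsilon>3.\<close>

lemma listed_form_proportional:
  assumes I: "open_interval I" "x0 \<in> I" and J: "open_interval J" and H: "\<And>u. u \<in> J \<Longrightarrow> H u \<noteq> 0"
    and x1: "x1 \<in> I" "h x1 \<noteq> 0" and l0: "\<And>x. x \<in> I \<Longrightarrow> l x \<noteq> 0"
    and K: "\<And>u. u \<in> J \<Longrightarrow> K u = c * H u"
    and lim: "\<And>x. x \<in> I \<Longrightarrow> l x = l x0 * exp (- e * antiderivative x0 (\<lambda>y. h y / g y) x)"
      "\<And>x. x \<in> I \<Longrightarrow> h1 x = l x * h x * \<eta>" "\<And>u. u \<in> J \<Longrightarrow> K1 u * \<eta> = (c + e) * H u"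
      "\<And>x. x \<in> I \<Longrightarrow> h1 x = l x * h x * \<eta>'"
    and zero: "\<eta> = 0 \<Longrightarrow> \<exists>D. \<forall>u\<in>J. \<forall>u'\<in>J. (K1 u / H u - K1 u' / H u') * D = u - u'"
      "\<eta>' = 0 \<Longrightarrow> \<exists>D. \<forall>u\<in>J. \<forall>u'\<in>J. (K1 u / H u - K1 u' / H u') * D = u * u - u' * u'"
  shows "listed_form x0 I J g h H K l h1 K1"
proof -
  have \<eta>: "\<eta> \<noteq> 0"
  proof
    assume 0: "\<eta> = 0"
    then have "\<eta>' = 0" using lim(2,4)[OF x1(1)] l0[OF x1(1)] x1(2) by simp
    obtain D where D: "\<And>u u'. u \<in> J \<Longrightarrow> u' \<in> J \<Longrightarrow> (K1 u / H u - K1 u' / H u') * D = u - u'"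
      using zero(1)[OF 0] by blast
    obtain D' where D': "\<And>u u'. u \<in> J \<Longrightarrow> u' \<in> J \<Longrightarrow> (K1 u / H u - K1 u' / H u') * D' = u * u - u' * u'"
      using zero(2)[OF \<open>\<eta>' = 0\<close>] by blast
    have sum: "(u + u') * D = D'" if u: "u \<in> J" "u' \<in> J" "u \<noteq> u'" for u u'
    proof -
      have "(u - u') * D' = (u * u - u' * u') * D"
        unfolding D[OF u(1,2), symmetric] D'[OF u(1,2), symmetric] by simp
      then have "(u - u') * (D' - (u + u') * D) = 0" by (simp add: algebra_simps)
      then show ?thesis using u(3) by simp
    qed
    obtain w1 w2 where w: "w1 \<in> J" "w2 \<in> J" "w1 \<noteq> w2" using two_points[OF J] by blast
    \<comment> \<open>A third point, to be paired with \<open>w1\<close> and with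
      \<open>w2\<close>.\<close>
    obtain a b where ab: "a < w1" "a < w2" "w1 < b" "{a..b} \<subseteq> J" using interval_between[OF J w(1,2)] by blast
    then have a: "a \<in> J" by (intro subsetD[of "{a..b}" J]) auto
    have "(a + w1) * D = (a + w2) * D" using sum[OF a w(1)] sum[OF a w(2)] ab by simp
    then have "(w1 - w2) * D = 0" by (simp add: algebra_simps)
    then have "D = 0" using w(3) by simp
    then show False using D[OF w(1,2)] w(3) by simp
  qed
  show ?thesis
    unfolding listed_form_def
  proof (rule exI[of _ "l x0"], rule exI[of _ "1 / \<eta>"], rule exI[of _ e], intro conjI ballI)
    show "l x0 \<noteq> 0" by (rule l0[OF I(2)])
    show "1 / \<eta> \<noteq> 0" using \<eta> by simp
    show "l x = l x0 * exp (- e * antiderivative x0 (\<lambda>y. h y / g y) x)" if "x \<in> I" for x by (rule lim(1)[OF that])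
    show "h1 x = l x * h x / (1 / \<eta>)" if "x \<in> I" for x using lim(2)[OF that] by simp
    show "K1 u = 1 / \<eta> * (K u + e * H u)" if "u \<in> J" for u
      using lim(3)[OF that] K[OF that] \<eta> by (simp add: field_simps)
  qed
qed

text \<open>If \<open>h = 0\<close>, then \<open>h\<close> is deformed to \<open>s m g\<close>, where \<open>M\<close> is the antiderivative of \<open>m\<close>.\<close>

lemma zero_limit:
  fixes l h1 :: "real \<Rightarrow> real \<Rightarrow> real"
  assumes I: "open_interval I" "x0 \<in> I" and g: "\<And>x. x \<in> I \<Longrightarrow> g x \<noteq> 0"
    and m: "continuous_on I m" "\<And>x. x \<in> I \<Longrightarrow> DERIV M x :> m x" "M x0 = 0"
    and l0: "\<And>s x. x \<in> I \<Longrightarrow> l s x \<noteq> 0"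
    and lc: "\<And>x. x \<in> I \<Longrightarrow> isCont (\<lambda>s. l s x) 0" and h1c: "\<And>x. x \<in> I \<Longrightarrow> isCont (\<lambda>s. h1 s x) 0"
    and listed: "\<And>s. s \<noteq> 0 \<Longrightarrow> listed_form x0 I J g (\<lambda>x. s * (m x * g x)) H K (l s) (h1 s) (K1 s)"
    and x: "x \<in> I" and y: "y \<in> I"
  shows "l 0 x / l 0 x0 > 0" "ln (l 0 x / l 0 x0) * M y = ln (l 0 y / l 0 x0) * M x"
    "h1 0 x * (l 0 y * m y * g y) = h1 0 y * (l 0 x * m x * g x)"
proof -
  have A: "antiderivative x0 (\<lambda>y. s * (m y * g y) / g y) z = s * M z" if z: "z \<in> I" for s z
  proof (rule antiderivative_eqI[OF I z])
    have "continuous_on I (\<lambda>y. s * m y)" by (intro continuous_on_mult continuous_on_const m)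
    then show "continuous_on I (\<lambda>y. s * (m y * g y) / g y)" by (rule continuous_on_eq) (use g in simp)
    show "DERIV (\<lambda>z. s * M z) r :> s * (m r * g r) / g r" if "r \<in> I" for r
      using DERIV_cmult[OF m(2)[OF that], of s] g[OF that] by simp
    show "s * M x0 = 0" using m(3) by simp
  qed
  \<comment> \<open>\<epsilon>4 and 1 / \<epsilon>3 appear here only multiplied by \<open>s\<close>,
    and may be unbounded as \<open>s\<close> tends to 0. The limit is therefore taken in relations
    between two points, from which both have been eliminated.\<close>
  have form: "\<exists>e \<eta>. \<forall>z\<in>I. l s z / l s x0 = exp (- e * (s * M z)) \<and> h1 s z = l s z * (s * (m z * g z)) * \<eta>"
    if s: "s \<noteq> 0" for s
  proof -
    obtain \<epsilon>1 \<epsilon>3 \<epsilon>4 where e: "\<epsilon>1 \<noteq> 0" "\<epsilon>3 \<noteq> 0" and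
      ex: "\<And>x. x \<in> I \<Longrightarrow> l s x = \<epsilon>1 * exp (- \<epsilon>4 * antiderivative x0 (\<lambda>y. s * (m y * g y) / g y) x) \<and>
        h1 s x = l s x * (s * (m x * g x)) / \<epsilon>3"
      using listed[OF s] unfolding listed_form_def by blast
    have "l s x0 = \<epsilon>1" using ex[OF I(2)] by simp
    then have "\<forall>z\<in>I. l s z / l s x0 = exp (- \<epsilon>4 * (s * M z)) \<and> h1 s z = l s z * (s * (m z * g z)) * (1 / \<epsilon>3)"
      using ex A e by simp
    then show ?thesis by blast
  qed
  have rc: "isCont (\<lambda>s. l s z / l s x0) 0" if "z \<in> I" for z
    by (intro continuous_divide lc that I(2)) (rule l0[OF I(2)])
  have pos: "l 0 z / l 0 x0 > 0" if z: "z \<in> I" for z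
  proof (rule positive_at_limit[OF rc[OF z]])
    show "l s z / l s x0 > 0" if "s \<noteq> 0" for s
      using form[OF that] z by (metis exp_gt_zero)
    show "l 0 z / l 0 x0 \<noteq> 0" using l0 z I(2) by simp
  qed
  show "l 0 x / l 0 x0 > 0" by (rule pos[OF x])
  have lnc: "isCont (\<lambda>s. ln (l s z / l s x0)) 0" if "z \<in> I" for z
    using pos[OF that] by (intro isCont_ln' rc[OF that]) auto
  show "ln (l 0 x / l 0 x0) * M y = ln (l 0 y / l 0 x0) * M x"
  proof (rule eq_at_limit)
    show "isCont (\<lambda>s. ln (l s x / l s x0) * M y) 0" "isCont (\<lambda>s. ln (l s y / l s x0) * M x) 0"
      by (intro continuous_mult lnc x y continuous_const)+
    show "ln (l s x / l s x0) * M y = ln (l s y / l s x0) * M x" if s: "s \<noteq> 0" for s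
    proof -
      obtain e \<eta> where "\<forall>z\<in>I. l s z / l s x0 = exp (- e * (s * M z)) \<and> h1 s z = l s z * (s * (m z * g z)) * \<eta>"
        using form[OF s] by blast
      then have "ln (l s z / l s x0) = - e * (s * M z)" if "z \<in> I" for z using that by simp
      then show ?thesis using x y by simp
    qed
  qed
  show "h1 0 x * (l 0 y * m y * g y) = h1 0 y * (l 0 x * m x * g x)"
  proof (rule eq_at_limit)
    show "isCont (\<lambda>s. h1 s x * (l s y * m y * g y)) 0" "isCont (\<lambda>s. h1 s y * (l s x * m x * g x)) 0"
      by (intro continuous_mult h1c lc x y continuous_const)+
    show "h1 s x * (l s y * m y * g y) = h1 s y * (l s x * m x * g x)" if s: "s \<noteq> 0" for s
    proof -
      obtain e \<eta> where "\<forall>z\<in>I. l s z / l s x0 = exp (- e * (s * M z)) \<and> h1 s z = l s z * (s * (m z * g z)) * \<eta>"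
        using form[OF s] by blast
      then have "h1 s x = l s x * (s * (m x * g x)) * \<eta>" "h1 s y = l s y * (s * (m y * g y)) * \<eta>" using x y by blast+
      then show ?thesis by (simp only: mult_ac)
    qed
  qed
qed

text \<open>The two deformations share their limit. So ln (l / l x0) is proportional to x - x0 and
  also to (x - x0)^2, and \<open>h1\<close> is proportional to l g and also to 2 (x - x0) l g.
  Comparison with a point \<open>a\<close> different from \<open>x0\<close> and \<open>x\<close>
  leaves only zero.\<close>

lemma zero_limit_consequences:
  fixes l h1 :: "real \<Rightarrow> real"
  assumes I: "open_interval I" "x0 \<in> I" and g: "\<And>x. x \<in> I \<Longrightarrow> g x \<noteq> 0" and l0: "\<And>x. x \<in> I \<Longrightarrow> l x \<noteq> 0"
    and pos: "\<And>x. x \<in> I \<Longrightarrow> l x / l x0 > 0"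
    and ln1: "\<And>x y. x \<in> I \<Longrightarrow> y \<in> I \<Longrightarrow> ln (l x / l x0) * (y - x0) = ln (l y / l x0) * (x - x0)"
    and ln2: "\<And>x y. x \<in> I \<Longrightarrow> y \<in> I \<Longrightarrow> ln (l x / l x0) * (y - x0)\<^sup>2 = ln (l y / l x0) * (x - x0)\<^sup>2"
    and h1: "\<And>x y. x \<in> I \<Longrightarrow> y \<in> I \<Longrightarrow> h1 x * (l y * 1 * g y) = h1 y * (l x * 1 * g x)"
    and h2: "\<And>x y. x \<in> I \<Longrightarrow> y \<in> I \<Longrightarrow> h1 x * (l y * (2 * (y - x0)) * g y) = h1 y * (l x * (2 * (x - x0)) * g x)"
    and x: "x \<in> I"
  shows "l x = l x0" "h1 x = 0"
proof -
  obtain a b where ab: "a < x0" "a < x" "{a..b} \<subseteq> I" "x0 < b" using interval_between[OF I(1,2) x] by blast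
  then have y: "a \<in> I" by (intro subsetD[of "{a..b}" I]) auto
  define L where "L z = ln (l z / l x0)" for z
  have "L x * (a - x0) * (a - x0) = L x * (a - x0)\<^sup>2" by (simp add: power2_eq_square)
  also have "\<dots> = L a * (x - x0) * (x - x0)" using ln2[OF x y] unfolding L_def by (simp add: power2_eq_square)
  also have "\<dots> = L x * (a - x0) * (x - x0)" using ln1[OF x y] unfolding L_def by simp
  finally have "L x * (a - x0) * (a - x) = 0" by (simp add: algebra_simps)
  then have "L x = 0" using ab by simp
  then have "l x / l x0 = 1" using pos[OF x] unfolding L_def by simp
  then show "l x = l x0" using l0[OF I(2)] by simp
  have "2 * (h1 x * (l a * g a) * (a - x0)) = 2 * (h1 a * (l x * g x) * (x - x0))"
    using h2[OF x y] by (simp only: mult_ac)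
  then have "h1 x * (l a * g a) * (a - x0) = h1 a * (l x * g x) * (x - x0)" by linarith
  also have "\<dots> = h1 x * (l a * g a) * (x - x0)" using h1[OF x y] by simp
  finally have "h1 x * (l a * g a) * (a - x) = 0" by (simp add: algebra_simps)
  then show "h1 x = 0" using ab l0[OF y] g[OF y] by simp
qed

text \<open>With \<open>l\<close> constant and h1 = 0 in the limit, it remains to write
  \<open>K1\<close> as \<alpha> (K + \<epsilon> H) with \<alpha> nonzero. If \<open>K\<close> is a
  multiple of \<open>H\<close>, so is the limit of \<open>K1\<close>, and \<alpha> = 1 serves.
  Otherwise \<alpha> h1 = s l g at \<open>x0\<close> excludes \<alpha> 0 = 0: the quotient \<alpha>
  / s would have a finite limit while \<open>h1\<close> tends to 0 and \<open>l g\<close> does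
  not.\<close>

lemma listed_form_zero:
  fixes l h1 K1 :: "real \<Rightarrow> real \<Rightarrow> real"
  assumes I: "open_interval I" "x0 \<in> I" and g: "\<And>x. x \<in> I \<Longrightarrow> g x \<noteq> 0" and H: "\<And>u. u \<in> J \<Longrightarrow> H u \<noteq> 0"
    and J: "u0 \<in> J" and h: "\<And>x. x \<in> I \<Longrightarrow> h x = 0"
    and l0: "\<And>s x. x \<in> I \<Longrightarrow> l s x \<noteq> 0" and lx: "\<And>x. x \<in> I \<Longrightarrow> l 0 x = l 0 x0" "\<And>x. x \<in> I \<Longrightarrow> h1 0 x = 0"
    and lc: "\<And>x. x \<in> I \<Longrightarrow> isCont (\<lambda>s. l s x) 0" and h1c: "\<And>x. x \<in> I \<Longrightarrow> isCont (\<lambda>s. h1 s x) 0"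
    and dK1: "\<And>u. u \<in> J \<Longrightarrow> DERIV (\<lambda>s. K1 s u) 0 :> dK1 u"
    and listed: "\<And>s. s \<noteq> 0 \<Longrightarrow> listed_form x0 I J g (\<lambda>x. s * (1 * g x)) H K (l s) (h1 s) (K1 s)"
  shows "listed_form x0 I J g h H K (l 0) (h1 0) (K1 0)"
proof -
  have K1c: "isCont (\<lambda>s. K1 s u) 0" if "u \<in> J" for u using dK1[OF that] DERIV_isCont by blast
  have form: "\<exists>\<alpha> \<epsilon>. \<alpha> \<noteq> 0 \<and> (\<forall>u\<in>J. K1 s u = \<alpha> * (K u + \<epsilon> * H u)) \<and> h1 s x0 = l s x0 * (s * g x0) / \<alpha>"
    if s: "s \<noteq> 0" for s
  proof -
    obtain \<epsilon>1 \<epsilon>3 \<epsilon>4 where e: "\<epsilon>3 \<noteq> 0" and "\<And>x. x \<in> I \<Longrightarrow> h1 s x = l s x * (s * (1 * g x)) / \<epsilon>3"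
      "\<And>u. u \<in> J \<Longrightarrow> K1 s u = \<epsilon>3 * (K u + \<epsilon>4 * H u)"
      using listed[OF s] unfolding listed_form_def by blast
    then show ?thesis using I(2) by (intro exI[of _ \<epsilon>3] exI[of _ \<epsilon>4]) simp
  qed
  have A: "antiderivative x0 (\<lambda>y. h y / g y) x = 0" if x: "x \<in> I" for x
  proof (rule antiderivative_eqI[OF I x, where F = "\<lambda>_. 0"])
    show "continuous_on I (\<lambda>y. h y / g y)"
      by (rule continuous_on_eq[OF continuous_on_const[of I 0]]) (simp add: h)
    show "DERIV (\<lambda>_. 0) z :> h z / g z" if "z \<in> I" for z using h[OF that] by simp
  qed simp
  have goal: "listed_form x0 I J g h H K (l 0) (h1 0) (K1 0)"
    if "\<alpha> \<noteq> 0" "\<And>u. u \<in> J \<Longrightarrow> K1 0 u = \<alpha> * (K u + \<epsilon> * H u)" for \<alpha> \<epsilon> :: real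
    unfolding listed_form_def
    by (rule exI[of _ "l 0 x0"], rule exI[of _ \<alpha>], rule exI[of _ \<epsilon>])
      (use that l0[OF I(2)] lx h A in auto)
  show ?thesis
  proof (cases "\<exists>c. \<forall>u\<in>J. K u = c * H u")
    case True
    then obtain c where c: "\<And>u. u \<in> J \<Longrightarrow> K u = c * H u" by blast
    have ratio: "K1 0 u * H u0 = K1 0 u0 * H u" if u: "u \<in> J" for u
    proof (rule eq_at_limit)
      show "isCont (\<lambda>s. K1 s u * H u0) 0" "isCont (\<lambda>s. K1 s u0 * H u) 0"
        by (intro continuous_mult K1c u J continuous_const)+
      show "K1 s u * H u0 = K1 s u0 * H u" if s: "s \<noteq> 0" for s
      proof -
        obtain \<alpha> \<epsilon> where "\<forall>u\<in>J. K1 s u = \<alpha> * (K u + \<epsilon> * H u)" using form[OF s] by blast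
        then have "K1 s w = \<alpha> * (c + \<epsilon>) * H w" if "w \<in> J" for w using that c by (simp add: algebra_simps)
        then show ?thesis using u J by simp
      qed
    qed
    show ?thesis
    proof (rule goal[of 1])
      show "K1 0 u = 1 * (K u + (K1 0 u0 / H u0 - c) * H u)" if u: "u \<in> J" for u
        using ratio[OF u] c[OF u] H[OF J] by (simp add: field_simps)
    qed simp
  next
    case False
    then obtain u1 where u1: "u1 \<in> J" "K u1 \<noteq> (K u0 / H u0) * H u1" by blast
    \<comment> \<open>The determinant of (K, H) at \<open>u1\<close> and \<open>u0\<close>; it
      isolates \<alpha> s by Cramer's rule, so that \<alpha> inherits differentiability at 0 from
      \<open>K1\<close>.\<close>
    define w where "w = K u1 * H u0 - K u0 * H u1"
    have w: "w \<noteq> 0" using u1(2) H[OF J] by (simp add: w_def field_simps)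
    define \<alpha> where "\<alpha> s = (K1 s u1 * H u0 - K1 s u0 * H u1) / w" for s
    define \<epsilon> where "\<epsilon> s = (K1 s u0 / \<alpha> s - K u0) / H u0" for s
    obtain D where D: "DERIV \<alpha> 0 :> D"
      unfolding \<alpha>_def[abs_def]
      using DERIV_cdivide[OF DERIV_diff[OF DERIV_cmult_right[OF dK1[OF u1(1)]] DERIV_cmult_right[OF dK1[OF J]]]] by blast
    have \<alpha>c: "isCont \<alpha> 0" using D DERIV_isCont by blast
    have al: "\<alpha> s \<noteq> 0" "\<And>u. u \<in> J \<Longrightarrow> K1 s u = \<alpha> s * (K u + \<epsilon> s * H u)" "\<alpha> s * h1 s x0 = s * (l s x0 * g x0)"
      if s: "s \<noteq> 0" for s
    proof -
      obtain a e where a: "a \<noteq> 0" "\<forall>u\<in>J. K1 s u = a * (K u + e * H u)" "h1 s x0 = l s x0 * (s * g x0) / a"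
        using form[OF s] by blast
      have "K1 s u1 * H u0 - K1 s u0 * H u1 = a * w" using a(2) u1(1) J by (simp add: w_def algebra_simps)
      then have aa: "\<alpha> s = a" using w by (simp add: \<alpha>_def)
      have "K1 s u0 / a = K u0 + e * H u0" using a(1,2) J by simp
      then have ee: "\<epsilon> s = e" using H[OF J] by (simp add: \<epsilon>_def aa)
      show "\<alpha> s \<noteq> 0" "\<And>u. u \<in> J \<Longrightarrow> K1 s u = \<alpha> s * (K u + \<epsilon> s * H u)" unfolding aa ee using a by auto
      show "\<alpha> s * h1 s x0 = s * (l s x0 * g x0)" unfolding aa a(3) using a(1) by simp
    qed
    have \<alpha>0: "\<alpha> 0 \<noteq> 0"
    proof
      assume z: "\<alpha> 0 = 0"
      \<comment> \<open>The quotient \<alpha> s / s, continued to s = 0 by the derivative of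
        \<alpha>.\<close>
      define q where "q s = (if s = 0 then D else \<alpha> s / s)" for s
      have "((\<lambda>s. \<alpha> s / s) \<longlongrightarrow> D) (at 0)"
        using D z unfolding has_field_derivative_iff by simp
      moreover have "(q \<longlongrightarrow> D) (at 0) \<longleftrightarrow> ((\<lambda>s. \<alpha> s / s) \<longlongrightarrow> D) (at 0)"
        by (rule tendsto_cong) (simp add: eventually_at_filter q_def)
      ultimately have "isCont q 0" unfolding isCont_def by (simp add: q_def)
      have "q 0 * h1 0 x0 = l 0 x0 * g x0"
      proof (rule eq_at_limit)
        show "isCont (\<lambda>s. q s * h1 s x0) 0" by (intro continuous_mult \<open>isCont q 0\<close> h1c I(2))
        show "isCont (\<lambda>s. l s x0 * g x0) 0" by (intro continuous_mult lc I(2) continuous_const)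
        show "q s * h1 s x0 = l s x0 * g x0" if "s \<noteq> 0" for s
          using al(3)[OF that] that by (simp add: q_def field_simps)
      qed
      then show False using lx(2)[OF I(2)] l0[OF I(2)] g[OF I(2)] by simp
    qed
    have \<epsilon>c: "isCont \<epsilon> 0"
      unfolding \<epsilon>_def[abs_def] using \<alpha>0 H[OF J]
      by (intro continuous_divide continuous_diff K1c J \<alpha>c continuous_const) auto
    show ?thesis
    proof (rule goal[OF \<alpha>0])
      show "K1 0 u = \<alpha> 0 * (K u + \<epsilon> 0 * H u)" if u: "u \<in> J" for u
        by (rule eq_at_limit[OF K1c[OF u] _ al(2)[OF _ u]])
          (intro continuous_mult continuous_add \<alpha>c \<epsilon>c continuous_const)
    qed
  qed
qed

lemma antiderivative_cong:
  assumes I: "open_interval I" "x0 \<in> I" "x \<in> I" and k: "\<And>y. y \<in> I \<Longrightarrow> k y = k' y"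
  shows "antiderivative x0 k x = antiderivative x0 k' x"
proof -
  have "integral {a..b} k = integral {a..b} k'" if "{a..b} \<subseteq> I" for a b
    by (rule integral_cong) (use that k in blast)
  then show ?thesis
    unfolding antiderivative_def
    using open_interval_Icc_subset[OF I] open_interval_Icc_subset[OF I(1,3,2)] by simp
qed

lemma listed_form_cong:
  assumes I: "open_interval I" "x0 \<in> I" and h: "\<And>x. x \<in> I \<Longrightarrow> h x = h' x" and K: "\<And>u. u \<in> J \<Longrightarrow> K u = K' u"
    and LF: "listed_form x0 I J g h H K l h1 K1"
  shows "listed_form x0 I J g h' H K' l h1 K1"
proof -
  have A: "antiderivative x0 (\<lambda>y. h y / g y) x = antiderivative x0 (\<lambda>y. h' y / g y) x" if "x \<in> I" for x
    by (rule antiderivative_cong[OF I that]) (simp add: h)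
  obtain \<epsilon>1 \<epsilon>3 \<epsilon>4 where "\<epsilon>1 \<noteq> 0" "\<epsilon>3 \<noteq> 0"
       "\<forall>x\<in>I. l x = \<epsilon>1 * exp (- \<epsilon>4 * antiderivative x0 (\<lambda>y. h y / g y) x) \<and> h1 x = l x * h x / \<epsilon>3"
       "\<forall>u\<in>J. K1 u = \<epsilon>3 * (K u + \<epsilon>4 * H u)"
    using LF unfolding listed_form_def by blast
  then show ?thesis
    unfolding listed_form_def using A h K
    by (intro exI[of _ \<epsilon>1] exI[of _ \<epsilon>3] exI[of _ \<epsilon>4]) simp
qed

text \<open>Every triple (q, a, c) is realised by a function \<open>u\<close> that has a transform
  \<open>v\<close>, so the condition on functions becomes a condition on jets.\<close>

lemma jet_eq_pullback_iff:
  assumes It: "open_interval It" and Ix: "open_interval Ix" and Iu: "open_interval Iu"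
    and L: "listed_point_map It Ix Iu \<delta>1 \<delta>2 \<delta>3 \<delta>4 X \<phi>" and \<theta>: "\<theta> \<in> arb_class Ix Iu"
    and \<theta>': "\<theta>' \<in> arb_class (X ` Ix) ((\<lambda>u. \<delta>3 * u + \<delta>4) ` Iu)"
    and map: "maps_equation (It \<times> Ix \<times> Iu) \<phi> \<theta> \<theta>'" and x: "x \<in> Ix" and w: "w \<in> Iu"
  shows "jet_eq \<theta> x w q a c \<longleftrightarrow> jet_eq (pullback \<delta>1 \<delta>3 \<delta>4 X \<theta>') x w q a c"
proof -
  note oI = open_intervalD(1)[OF Ix] and oJ = open_intervalD(1)[OF Iu] and oT = open_intervalD(1)[OF It]
  obtain t where t: "t \<in> It" using open_intervalD(4)[OF It] by blast
  let ?B = "It \<times> Ix \<times> Iu" and ?z = "(t, x, w)"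
  have B: "open ?B" using oI oJ oT by (simp add: open_Times)
  have z: "?z \<in> ?B" using t x w by simp
  have pt: "point_transformation ?B \<phi>" by (rule listed_point_transformation[OF oT oI oJ L])
  have smooth: "smooth_on ?B \<phi>" and bij: "bij (frechet_derivative \<phi> (at ?z))"
    using pt z by (auto simp: point_transformation_def)
  have \<delta>: "\<delta>1 \<noteq> 0" "\<delta>3 \<noteq> 0" and X0: "deriv X x \<noteq> 0"
    and \<phi>: "\<And>s y w. s \<in> It \<Longrightarrow> y \<in> Ix \<Longrightarrow> w \<in> Iu \<Longrightarrow> \<phi> (s, y, w) = (\<delta>1 * s + \<delta>2, X y, \<delta>3 * w + \<delta>4)"
    using L x by (auto simp: listed_point_map_def)
  define D where "D = frechet_derivative \<phi> (at ?z)"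
  have D: "D = (\<lambda>h. (\<delta>1 * fst h, deriv X x * fst (snd h), \<delta>3 * snd (snd h)))"
    unfolding D_def using listed_frechet_derivative[OF oT oI oJ L z] by simp
  have det: "fst (D (1, 0, 0)) * fst (snd (D (0, 1, q))) - fst (D (0, 1, q)) * fst (snd (D (1, 0, 0))) \<noteq> 0"
    unfolding D using \<delta> X0 by simp
  obtain V W u v where "jet_pair ?B \<phi> t x w 0 q a c V W u v"
    by (rule jet_pair_exists[OF B smooth z D_def bij[folded D_def] det])
  then have A: "open V" "open W" "C_k_on 2 V u" "C_k_on 2 W v"
      "graph_over V u \<subseteq> ?B" "\<phi> ` graph_over V u = graph_over W v" "(t, x) \<in> V" "u (t, x) = w"
      "D_x u (t, x) = q" "D_t (D_t u) (t, x) = a" "D_x (D_x u) (t, x) = c"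
      "base (\<phi> ?z) \<in> W" "v (base (\<phi> ?z)) = snd (snd (\<phi> ?z))"
    unfolding jet_pair_def by - (elim conjE; assumption)+
  let ?q = "(\<delta>1 * t + \<delta>2, X x)"
  have bq: "base (\<phi> ?z) = ?q" and vq: "v ?q = \<delta>3 * w + \<delta>4" "?q \<in> W"
    using A(12,13) \<phi>[OF t x w] by (simp_all add: base_def)
  have e: "\<phi> (fst (t, x), snd (t, x), u (t, x)) = (fst ?q, snd ?q, v ?q)"
    using \<phi>[OF t x w] A(8) vq by simp
  have hyp: "open V \<and> open W \<and> C_k_on 2 V u \<and> C_k_on 2 W v \<and> graph_over V u \<subseteq> ?B \<and> \<phi> ` graph_over V u = graph_over W v"
    using A by blast
  have H: "DERIV (el_H \<theta>) (u (t, x)) :> deriv (el_H \<theta>) (u (t, x))"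
    unfolding A(8) by (rule smooth_on_DERIV[OF arb_classD(4)[OF \<theta>] oJ w])
  have "jet_eq \<theta> x w q a c \<longleftrightarrow> satisfies_at \<theta> u (t, x)"
    using satisfies_at_iff_jet_eq[OF A(1,3,7) smooth_on_DERIV[OF arb_classD(2)[OF \<theta>] oI x] H]
    unfolding A(8-11) by blast
  also have "\<dots> \<longleftrightarrow> satisfies_at \<theta>' v ?q"
    by (rule map[unfolded maps_equation_def, rule_format, OF hyp A(7) vq(2) e])
  also have "\<dots> \<longleftrightarrow> jet_eq (pullback \<delta>1 \<delta>3 \<delta>4 X \<theta>') x w q a c"
    using satisfies_at_listed_map[OF Ix Iu L \<theta>' A(1-7)] unfolding A(8-11) .
  finally show ?thesis .
qed

text \<open>Both conditions are linear in \<open>a\<close> and \<open>c\<close> and quadratic in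
  \<open>q\<close>. Inserting in the second one jets that solve the first compares the coefficients;
  q = 1 and q = -1 separate the coefficient of \<open>q\<close> from that of q^2.\<close>

lemma jet_eq_coefficients:
  assumes "\<And>q a c. jet_eq \<theta> x w q a c \<longleftrightarrow> jet_eq \<eta> x w q a c" and f: "el_f \<theta> x \<noteq> 0"
  shows "el_f \<eta> x * (el_g \<theta> x * el_H \<theta> w) = el_f \<theta> x * (el_g \<eta> x * el_H \<eta> w)"
    "el_f \<eta> x * (deriv (el_g \<theta>) x * el_H \<theta> w + el_h \<theta> x * el_K \<theta> w) =
     el_f \<theta> x * (deriv (el_g \<eta>) x * el_H \<eta> w + el_h \<eta> x * el_K \<eta> w)"
proof -
  define P :: "arb_elements \<Rightarrow> real" where "P \<theta> = deriv (el_g \<theta>) x * el_H \<theta> w + el_h \<theta> x * el_K \<theta> w" for \<theta>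
  define S :: "arb_elements \<Rightarrow> real" where "S \<theta> = el_g \<theta> x * deriv (el_H \<theta>) w" for \<theta>
  define G :: "arb_elements \<Rightarrow> real" where "G \<theta> = el_g \<theta> x * el_H \<theta> w" for \<theta>
  have iff: "el_f \<theta> x * a = P \<theta> * q + S \<theta> * q\<^sup>2 + G \<theta> * c \<longleftrightarrow> el_f \<eta> x * a = P \<eta> * q + S \<eta> * q\<^sup>2 + G \<eta> * c" for q a c
    using assms(1)[of q a c] unfolding jet_eq_def P_def S_def G_def .
  have "el_f \<eta> x * G \<theta> = G \<eta> * el_f \<theta> x" using iff[of "G \<theta>" 0 "el_f \<theta> x"] by (simp add: mult.commute)
  then show "el_f \<eta> x * (el_g \<theta> x * el_H \<theta> w) = el_f \<theta> x * (el_g \<eta> x * el_H \<eta> w)"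
    unfolding G_def by (simp add: mult_ac)
  have "el_f \<eta> x * ((P \<theta> * q + S \<theta> * q\<^sup>2) / el_f \<theta> x) = P \<eta> * q + S \<eta> * q\<^sup>2" for q
    using iff[of "(P \<theta> * q + S \<theta> * q\<^sup>2) / el_f \<theta> x" q 0] f by simp
  then have "el_f \<eta> x * (P \<theta> * q + S \<theta> * q\<^sup>2) = el_f \<theta> x * (P \<eta> * q + S \<eta> * q\<^sup>2)" for q
    using f by (simp add: field_simps)
  from this[of 1] this[of "-1"] have "el_f \<eta> x * P \<theta> = el_f \<theta> x * P \<eta>" by (simp add: algebra_simps)
  then show "el_f \<eta> x * (deriv (el_g \<theta>) x * el_H \<theta> w + el_h \<theta> x * el_K \<theta> w) =
     el_f \<theta> x * (deriv (el_g \<eta>) x * el_H \<eta> w + el_h \<eta> x * el_K \<eta> w)"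
    unfolding P_def .
qed

section \<open>Arbitrary elements under a listed point transformation\<close>

locale listed_equivalence =
  fixes It Ix Iu :: "real set" and x0 :: real and \<phi> \<Psi> \<delta>1 \<delta>2 \<delta>3 \<delta>4 X
  assumes It: "open_interval It" and Ix: "open_interval Ix" and Iu: "open_interval Iu" and x0: "x0 \<in> Ix"
    and L: "listed_point_map It Ix Iu \<delta>1 \<delta>2 \<delta>3 \<delta>4 X \<phi>"
    and op: "smooth_operator Ix Iu (X ` Ix) ((\<lambda>u. \<delta>3 * u + \<delta>4) ` Iu) \<Psi>"
    and map: "\<And>\<theta>. \<theta> \<in> arb_class Ix Iu \<Longrightarrow> maps_equation (It \<times> Ix \<times> Iu) \<phi> \<theta> (\<Psi> \<theta>)"
begin

lemmas oIx = open_intervalD(1)[OF Ix]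
lemmas oIu = open_intervalD(1)[OF Iu]

lemma \<delta>: "\<delta>1 \<noteq> 0" "\<delta>3 \<noteq> 0" and X: "smooth_on Ix X" and X0: "\<And>x. x \<in> Ix \<Longrightarrow> deriv X x \<noteq> 0"
  using L by (auto simp: listed_point_map_def)

definition "\<eta> \<theta> = pullback \<delta>1 \<delta>3 \<delta>4 X (\<Psi> \<theta>)"
definition "ratio \<theta> x = el_f (\<eta> \<theta>) x / el_f \<theta> x"

lemma cls: "\<theta> \<in> arb_class Ix Iu \<Longrightarrow> \<Psi> \<theta> \<in> arb_class (X ` Ix) ((\<lambda>u. \<delta>3 * u + \<delta>4) ` Iu)"
  by (rule smooth_operator_arb_class[OF op oIx oIu])

lemma \<eta>_elements:
  assumes \<theta>: "\<theta> \<in> arb_class Ix Iu"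
  shows "smooth_on Ix (el_f (\<eta> \<theta>))" "\<And>x. x \<in> Ix \<Longrightarrow> el_f (\<eta> \<theta>) x \<noteq> 0" "\<And>x. x \<in> Ix \<Longrightarrow> el_g (\<eta> \<theta>) x \<noteq> 0"
    "\<And>u. u \<in> Iu \<Longrightarrow> el_H (\<eta> \<theta>) u \<noteq> 0"
proof -
  note c = arb_classD[OF cls[OF \<theta>]]
  show "smooth_on Ix (el_f (\<eta> \<theta>))"
    unfolding \<eta>_def pullback_def
    by (simp, intro smooth_on_divide smooth_on_mult smooth_on_const oIx smooth_on_deriv[OF X]
      smooth_on_compose[OF oIx smooth_on_inv_into(1)[OF Ix X X0] c(1) X]) (use \<delta> in auto)
  show "\<And>x. x \<in> Ix \<Longrightarrow> el_f (\<eta> \<theta>) x \<noteq> 0" "\<And>x. x \<in> Ix \<Longrightarrow> el_g (\<eta> \<theta>) x \<noteq> 0"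
    "\<And>u. u \<in> Iu \<Longrightarrow> el_H (\<eta> \<theta>) u \<noteq> 0"
    unfolding \<eta>_def pullback_def using c(6-8) \<delta> X0 by auto
qed

lemma ratio_nonzero: "\<theta> \<in> arb_class Ix Iu \<Longrightarrow> x \<in> Ix \<Longrightarrow> ratio \<theta> x \<noteq> 0"
  using \<eta>_elements(2) arb_classD(6) by (simp add: ratio_def)

text \<open>The leading coefficients give l(x) g(x) H(u) = g1(x) H1(u) for the pulled back g1 and
  H1. At \<open>x0\<close> this makes H1 a constant multiple of \<open>H\<close>, and then g1 = l g
  / \<epsilon>2. Differentiating g1 produces the term with l_x in the coefficient of u_x.\<close>

lemma reduction:
  assumes \<theta>: "\<theta> \<in> arb_class Ix Iu"
  obtains \<epsilon>2 where "\<epsilon>2 \<noteq> 0" "\<And>u. u \<in> Iu \<Longrightarrow> el_H (\<eta> \<theta>) u = \<epsilon>2 * el_H \<theta> u"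
    "\<And>x. x \<in> Ix \<Longrightarrow> el_g (\<eta> \<theta>) x = ratio \<theta> x * el_g \<theta> x / \<epsilon>2"
    "reduced Ix Iu (el_g \<theta>) (el_h \<theta>) (el_H \<theta>) (el_K \<theta>) (ratio \<theta>) (el_h (\<eta> \<theta>)) (el_K (\<eta> \<theta>))"
proof -
  note c = arb_classD[OF \<theta>] and e = \<eta>_elements[OF \<theta>]
  have rel: "ratio \<theta> x * (el_g \<theta> x * el_H \<theta> w) = el_g (\<eta> \<theta>) x * el_H (\<eta> \<theta>) w"
     "ratio \<theta> x * (deriv (el_g \<theta>) x * el_H \<theta> w + el_h \<theta> x * el_K \<theta> w) =
     deriv (el_g (\<eta> \<theta>)) x * el_H (\<eta> \<theta>) w + el_h (\<eta> \<theta>) x * el_K (\<eta> \<theta>) w"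
    if x: "x \<in> Ix" and w: "w \<in> Iu" for x w
  proof -
    note k = jet_eq_coefficients[OF jet_eq_pullback_iff[OF It Ix Iu L \<theta> cls[OF \<theta>] map[OF \<theta>] x w, folded \<eta>_def] c(6)[OF x]]
    show "ratio \<theta> x * (el_g \<theta> x * el_H \<theta> w) = el_g (\<eta> \<theta>) x * el_H (\<eta> \<theta>) w"
      unfolding ratio_def using k(1) c(6)[OF x] by (simp add: divide_eq_eq mult_ac)
    show "ratio \<theta> x * (deriv (el_g \<theta>) x * el_H \<theta> w + el_h \<theta> x * el_K \<theta> w) =
     deriv (el_g (\<eta> \<theta>)) x * el_H (\<eta> \<theta>) w + el_h (\<eta> \<theta>) x * el_K (\<eta> \<theta>) w"
      unfolding ratio_def times_divide_eq_left using k(2) c(6)[OF x] by (simp add: divide_eq_eq mult_ac)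
  qed
  define \<epsilon>2 where "\<epsilon>2 = ratio \<theta> x0 * el_g \<theta> x0 / el_g (\<eta> \<theta>) x0"
  have \<epsilon>2: "\<epsilon>2 \<noteq> 0" using ratio_nonzero[OF \<theta> x0] c(7)[OF x0] e(3)[OF x0] by (simp add: \<epsilon>2_def)
  have H: "el_H (\<eta> \<theta>) u = \<epsilon>2 * el_H \<theta> u" if "u \<in> Iu" for u
    using rel(1)[OF x0 that] e(3)[OF x0] by (simp add: \<epsilon>2_def field_simps)
  obtain w where w: "w \<in> Iu" using open_intervalD(4)[OF Iu] by blast
  have g: "el_g (\<eta> \<theta>) x = ratio \<theta> x * el_g \<theta> x / \<epsilon>2" if "x \<in> Ix" for x
    using rel(1)[OF that w] \<epsilon>2 c(8)[OF w] unfolding H[OF w] by (simp add: field_simps)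
  have sr: "smooth_on Ix (ratio \<theta>)"
    unfolding ratio_def[abs_def] by (intro smooth_on_divide oIx e(1) c(1)) (rule c(6))
  have dr: "DERIV (ratio \<theta>) x :> deriv (ratio \<theta>) x" if "x \<in> Ix" for x by (rule smooth_on_DERIV[OF sr oIx that])
  have dg: "deriv (el_g (\<eta> \<theta>)) x = (deriv (ratio \<theta>) x * el_g \<theta> x + deriv (el_g \<theta>) x * ratio \<theta> x) / \<epsilon>2"
    if x: "x \<in> Ix" for x
  proof -
    have "deriv (el_g (\<eta> \<theta>)) x = deriv (\<lambda>x. ratio \<theta> x * el_g \<theta> x / \<epsilon>2) x"
      by (rule deriv_cong_on[OF oIx x g])
    also have "\<dots> = (deriv (ratio \<theta>) x * el_g \<theta> x + deriv (el_g \<theta>) x * ratio \<theta> x) / \<epsilon>2"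
      by (rule DERIV_imp_deriv[OF DERIV_cdivide[OF DERIV_mult[OF dr[OF x] smooth_on_DERIV[OF c(2) oIx x]]]])
    finally show ?thesis .
  qed
  have "el_h (\<eta> \<theta>) x * el_K (\<eta> \<theta>) u = ratio \<theta> x * el_h \<theta> x * el_K \<theta> u - deriv (ratio \<theta>) x * el_g \<theta> x * el_H \<theta> u"
    if x: "x \<in> Ix" and u: "u \<in> Iu" for x u
  proof -
    have cancel: "D / \<epsilon>2 * (\<epsilon>2 * r) = D * r" for D r using \<epsilon>2 by simp
    show ?thesis
      using rel(2)[OF x u] unfolding dg[OF x] H[OF u] cancel by (simp add: algebra_simps)
  qed
  then have "reduced Ix Iu (el_g \<theta>) (el_h \<theta>) (el_H \<theta>) (el_K \<theta>) (ratio \<theta>) (el_h (\<eta> \<theta>)) (el_K (\<eta> \<theta>))"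
    unfolding reduced_def using ratio_nonzero[OF \<theta>] dr by blast
  then show thesis using that[OF \<epsilon>2 H g] by blast
qed

abbreviation "LF \<theta> \<equiv> listed_form x0 Ix Iu (el_g \<theta>) (el_h \<theta>) (el_H \<theta>) (el_K \<theta>) (ratio \<theta>) (el_h (\<eta> \<theta>)) (el_K (\<eta> \<theta>))"

lemma quotient_continuous:
  assumes \<theta>: "\<theta> \<in> arb_class Ix Iu"
  shows "continuous_on Ix (\<lambda>y. el_h \<theta> y / el_g \<theta> y)"
  using arb_classD[OF \<theta>] by (intro continuous_on_divide ballI smooth_on_continuous) auto

lemma LF_generic:
  assumes \<theta>: "\<theta> \<in> arb_class Ix Iu" and x1: "x1 \<in> Ix" "el_h \<theta> x1 \<noteq> 0" and np: "\<And>c. \<exists>u\<in>Iu. el_K \<theta> u \<noteq> c * el_H \<theta> u"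
  shows "LF \<theta>"
proof -
  obtain \<epsilon>2 where "reduced Ix Iu (el_g \<theta>) (el_h \<theta>) (el_H \<theta>) (el_K \<theta>) (ratio \<theta>) (el_h (\<eta> \<theta>)) (el_K (\<eta> \<theta>))"
    using reduction[OF \<theta>] by blast
  from listed_form_generic[OF Ix x0 arb_classD(7)[OF \<theta>] quotient_continuous[OF \<theta>] arb_classD(8)[OF \<theta>]
      open_intervalD(4)[OF Iu] this x1 np]
  show ?thesis .
qed

text \<open>Smoothness of the transformed family, read at a fixed point as a function of
  \<open>s\<close>. The condition on \<open>el_f\<close> makes the denominator of
  \<open>ratio\<close> independent of \<open>s\<close>; the deformations below satisfy it.\<close>

lemma family_DERIV:
  assumes \<Theta>: "smooth_family Ix Iu \<Theta>"
  shows "\<And>x. x \<in> Ix \<Longrightarrow> (\<And>s. el_f (\<Theta> s) x = el_f (\<Theta> 0) x) \<Longrightarrow>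
      DERIV (\<lambda>s. ratio (\<Theta> s) x) 0 :> deriv (\<lambda>s. ratio (\<Theta> s) x) 0"
    "\<And>x. x \<in> Ix \<Longrightarrow> DERIV (\<lambda>s. el_h (\<eta> (\<Theta> s)) x) 0 :> deriv (\<lambda>s. el_h (\<eta> (\<Theta> s)) x) 0"
    "\<And>u. u \<in> Iu \<Longrightarrow> DERIV (\<lambda>s. el_K (\<eta> (\<Theta> s)) u) 0 :> deriv (\<lambda>s. el_K (\<eta> (\<Theta> s)) u) 0"
proof -
  have fam: "smooth_family (X ` Ix) ((\<lambda>u. \<delta>3 * u + \<delta>4) ` Iu) (\<lambda>s. \<Psi> (\<Theta> s))"
    using op \<Theta> unfolding smooth_operator_def by blast
  have oI': "open (X ` Ix)" by (rule smooth_on_inv_into(1)[OF Ix X X0])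
  have oJ': "open ((\<lambda>u. \<delta>3 * u + \<delta>4) ` Iu)" by (rule open_affine_image[OF oIu \<delta>(2)])
  have D: "\<exists>D. DERIV (\<lambda>s. F s y) 0 :> D" if "smooth_on (UNIV \<times> S) (\<lambda>(s, y). F s y)" "open S" "y \<in> S"
    for F :: "real \<Rightarrow> real \<Rightarrow> real" and S y
  proof -
    have "open (UNIV \<times> S :: (real \<times> real) set)" "(0, y) \<in> UNIV \<times> S" using that by (auto simp: open_Times)
    from DERIV_slice(1)[OF smooth_on_has_derivative[OF that(1) this]] show ?thesis by auto
  qed
  have D': "DERIV F 0 :> deriv F 0" if "\<exists>D. DERIV F 0 :> D" for F :: "real \<Rightarrow> real"
    using that DERIV_imp_deriv by blast
  show "DERIV (\<lambda>s. ratio (\<Theta> s) x) 0 :> deriv (\<lambda>s. ratio (\<Theta> s) x) 0"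
    if x: "x \<in> Ix" and c: "\<And>s. el_f (\<Theta> s) x = el_f (\<Theta> 0) x" for x
  proof (rule D')
    obtain D where "DERIV (\<lambda>s. el_f (\<Psi> (\<Theta> s)) (X x)) 0 :> D"
      using D[of "X ` Ix" "\<lambda>s. el_f (\<Psi> (\<Theta> s))" "X x"] fam oI' x unfolding smooth_family_def by blast
    then have "DERIV (\<lambda>s. el_f (\<Psi> (\<Theta> s)) (X x) * deriv X x / \<delta>1\<^sup>2 / el_f (\<Theta> 0) x) 0 :> D * deriv X x / \<delta>1\<^sup>2 / el_f (\<Theta> 0) x"
      by (intro DERIV_cdivide DERIV_cmult_right)
    moreover have "(\<lambda>s. ratio (\<Theta> s) x) = (\<lambda>s. el_f (\<Psi> (\<Theta> s)) (X x) * deriv X x / \<delta>1\<^sup>2 / el_f (\<Theta> 0) x)"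
    proof
      fix s
      show "ratio (\<Theta> s) x = el_f (\<Psi> (\<Theta> s)) (X x) * deriv X x / \<delta>1\<^sup>2 / el_f (\<Theta> 0) x"
        unfolding ratio_def c[of s] by (simp add: \<eta>_def pullback_def)
    qed
    ultimately show "\<exists>D. DERIV (\<lambda>s. ratio (\<Theta> s) x) 0 :> D" by auto
  qed
  show "DERIV (\<lambda>s. el_h (\<eta> (\<Theta> s)) x) 0 :> deriv (\<lambda>s. el_h (\<eta> (\<Theta> s)) x) 0" if x: "x \<in> Ix" for x
  proof (rule D')
    show "\<exists>D. DERIV (\<lambda>s. el_h (\<eta> (\<Theta> s)) x) 0 :> D"
      using D[of "X ` Ix" "\<lambda>s. el_h (\<Psi> (\<Theta> s))" "X x"] fam oI' x
      unfolding smooth_family_def by (simp add: \<eta>_def pullback_def)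
  qed
  show "DERIV (\<lambda>s. el_K (\<eta> (\<Theta> s)) u) 0 :> deriv (\<lambda>s. el_K (\<eta> (\<Theta> s)) u) 0" if u: "u \<in> Iu" for u
  proof (rule D')
    show "\<exists>D. DERIV (\<lambda>s. el_K (\<eta> (\<Theta> s)) u) 0 :> D"
      using D[of "(\<lambda>u. \<delta>3 * u + \<delta>4) ` Iu" "\<lambda>s. el_K (\<Psi> (\<Theta> s))", OF _ oJ' imageI[OF u]] fam
      unfolding smooth_family_def by (simp add: \<eta>_def pullback_def)
  qed
qed

text \<open>When K = c H, also K_u = c H_u, so nonlinearity of the tuple must come from
  \<open>H\<close>. Changing \<open>K\<close> therefore cannot leave the class.\<close>

lemma deform_K_family:
  assumes \<theta>: "\<theta> \<in> arb_class Ix Iu" and K: "\<And>u. u \<in> Iu \<Longrightarrow> el_K \<theta> u = c * el_H \<theta> u" and \<kappa>: "smooth_on Iu \<kappa>"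
  shows "smooth_family Ix Iu (\<lambda>s. \<theta>\<lparr>el_K := \<lambda>u. el_K \<theta> u + s * (\<kappa> u * el_H \<theta> u)\<rparr>)"
proof -
  note a = arb_classD[OF \<theta>]
  have oB: "open (UNIV \<times> Iu :: (real \<times> real) set)" using oIu by (simp add: open_Times)
  have "deriv (el_K \<theta>) u = c * deriv (el_H \<theta>) u" if u: "u \<in> Iu" for u
  proof -
    have "deriv (el_K \<theta>) u = deriv (\<lambda>u. c * el_H \<theta> u) u" by (rule deriv_cong_on[OF oIu u K])
    also have "\<dots> = c * deriv (el_H \<theta>) u"
      by (rule DERIV_imp_deriv[OF DERIV_cmult[OF smooth_on_DERIV[OF a(4) oIu u]]])
    finally show ?thesis .
  qed
  then have H': "\<exists>u\<in>Iu. deriv (el_H \<theta>) u \<noteq> 0" using a(9) by auto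
  have sK: "smooth_on (UNIV \<times> Iu) (\<lambda>p. el_K \<theta> (snd p) + fst p * (\<kappa> (snd p) * el_H \<theta> (snd p)))"
    by (intro smooth_on_add smooth_on_mult smooth_on_fst smooth_on_ident oB smooth_on_extend[OF oIu] a \<kappa>)
  have "smooth_on Iu (\<lambda>u. el_K \<theta> u + s * (\<kappa> u * el_H \<theta> u))" for s
    using smooth_on_slice[OF oIu sK, of s] by simp
  then have "\<theta>\<lparr>el_K := \<lambda>u. el_K \<theta> u + s * (\<kappa> u * el_H \<theta> u)\<rparr> \<in> arb_class Ix Iu" for s
    using a(1-8) H' unfolding arb_class_def by (simp, blast)
  then show ?thesis
    unfolding smooth_family_def case_prod_unfold
    using sK smooth_on_extend[OF oIx a(1)] smooth_on_extend[OF oIx a(2)] smooth_on_extend[OF oIx a(3)]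
      smooth_on_extend[OF oIu a(4)] by simp
qed

text \<open>The perturbation is a multiple of \<open>g\<close> so that h / g becomes
  \<open>s m\<close> when h = 0, and the antiderivative can be prescribed explicitly.\<close>

lemma deform_h_family:
  assumes \<theta>: "\<theta> \<in> arb_class Ix Iu" and m: "smooth_on Ix m"
  shows "smooth_family Ix Iu (\<lambda>s. \<theta>\<lparr>el_h := \<lambda>x. el_h \<theta> x + s * (m x * el_g \<theta> x)\<rparr>)"
proof -
  note a = arb_classD[OF \<theta>]
  have oB: "open (UNIV \<times> Ix :: (real \<times> real) set)" using oIx by (simp add: open_Times)
  have sh: "smooth_on (UNIV \<times> Ix) (\<lambda>p. el_h \<theta> (snd p) + fst p * (m (snd p) * el_g \<theta> (snd p)))"
    by (intro smooth_on_add smooth_on_mult smooth_on_fst smooth_on_ident oB smooth_on_extend[OF oIx] a m)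
  have "smooth_on Ix (\<lambda>x. el_h \<theta> x + s * (m x * el_g \<theta> x))" for s
    using smooth_on_slice[OF oIx sh, of s] by simp
  then have "\<theta>\<lparr>el_h := \<lambda>x. el_h \<theta> x + s * (m x * el_g \<theta> x)\<rparr> \<in> arb_class Ix Iu" for s
    using a unfolding arb_class_def by simp
  then show ?thesis
    unfolding smooth_family_def case_prod_unfold
    using sh smooth_on_extend[OF oIx a(1)] smooth_on_extend[OF oIx a(2)] smooth_on_extend[OF oIu a(4)]
      smooth_on_extend[OF oIu a(5)] by simp
qed

text \<open>For s \<noteq> 0 and nonconstant \<kappa>, K + s \<kappa> H is no multiple of
  \<open>H\<close>, so the generic case applies away from s = 0. The directions \<kappa> = u and
  \<kappa> = u^2 are combined in the limit.\<close>

lemma LF_proportional: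
  assumes \<theta>: "\<theta> \<in> arb_class Ix Iu" and x1: "x1 \<in> Ix" "el_h \<theta> x1 \<noteq> 0" and K: "\<And>u. u \<in> Iu \<Longrightarrow> el_K \<theta> u = c * el_H \<theta> u"
  shows "LF \<theta>"
proof -
  note a = arb_classD[OF \<theta>]
  obtain u0 where u0: "u0 \<in> Iu" using open_intervalD(4)[OF Iu] by blast
  have lim: "\<exists>\<eta>' e. (\<forall>x\<in>Ix. ratio \<theta> x = ratio \<theta> x0 * exp (- e * antiderivative x0 (\<lambda>y. el_h \<theta> y / el_g \<theta> y) x)) \<and>
    (\<forall>x\<in>Ix. el_h (\<eta> \<theta>) x = ratio \<theta> x * el_h \<theta> x * \<eta>') \<and> (\<forall>u\<in>Iu. el_K (\<eta> \<theta>) u * \<eta>' = (c + e) * el_H \<theta> u) \<and>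
    (\<eta>' = 0 \<longrightarrow> (\<exists>D. \<forall>u\<in>Iu. \<forall>u'\<in>Iu. (el_K (\<eta> \<theta>) u / el_H \<theta> u - el_K (\<eta> \<theta>) u' / el_H \<theta> u') * D = \<kappa> u - \<kappa> u'))"
    if \<kappa>: "smooth_on Iu \<kappa>" and nc: "u1 \<in> Iu" "u2 \<in> Iu" "\<kappa> u1 \<noteq> \<kappa> u2" for \<kappa> u1 u2
  proof -
    define \<Theta> where "\<Theta> s = \<theta>\<lparr>el_K := \<lambda>u. el_K \<theta> u + s * (\<kappa> u * el_H \<theta> u)\<rparr>" for s
    have \<Theta>: "smooth_family Ix Iu \<Theta>" unfolding \<Theta>_def[abs_def] by (rule deform_K_family[OF \<theta> K \<kappa>])
    have cl: "\<Theta> s \<in> arb_class Ix Iu" for s using \<Theta> by (simp add: smooth_family_def)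
    have \<Theta>0: "\<Theta> 0 = \<theta>" by (simp add: \<Theta>_def)
    have el: "el_f (\<Theta> s) = el_f \<theta>" "el_g (\<Theta> s) = el_g \<theta>" "el_h (\<Theta> s) = el_h \<theta>" "el_H (\<Theta> s) = el_H \<theta>" for s
      by (simp_all add: \<Theta>_def)
    have KE: "el_K (\<Theta> s) u = c * el_H \<theta> u + s * (\<kappa> u * el_H \<theta> u)" if "u \<in> Iu" for s u
      using K[OF that] by (simp add: \<Theta>_def)
    have LFs: "listed_form x0 Ix Iu (el_g \<theta>) (el_h \<theta>) (el_H \<theta>) (\<lambda>u. c * el_H \<theta> u + s * (\<kappa> u * el_H \<theta> u))
        (ratio (\<Theta> s)) (el_h (\<eta> (\<Theta> s))) (el_K (\<eta> (\<Theta> s)))" if s: "s \<noteq> 0" for s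
    proof (rule listed_form_cong[OF Ix x0 refl KE])
      have np: "\<exists>u\<in>Iu. el_K (\<Theta> s) u \<noteq> c' * el_H (\<Theta> s) u" for c'
      proof (rule ccontr)
        assume A: "\<not> ?thesis"
        have "s * \<kappa> u = c' - c" if u: "u \<in> Iu" for u
        proof -
          have "c * el_H \<theta> u + s * (\<kappa> u * el_H \<theta> u) = c' * el_H \<theta> u" using A u KE[OF u] by (auto simp: el)
          then have "(c + s * \<kappa> u - c') * el_H \<theta> u = 0" by (simp add: algebra_simps)
          then show ?thesis using a(8)[OF u] by simp
        qed
        from this[OF nc(1)] this[OF nc(2)] have "s * \<kappa> u1 = s * \<kappa> u2" by simp
        then show False using s nc(3) by simp
      qed
      show "listed_form x0 Ix Iu (el_g \<theta>) (el_h \<theta>) (el_H \<theta>) (el_K (\<Theta> s)) (ratio (\<Theta> s)) (el_h (\<eta> (\<Theta> s))) (el_K (\<eta> (\<Theta> s)))"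
        using LF_generic[OF cl[of s] x1(1) _ np] x1(2) unfolding el by blast
    qed
    note fd = family_DERIV[OF \<Theta>]
    have fr: "DERIV (\<lambda>s. ratio (\<Theta> s) x) 0 :> deriv (\<lambda>s. ratio (\<Theta> s) x) 0" if "x \<in> Ix" for x
      by (rule fd(1)[OF that]) (simp add: el)
    note limit = proportional_limit[where l = "\<lambda>s. ratio (\<Theta> s)" and ?h1.0 = "\<lambda>s. el_h (\<eta> (\<Theta> s))"
        and ?K1.0 = "\<lambda>s. el_K (\<eta> (\<Theta> s))", OF Ix x0 a(7) quotient_continuous[OF \<theta>] a(8) x1 u0
        ratio_nonzero[OF cl] fr fd(2)[OF x1(1)] DERIV_isCont[OF fd(2)] fd(3) LFs, unfolded \<Theta>0]
    show ?thesis by (rule limit) (assumption | blast)+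
  qed
  obtain w1 w2 where w: "w1 \<in> Iu" "w2 \<in> Iu" "w1 \<noteq> w2" using two_points[OF Iu] by blast
  \<comment> \<open>u^2 is not constant, even on an interval symmetric about 0: otherwise its
    derivative 2 u would vanish at both \<open>w1\<close> and \<open>w2\<close>.\<close>
  obtain w3 w4 where w': "w3 \<in> Iu" "w4 \<in> Iu" "w3 * w3 \<noteq> w4 * w4"
  proof (rule ccontr)
    assume "\<not> thesis"
    then have c: "u * u = w1 * w1" if "u \<in> Iu" for u using that w(1) \<open>\<And>w3 w4. w3 \<in> Iu \<Longrightarrow> w4 \<in> Iu \<Longrightarrow> w3 * w3 \<noteq> w4 * w4 \<Longrightarrow> thesis\<close> by blast
    have "2 * u = 0" if u: "u \<in> Iu" for u :: real
      by (rule DERIV_unique_on[OF _ DERIV_const oIu u c]) (auto intro!: derivative_eq_intros)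
    from this[OF w(1)] this[OF w(2)] show False using w(3) by simp
  qed
  obtain \<eta>1 e where 1: "\<forall>x\<in>Ix. ratio \<theta> x = ratio \<theta> x0 * exp (- e * antiderivative x0 (\<lambda>y. el_h \<theta> y / el_g \<theta> y) x)"
    "\<forall>x\<in>Ix. el_h (\<eta> \<theta>) x = ratio \<theta> x * el_h \<theta> x * \<eta>1" "\<forall>u\<in>Iu. el_K (\<eta> \<theta>) u * \<eta>1 = (c + e) * el_H \<theta> u"
    "\<eta>1 = 0 \<longrightarrow> (\<exists>D. \<forall>u\<in>Iu. \<forall>u'\<in>Iu. (el_K (\<eta> \<theta>) u / el_H \<theta> u - el_K (\<eta> \<theta>) u' / el_H \<theta> u') * D = u - u')"
    using lim[of "\<lambda>u. u", OF smooth_on_ident[OF oIu] w] by blast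
  obtain \<eta>2 where 2: "\<forall>x\<in>Ix. el_h (\<eta> \<theta>) x = ratio \<theta> x * el_h \<theta> x * \<eta>2"
    "\<eta>2 = 0 \<longrightarrow> (\<exists>D. \<forall>u\<in>Iu. \<forall>u'\<in>Iu. (el_K (\<eta> \<theta>) u / el_H \<theta> u - el_K (\<eta> \<theta>) u' / el_H \<theta> u') * D = u * u - u' * u')"
    using lim[of "\<lambda>u. u * u", OF smooth_on_mult[OF oIu smooth_on_ident[OF oIu] smooth_on_ident[OF oIu]] w'] by blast
  show ?thesis
    by (rule listed_form_proportional[where H = "el_H \<theta>" and h = "el_h \<theta>" and K = "el_K \<theta>" and l = "ratio \<theta>"
          and c = c and e = e and \<eta> = \<eta>1 and \<eta>' = \<eta>2, OF Ix x0 Iu a(8) x1 ratio_nonzero[OF \<theta>] K])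
      (use 1 2 in blast)+
qed

lemma LF_nonzero:
  assumes "\<theta> \<in> arb_class Ix Iu" "x1 \<in> Ix" "el_h \<theta> x1 \<noteq> 0"
  shows "LF \<theta>"
proof (cases "\<exists>c. \<forall>u\<in>Iu. el_K \<theta> u = c * el_H \<theta> u")
  case True
  then obtain c where "\<And>u. u \<in> Iu \<Longrightarrow> el_K \<theta> u = c * el_H \<theta> u" by blast
  then show ?thesis by (rule LF_proportional[OF assms])
next
  case False
  show ?thesis by (rule LF_generic[OF assms]) (use False in blast)
qed

text \<open>For s \<noteq> 0 the deformed h = s m g is not identically zero, so
  \<open>LF_nonzero\<close> applies, whether or not \<open>K\<close> is a multiple of
  \<open>H\<close>. The directions m = 1 and m = 2 (x - x0) have the antiderivatives x - x0 and (x -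
  x0)^2.\<close>

lemma LF_zero:
  assumes \<theta>: "\<theta> \<in> arb_class Ix Iu" and h: "\<And>x. x \<in> Ix \<Longrightarrow> el_h \<theta> x = 0"
  shows "LF \<theta>"
proof -
  note a = arb_classD[OF \<theta>]
  obtain u0 where u0: "u0 \<in> Iu" using open_intervalD(4)[OF Iu] by blast
  define \<Theta> where "\<Theta> m s = \<theta>\<lparr>el_h := \<lambda>x. el_h \<theta> x + s * (m x * el_g \<theta> x)\<rparr>" for m s
  have \<Theta>: "smooth_family Ix Iu (\<Theta> m)" if "smooth_on Ix m" for m
    unfolding \<Theta>_def[abs_def] by (rule deform_h_family[OF \<theta> that])
  have cl: "\<Theta> m s \<in> arb_class Ix Iu" if "smooth_on Ix m" for m s using \<Theta>[OF that] by (simp add: smooth_family_def)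
  have \<Theta>0: "\<Theta> m 0 = \<theta>" for m by (simp add: \<Theta>_def)
  have el: "el_f (\<Theta> m s) = el_f \<theta>" "el_g (\<Theta> m s) = el_g \<theta>" "el_H (\<Theta> m s) = el_H \<theta>" "el_K (\<Theta> m s) = el_K \<theta>" for m s
    by (simp_all add: \<Theta>_def)
  have hE: "el_h (\<Theta> m s) x = s * (m x * el_g \<theta> x)" if "x \<in> Ix" for m s x
    using h[OF that] by (simp add: \<Theta>_def)
  have LFs: "listed_form x0 Ix Iu (el_g \<theta>) (\<lambda>x. s * (m x * el_g \<theta> x)) (el_H \<theta>) (el_K \<theta>)
        (ratio (\<Theta> m s)) (el_h (\<eta> (\<Theta> m s))) (el_K (\<eta> (\<Theta> m s)))"
    if m: "smooth_on Ix m" "x1 \<in> Ix" "m x1 \<noteq> 0" and s: "s \<noteq> 0" for m x1 s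
  proof (rule listed_form_cong[OF Ix x0 hE refl])
    have "el_h (\<Theta> m s) x1 \<noteq> 0" unfolding hE[OF m(2)] using s m(3) a(7)[OF m(2)] by simp
    from LF_nonzero[OF cl[OF m(1)] m(2) this]
    show "listed_form x0 Ix Iu (el_g \<theta>) (el_h (\<Theta> m s)) (el_H \<theta>) (el_K \<theta>) (ratio (\<Theta> m s)) (el_h (\<eta> (\<Theta> m s))) (el_K (\<eta> (\<Theta> m s)))"
      unfolding el .
  qed
  obtain x1 where x1: "x1 \<in> Ix" "x1 \<noteq> x0" using two_points[OF Ix] by metis
  define m2 where "m2 x = 2 * (x - x0)" for x
  have s1: "smooth_on Ix (\<lambda>_. 1::real)" by (rule smooth_on_const[OF oIx])
  have "smooth_on Ix (\<lambda>x. 2 * (x + - x0))"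
    by (intro smooth_on_mult smooth_on_add smooth_on_const smooth_on_ident oIx)
  then have s2: "smooth_on Ix m2" unfolding m2_def[abs_def] by simp
  have d1: "DERIV (\<lambda>x. x - x0) x :> (1::real)" and d2: "DERIV (\<lambda>x. (x - x0)\<^sup>2) x :> m2 x" for x
    unfolding m2_def by (auto intro!: derivative_eq_intros)
  have m21: "m2 x1 \<noteq> 0" using x1 by (simp add: m2_def)
  have fr: "DERIV (\<lambda>s. ratio (\<Theta> m s) x) 0 :> deriv (\<lambda>s. ratio (\<Theta> m s) x) 0" if "smooth_on Ix m" "x \<in> Ix" for m x
    by (rule family_DERIV(1)[OF \<Theta>[OF that(1)] that(2)]) (simp add: el)
  note fh = family_DERIV(2)[OF \<Theta>] and fK = family_DERIV(3)[OF \<Theta>]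
  have Z1: "ln (ratio (\<Theta> (\<lambda>_. 1) 0) x / ratio (\<Theta> (\<lambda>_. 1) 0) x0) * (y - x0) =
        ln (ratio (\<Theta> (\<lambda>_. 1) 0) y / ratio (\<Theta> (\<lambda>_. 1) 0) x0) * (x - x0)"
    "el_h (\<eta> (\<Theta> (\<lambda>_. 1) 0)) x * (ratio (\<Theta> (\<lambda>_. 1) 0) y * 1 * el_g \<theta> y) =
        el_h (\<eta> (\<Theta> (\<lambda>_. 1) 0)) y * (ratio (\<Theta> (\<lambda>_. 1) 0) x * 1 * el_g \<theta> x)"
    if "x \<in> Ix" "y \<in> Ix" for x y
    by (rule zero_limit(2,3)[where l = "\<lambda>s. ratio (\<Theta> (\<lambda>_. 1) s)" and ?h1.0 = "\<lambda>s. el_h (\<eta> (\<Theta> (\<lambda>_. 1) s))"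
          and ?K1.0 = "\<lambda>s. el_K (\<eta> (\<Theta> (\<lambda>_. 1) s))" and m = "\<lambda>_. 1" and M = "\<lambda>x. x - x0",
          OF Ix x0 a(7) smooth_on_continuous[OF s1] d1 _ ratio_nonzero[OF cl[OF s1]]
          DERIV_isCont[OF fr[OF s1]] DERIV_isCont[OF fh[OF s1]] LFs[OF s1 x1(1)] that]; (assumption | simp))+
  have Z2: "ratio (\<Theta> m2 0) x / ratio (\<Theta> m2 0) x0 > 0"
    "ln (ratio (\<Theta> m2 0) x / ratio (\<Theta> m2 0) x0) * (y - x0)\<^sup>2 = ln (ratio (\<Theta> m2 0) y / ratio (\<Theta> m2 0) x0) * (x - x0)\<^sup>2"
    "el_h (\<eta> (\<Theta> m2 0)) x * (ratio (\<Theta> m2 0) y * m2 y * el_g \<theta> y) =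
        el_h (\<eta> (\<Theta> m2 0)) y * (ratio (\<Theta> m2 0) x * m2 x * el_g \<theta> x)"
    if "x \<in> Ix" "y \<in> Ix" for x y
    by (rule zero_limit[where l = "\<lambda>s. ratio (\<Theta> m2 s)" and ?h1.0 = "\<lambda>s. el_h (\<eta> (\<Theta> m2 s))"
          and ?K1.0 = "\<lambda>s. el_K (\<eta> (\<Theta> m2 s))" and m = m2 and M = "\<lambda>x. (x - x0)\<^sup>2",
          OF Ix x0 a(7) smooth_on_continuous[OF s2] d2 _ ratio_nonzero[OF cl[OF s2]]
          DERIV_isCont[OF fr[OF s2]] DERIV_isCont[OF fh[OF s2]] LFs[OF s2 x1(1) m21] that]; (assumption | simp))+
  note Z1' = Z1[unfolded \<Theta>0] and Z2' = Z2[unfolded \<Theta>0]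
  have cons: "ratio \<theta> x = ratio \<theta> x0" "el_h (\<eta> \<theta>) x = 0" if "x \<in> Ix" for x
    by (rule zero_limit_consequences[OF Ix x0 a(7) ratio_nonzero[OF \<theta>] Z2'(1)[OF _ x0] Z1'(1) Z2'(2)
          Z1'(2) Z2'(3)[unfolded m2_def] that]; assumption)+
  \<comment> \<open>The limits of \<open>l\<close> and \<open>h1\<close> are now known from both
    directions together; the form of the new \<open>K\<close> comes from the direction m = 1
    alone.\<close>
  have "listed_form x0 Ix Iu (el_g \<theta>) (el_h \<theta>) (el_H \<theta>) (el_K \<theta>) (ratio (\<Theta> (\<lambda>_. 1) 0))
      (el_h (\<eta> (\<Theta> (\<lambda>_. 1) 0))) (el_K (\<eta> (\<Theta> (\<lambda>_. 1) 0)))"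
  proof (rule listed_form_zero[where l = "\<lambda>s. ratio (\<Theta> (\<lambda>_. 1) s)" and ?h1.0 = "\<lambda>s. el_h (\<eta> (\<Theta> (\<lambda>_. 1) s))"
        and ?K1.0 = "\<lambda>s. el_K (\<eta> (\<Theta> (\<lambda>_. 1) s))", OF Ix x0 a(7,8) u0 h ratio_nonzero[OF cl[OF s1]] _ _
        DERIV_isCont[OF fr[OF s1]] DERIV_isCont[OF fh[OF s1]] fK[OF s1] LFs[OF s1 x1(1)]])
    show "ratio (\<Theta> (\<lambda>_. 1) 0) x = ratio (\<Theta> (\<lambda>_. 1) 0) x0" if "x \<in> Ix" for x unfolding \<Theta>0 by (rule cons(1)[OF that])
    show "el_h (\<eta> (\<Theta> (\<lambda>_. 1) 0)) x = 0" if "x \<in> Ix" for x unfolding \<Theta>0 by (rule cons(2)[OF that])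
  qed simp_all
  then show ?thesis unfolding \<Theta>0 .
qed

lemma elements_listed:
  assumes \<theta>: "\<theta> \<in> arb_class Ix Iu"
  shows "\<exists>\<epsilon>1 \<epsilon>2 \<epsilon>3 \<epsilon>4. \<epsilon>1 * \<epsilon>2 * \<epsilon>3 \<noteq> 0 \<and> listed_elements Ix Iu x0 \<delta>1 \<delta>3 \<delta>4 X \<epsilon>1 \<epsilon>2 \<epsilon>3 \<epsilon>4 \<theta> (\<Psi> \<theta>)"
proof -
  have "LF \<theta>" using LF_nonzero[OF \<theta>] LF_zero[OF \<theta>] by blast
  then obtain \<epsilon>1 \<epsilon>3 \<epsilon>4 where e: "\<epsilon>1 \<noteq> 0" "\<epsilon>3 \<noteq> 0" and
    ex: "\<And>x. x \<in> Ix \<Longrightarrow> ratio \<theta> x = \<epsilon>1 * exp (- \<epsilon>4 * antiderivative x0 (\<lambda>y. el_h \<theta> y / el_g \<theta> y) x) \<and>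
      el_h (\<eta> \<theta>) x = ratio \<theta> x * el_h \<theta> x / \<epsilon>3" and
    eu: "\<And>u. u \<in> Iu \<Longrightarrow> el_K (\<eta> \<theta>) u = \<epsilon>3 * (el_K \<theta> u + \<epsilon>4 * el_H \<theta> u)"
    unfolding listed_form_def by (elim exE conjE) (rule that; (assumption | erule (1) bspec))
  obtain \<epsilon>2 where r: "\<epsilon>2 \<noteq> 0" "\<And>u. u \<in> Iu \<Longrightarrow> el_H (\<eta> \<theta>) u = \<epsilon>2 * el_H \<theta> u"
    "\<And>x. x \<in> Ix \<Longrightarrow> el_g (\<eta> \<theta>) x = ratio \<theta> x * el_g \<theta> x / \<epsilon>2"
    by (rule reduction[OF \<theta>]) (rule that; (assumption | simp))
  have f: "el_f (\<eta> \<theta>) x = ratio \<theta> x * el_f \<theta> x" if "x \<in> Ix" for x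
    using arb_classD(6)[OF \<theta> that] by (simp add: ratio_def)
  have "listed_elements Ix Iu x0 \<delta>1 \<delta>3 \<delta>4 X \<epsilon>1 \<epsilon>2 \<epsilon>3 \<epsilon>4 \<theta> (\<Psi> \<theta>)"
  proof (rule iffD2[OF listed_elements_iff_pullback[OF \<delta>(1) X0]], assumption,
      unfold Let_def \<eta>_def[symmetric], intro conjI ballI)
    fix x assume x: "x \<in> Ix"
    let ?E = "exp (- \<epsilon>4 * antiderivative x0 (\<lambda>y. el_h \<theta> y / el_g \<theta> y) x)"
    have R: "ratio \<theta> x = \<epsilon>1 * ?E" using ex[OF x] by blast
    show "el_f (\<eta> \<theta>) x = \<epsilon>1 * el_f \<theta> x * ?E" unfolding f[OF x] R by simp
    show "el_g (\<eta> \<theta>) x = \<epsilon>1 / \<epsilon>2 * el_g \<theta> x * ?E" unfolding r(3)[OF x] R by simp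
    show "el_h (\<eta> \<theta>) x = \<epsilon>1 / \<epsilon>3 * el_h \<theta> x * ?E" unfolding conjunct2[OF ex[OF x]] R by simp
  qed (simp_all add: r(2) eu)
  then show ?thesis using e r(1) by (intro exI[of _ \<epsilon>1] exI[of _ \<epsilon>2] exI[of _ \<epsilon>3] exI[of _ \<epsilon>4]) simp
qed

end

text \<open>The \<delta>j and \<open>X\<close> are common to all tuples, since \<phi> acts on (t, x,
  u) alone. The \<epsilon>i are found tuple by tuple: \<Psi> may depend on the elements in any
  smooth way, so they may vary with the tuple. The last part treats constants independent of the
  tuple, where the smoothness of \<Psi> follows from the formulas.\<close>

theorem theorem2:
  fixes It Ix Iu :: "real set" and x0 :: real
  assumes "open_interval It" and "open_interval Ix" and "open_interval Iu" and "x0 \<in> Ix"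
  shows
    "(\<forall>\<phi> \<Psi>.
        (\<phi>, \<Psi>) \<in> ext_equiv_group It Ix Iu \<longleftrightarrow>
        smooth_operator Ix Iu (x_range (It \<times> Ix \<times> Iu) \<phi>) (u_range (It \<times> Ix \<times> Iu) \<phi>) \<Psi> \<and>
        (\<exists>\<delta>1 \<delta>2 \<delta>3 \<delta>4 X.
           listed_point_map It Ix Iu \<delta>1 \<delta>2 \<delta>3 \<delta>4 X \<phi> \<and>
           (\<forall>\<theta>\<in>arb_class Ix Iu. \<exists>\<epsilon>1 \<epsilon>2 \<epsilon>3 \<epsilon>4. \<epsilon>1 * \<epsilon>2 * \<epsilon>3 \<noteq> 0 \<and>
              listed_elements Ix Iu x0 \<delta>1 \<delta>3 \<delta>4 X \<epsilon>1 \<epsilon>2 \<epsilon>3 \<epsilon>4 \<theta> (\<Psi> \<theta>)))) \<and>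
     (\<forall>\<phi> \<Psi> \<delta>1 \<delta>2 \<delta>3 \<delta>4 X \<epsilon>1 \<epsilon>2 \<epsilon>3 \<epsilon>4.
        listed_point_map It Ix Iu \<delta>1 \<delta>2 \<delta>3 \<delta>4 X \<phi> \<and> \<epsilon>1 * \<epsilon>2 * \<epsilon>3 \<noteq> 0 \<and>
        (\<forall>\<theta>\<in>arb_class Ix Iu. listed_elements Ix Iu x0 \<delta>1 \<delta>3 \<delta>4 X \<epsilon>1 \<epsilon>2 \<epsilon>3 \<epsilon>4 \<theta> (\<Psi> \<theta>)) \<longrightarrow>
        (\<phi>, \<Psi>) \<in> ext_equiv_group It Ix Iu)"
proof -
  note It = assms(1) and Ix = assms(2) and Iu = assms(3) and x0 = assms(4)
  note op = open_intervalD(1)[OF It] open_intervalD(1)[OF Ix] open_intervalD(1)[OF Iu]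
  note range_eqs = listed_ranges[OF _ open_intervalD(4)[OF It] open_intervalD(4)[OF Ix] open_intervalD(4)[OF Iu]]
  let ?B = "It \<times> Ix \<times> Iu"
  have listed_in_group: "(\<phi>, \<Psi>) \<in> ext_equiv_group It Ix Iu"
    if so: "smooth_operator Ix Iu (x_range ?B \<phi>) (u_range ?B \<phi>) \<Psi>"
      and L: "listed_point_map It Ix Iu \<delta>1 \<delta>2 \<delta>3 \<delta>4 X \<phi>"
      and E: "\<And>\<theta>. \<theta> \<in> arb_class Ix Iu \<Longrightarrow> \<exists>\<epsilon>1 \<epsilon>2 \<epsilon>3 \<epsilon>4. \<epsilon>1 * \<epsilon>2 * \<epsilon>3 \<noteq> 0 \<and>
              listed_elements Ix Iu x0 \<delta>1 \<delta>3 \<delta>4 X \<epsilon>1 \<epsilon>2 \<epsilon>3 \<epsilon>4 \<theta> (\<Psi> \<theta>)"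
    for \<phi> \<Psi> \<delta>1 \<delta>2 \<delta>3 \<delta>4 X
  proof -
    have cl: "\<Psi> \<theta> \<in> arb_class (x_range ?B \<phi>) (u_range ?B \<phi>)" if "\<theta> \<in> arb_class Ix Iu" for \<theta>
      by (rule smooth_operator_arb_class[OF so op(2,3) that])
    have "maps_equation ?B \<phi> \<theta> (\<Psi> \<theta>)" if \<theta>: "\<theta> \<in> arb_class Ix Iu" for \<theta>
    proof -
      obtain \<epsilon>1 \<epsilon>2 \<epsilon>3 \<epsilon>4 where "\<epsilon>1 * \<epsilon>2 * \<epsilon>3 \<noteq> 0"
        "listed_elements Ix Iu x0 \<delta>1 \<delta>3 \<delta>4 X \<epsilon>1 \<epsilon>2 \<epsilon>3 \<epsilon>4 \<theta> (\<Psi> \<theta>)"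
        using E[OF \<theta>] by blast
      then show ?thesis
        by (rule listed_maps_equation[OF Ix Iu x0 L \<theta> cl[OF \<theta>, unfolded range_eqs[OF L]]])
    qed
    then show ?thesis
      unfolding ext_equiv_group_def Let_def
      using so cl listed_point_transformation[OF op L] by blast
  qed
  have group_listed: "\<exists>\<delta>1 \<delta>2 \<delta>3 \<delta>4 X. listed_point_map It Ix Iu \<delta>1 \<delta>2 \<delta>3 \<delta>4 X \<phi> \<and>
           (\<forall>\<theta>\<in>arb_class Ix Iu. \<exists>\<epsilon>1 \<epsilon>2 \<epsilon>3 \<epsilon>4. \<epsilon>1 * \<epsilon>2 * \<epsilon>3 \<noteq> 0 \<and>
              listed_elements Ix Iu x0 \<delta>1 \<delta>3 \<delta>4 X \<epsilon>1 \<epsilon>2 \<epsilon>3 \<epsilon>4 \<theta> (\<Psi> \<theta>))"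
    and group_smooth: "smooth_operator Ix Iu (x_range ?B \<phi>) (u_range ?B \<phi>) \<Psi>"
    if G: "(\<phi>, \<Psi>) \<in> ext_equiv_group It Ix Iu" for \<phi> \<Psi>
  proof -
    have pt: "point_transformation ?B \<phi>" and so: "smooth_operator Ix Iu (x_range ?B \<phi>) (u_range ?B \<phi>) \<Psi>"
      and cl: "\<And>\<theta>. \<theta> \<in> arb_class Ix Iu \<Longrightarrow> \<Psi> \<theta> \<in> arb_class (x_range ?B \<phi>) (u_range ?B \<phi>)"
      and map: "\<And>\<theta>. \<theta> \<in> arb_class Ix Iu \<Longrightarrow> maps_equation ?B \<phi> \<theta> (\<Psi> \<theta>)"
      using G unfolding ext_equiv_group_def Let_def by blast+
    show "smooth_operator Ix Iu (x_range ?B \<phi>) (u_range ?B \<phi>) \<Psi>" by (rule so)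
    interpret equivalence_transformation It Ix Iu \<phi> \<Psi>
      by (unfold_locales; fact It Ix Iu pt cl map)
    obtain \<delta>1 \<delta>2 \<delta>3 \<delta>4 where L: "listed_point_map It Ix Iu \<delta>1 \<delta>2 \<delta>3 \<delta>4 Xf \<phi>" using listed by blast
    interpret le: listed_equivalence It Ix Iu x0 \<phi> \<Psi> \<delta>1 \<delta>2 \<delta>3 \<delta>4 Xf
      by (unfold_locales; fact It Ix Iu x0 L map so[unfolded range_eqs[OF L]])
    show "\<exists>\<delta>1 \<delta>2 \<delta>3 \<delta>4 X. listed_point_map It Ix Iu \<delta>1 \<delta>2 \<delta>3 \<delta>4 X \<phi> \<and>
           (\<forall>\<theta>\<in>arb_class Ix Iu. \<exists>\<epsilon>1 \<epsilon>2 \<epsilon>3 \<epsilon>4. \<epsilon>1 * \<epsilon>2 * \<epsilon>3 \<noteq> 0 \<and>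
              listed_elements Ix Iu x0 \<delta>1 \<delta>3 \<delta>4 X \<epsilon>1 \<epsilon>2 \<epsilon>3 \<epsilon>4 \<theta> (\<Psi> \<theta>))"
      using L le.elements_listed by blast
  qed
  have uniform: "(\<phi>, \<Psi>) \<in> ext_equiv_group It Ix Iu"
    if L: "listed_point_map It Ix Iu \<delta>1 \<delta>2 \<delta>3 \<delta>4 X \<phi>" and nz: "\<epsilon>1 * \<epsilon>2 * \<epsilon>3 \<noteq> 0"
      and E: "\<forall>\<theta>\<in>arb_class Ix Iu. listed_elements Ix Iu x0 \<delta>1 \<delta>3 \<delta>4 X \<epsilon>1 \<epsilon>2 \<epsilon>3 \<epsilon>4 \<theta> (\<Psi> \<theta>)"
    for \<phi> \<Psi> \<delta>1 \<delta>2 \<delta>3 \<delta>4 X \<epsilon>1 \<epsilon>2 \<epsilon>3 \<epsilon>4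
  proof (rule listed_in_group[OF _ L])
    show "smooth_operator Ix Iu (x_range ?B \<phi>) (u_range ?B \<phi>) \<Psi>"
      unfolding range_eqs[OF L] by (rule listed_smooth_operator[OF Ix Iu x0 L nz]) (use E in blast)
  qed (use nz E in blast)
  show ?thesis
  proof (intro conjI allI)
    fix \<phi> \<Psi>
    show "(\<phi>, \<Psi>) \<in> ext_equiv_group It Ix Iu \<longleftrightarrow>
        smooth_operator Ix Iu (x_range ?B \<phi>) (u_range ?B \<phi>) \<Psi> \<and>
        (\<exists>\<delta>1 \<delta>2 \<delta>3 \<delta>4 X.
           listed_point_map It Ix Iu \<delta>1 \<delta>2 \<delta>3 \<delta>4 X \<phi> \<and>
           (\<forall>\<theta>\<in>arb_class Ix Iu. \<exists>\<epsilon>1 \<epsilon>2 \<epsilon>3 \<epsilon>4. \<epsilon>1 * \<epsilon>2 * \<epsilon>3 \<noteq> 0 \<and>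
              listed_elements Ix Iu x0 \<delta>1 \<delta>3 \<delta>4 X \<epsilon>1 \<epsilon>2 \<epsilon>3 \<epsilon>4 \<theta> (\<Psi> \<theta>)))"
      by (intro iffI conjI group_smooth group_listed; (assumption | elim conjE exE)?)
        (rule listed_in_group, assumption, assumption, blast)
  qed (use uniform in blast)
qed

end
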